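(* Let $r$ be a positive integer, let $\kappa<0$ and $p>0$ satisfy $p+(r+1)\kappa=0$, and set $p_i=p+(i-1)\kappa$ for $1\le i\le r+1$. Consider the perturbed chain of integrators $$\dot z=J_rz+(\gamma u+\varphi)e_r,\qquad z\in\mathbb{R}^r,\ u\in\mathbb{R},$$ where $\gamma,\varphi:\mathbb{R}_+\to\mathbb{R}$ are globally Lipschitz and there exist constants $\gamma_m,\gamma_M>0$ and $\overline{\gamma},\overline{\varphi},\varphi_M\ge 0$ such that, for $t\ge 0$, $$0<\gamma_m\le\gamma(t)\le\gamma_M,\qquad |\dot\gamma(t)|\le\overline{\gamma},\qquad |\dot\varphi(t)|\le\overline{\varphi},\qquad |\varphi(t)|\le\varphi_M.$$ Assume that there exist a continuous feedback law $u_0:\mathbb{R}^r\to\mathbb{R}$, homogeneous of degree $p_{r+1}$ with respect to $(\delta_\varepsilon)_{\varepsilon>0}$, such that $\dot z=J_rz+u_0(z)e_r$ is finite-time stable, and a function $V_1$ such that: (i) the vector field $z\mapsto J_rz+u_0(z)e_r$ is homogeneous of degree $\kappa$ with respect to $(\delta_\varepsilon)_{\varepsilon>0}$, and $V_1:\mathbb{R}^r\to\mathbb{R}_+$ is continuous, positive definite, $C^1$ except at the origin, homogeneous of degree $2p_{r+1}$ with respect to $(\delta_\varepsilon)_{\varepsilon>0}$, and there exist $c>0$ and $\alpha\in(0,1)$ for which the time derivative of $V_1$ along non-trivial trajectories of $\dot z=J_rz+u_0(z)e_r$ satisfies $\dot V_1\le -cV_1^\alpha$; (ii) $z\mapsto\partial_rV_1(z)$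 is homogeneous of non-negative degree with respect to $(\delta_\varepsilon)_{\varepsilon>0}$, and $z\mapsto\partial_rV_1(z)\,u_0(z)$ is non-positive over $\mathbb{R}^r$. Set $\gamma_d=(\gamma_M+\gamma_m)/2$ and $\delta_\gamma=1-\gamma_m/\gamma_M\in(0,1)$. Then, for all gains $k_P\ge 1$ and $k_I>0$, there exist $\delta_0\in(0,1)$ and $\lambda_0>0$, depending only on the gains and on the constants $\gamma_m,\gamma_M,\overline{\gamma},\overline{\varphi},\varphi_M$ (with $u_0$ and $V_1$ given), such that, if $\delta_\gamma\le\delta_0$ and $\lambda\ge\lambda_0$, the perturbed chain of integrators is stabilized in finite time by the feedback law $$u_{st}(z,t)=\frac1{\gamma_d}\Big(k_Pu_0(D_\lambda z(t))-k_I\int_{0}^{\lambda t}\partial_rV_1\big(D_\lambda z(s/\lambda)\big)\,ds\Big).$$ In particular, the feedback $u_{st}$ is continuous.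
   Context: $z=(z_1,\dots,z_r)^T\in\mathbb{R}^r$; $e_1,\dots,e_r$ is the canonical basis of $\mathbb{R}^r$; $J_r$ is the $r\times r$ nilpotent Jordan block with $(J_rz)_i=z_{i+1}$ for $1\le i\le r-1$ and $(J_rz)_r=0$, so the perturbed chain reads $\dot z_i=z_{i+1}$ for $1\le i\le r-1$, $\dot z_r=\gamma u+\varphi$. $\partial_r$ denotes the partial derivative with respect to $z_r$. For $\lambda>0$, $D_\lambda=\mathrm{diag}(\lambda^r,\lambda^{r-1},\dots,\lambda)$. Dilations: for $\varepsilon>0$, $\delta_\varepsilon(z)=(\varepsilon^{p_1}z_1,\dots,\varepsilon^{p_r}z_r)$. A real-valued function $f$ is homogeneous of degree $q$ with respect to $(\delta_\varepsilon)$ if $f(\delta_\varepsilon(z))=\varepsilon^qf(z)$ for all $\varepsilon>0$ and all $z$ (where $f$ is defined); a vector field $F$ is homogeneous of degree $q$ if $F(\delta_\varepsilon(z))=\varepsilon^q\delta_\varepsilon(F(z))$. Differential equations with discontinuous right-hand side are understood in the sense of Filippov differential inclusions. A system is finite-time stable if the origin is Lyapunov stable and every trajectory reaches the origin in finite time and stays there afterwards; a controller stabilizes a system in finite time if the resulting closed-loop trajectories $z$ converge to the origin in finite time in this sense. Bounds on derivatives of Lipschitz functions are understood at (almost every) time where they exist. *)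

theory Defs
  imports "HOL-Analysis.Analysis"
begin

section \<open>Filippov solutions\<close>

definition filippov :: "('a::euclidean_space \<Rightarrow> 'a) \<Rightarrow> 'a \<Rightarrow> 'a set" where
  "filippov f x =
    (\<Inter>d\<in>{0<..}. \<Inter>N\<in>{N. negligible N}. closure (convex hull (f ` (ball x d - N))))"

text \<open>
  Solutions of \<open>x' = f t x\<close> on \<open>[0,T)\<close>, \<open>0 < T \<le> \<infinity>\<close>. Local absolute continuity of \<open>x\<close> is expressed
  by writing \<open>x\<close> as the indefinite Lebesgue integral of its almost everywhere derivative \<open>v\<close>.
  The spatial Filippov regularisation is taken at each fixed time.
\<close>
definition filippov_solution ::
    "(real \<Rightarrow> 'a::euclidean_space \<Rightarrow> 'a) \<Rightarrow> ereal \<Rightarrow> (real \<Rightarrow> 'a) \<Rightarrow> bool" where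
  "filippov_solution f T x \<longleftrightarrow> 0 < T \<and>
    (\<exists>v. (\<forall>t\<ge>0. ereal t < T \<longrightarrow>
            v absolutely_integrable_on {0..t} \<and> x t = x 0 + integral {0..t} v) \<and>
         (AE t in lebesgue. 0 \<le> t \<and> ereal t < T \<longrightarrow> v t \<in> filippov (f t) (x t)))"

text \<open>Trajectories are the solutions that cannot be continued to the right.\<close>
definition trajectory ::
    "(real \<Rightarrow> 'a::euclidean_space \<Rightarrow> 'a) \<Rightarrow> ereal \<Rightarrow> (real \<Rightarrow> 'a) \<Rightarrow> bool" where
  "trajectory f T x \<longleftrightarrow> filippov_solution f T x \<and>
    \<not> (\<exists>T'>T. \<exists>y. filippov_solution f T' y \<and> (\<forall>t\<ge>0. ereal t < T \<longrightarrow> y t = x t))"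

definition lyapunov_stable :: "('a::euclidean_space \<Rightarrow> 'a) \<Rightarrow> bool" where
  "lyapunov_stable f \<longleftrightarrow> (\<forall>\<epsilon>>0. \<exists>\<delta>>0. \<forall>T x. trajectory (\<lambda>_. f) T x \<longrightarrow> norm (x 0) < \<delta> \<longrightarrow>
    (\<forall>t\<ge>0. ereal t < T \<longrightarrow> norm (x t) < \<epsilon>))"

definition finite_time_stable :: "('a::euclidean_space \<Rightarrow> 'a) \<Rightarrow> bool" where
  "finite_time_stable f \<longleftrightarrow> lyapunov_stable f \<and>
    (\<forall>T x. trajectory (\<lambda>_. f) T x \<longrightarrow> T = \<infinity> \<and> (\<exists>\<tau>\<ge>0. \<forall>t\<ge>\<tau>. x t = 0))"


section \<open>Chains of integrators\<close>

text \<open>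
  The space \<open>\<real>\<^sup>r\<close> is \<open>real ^ 'n\<close> for a finite linearly ordered index type with \<open>CARD('n) = r\<close>;
  \<open>idx i \<in> {1..r}\<close> is the position of the index \<open>i\<close>, and the last index plays the role of \<open>r\<close>.
\<close>
definition idx :: "'n::{finite,linorder} \<Rightarrow> nat" where
  "idx i = card {j. j \<le> i}"

definition last_ix :: "'n::{finite,linorder}" where
  "last_ix = Max UNIV"

definition next_ix :: "'n::{finite,linorder} \<Rightarrow> 'n" where
  "next_ix i = Min {j. i < j}"

definition e_last :: "real ^ 'n::{finite,linorder}" where
  "e_last = axis last_ix 1"

definition J :: "real ^ 'n::{finite,linorder} \<Rightarrow> real ^ 'n::{finite,linorder}" where
  "J z = (\<chi> i. if i = last_ix then 0 else z $ next_ix i)"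

definition Dscale ::
    "real \<Rightarrow> real ^ 'n::{finite,linorder} \<Rightarrow> real ^ 'n::{finite,linorder}" where
  "Dscale lam z = (\<chi> i. lam ^ (CARD('n) + 1 - idx i) * z $ i)"

definition wt :: "real \<Rightarrow> real \<Rightarrow> nat \<Rightarrow> real" where
  "wt p \<kappa> i = p + (real i - 1) * \<kappa>"

definition dil ::
    "real \<Rightarrow> real \<Rightarrow> real \<Rightarrow> real ^ 'n::{finite,linorder} \<Rightarrow> real ^ 'n::{finite,linorder}" where
  "dil p \<kappa> \<epsilon> z = (\<chi> i. \<epsilon> powr wt p \<kappa> (idx i) * z $ i)"

text \<open>The set \<open>S\<close> is the domain of definition of the function.\<close>
definition homogeneous_on ::
    "real \<Rightarrow> real \<Rightarrow> (real ^ 'n::{finite,linorder}) set \<Rightarrow> real \<Rightarrow>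
     (real ^ 'n::{finite,linorder} \<Rightarrow> real) \<Rightarrow> bool" where
  "homogeneous_on p \<kappa> S q f \<longleftrightarrow> (\<forall>\<epsilon>>0. \<forall>z\<in>S. f (dil p \<kappa> \<epsilon> z) = \<epsilon> powr q * f z)"

definition homogeneous_field ::
    "real \<Rightarrow> real \<Rightarrow> real \<Rightarrow> (real ^ 'n::{finite,linorder} \<Rightarrow> real ^ 'n::{finite,linorder}) \<Rightarrow> bool" where
  "homogeneous_field p \<kappa> q F \<longleftrightarrow>
    (\<forall>\<epsilon>>0. \<forall>z. F (dil p \<kappa> \<epsilon> z) = \<epsilon> powr q *\<^sub>R dil p \<kappa> \<epsilon> (F z))"

definition partial_last ::
    "(real ^ 'n::{finite,linorder} \<Rightarrow> real) \<Rightarrow> real ^ 'n::{finite,linorder} \<Rightarrow> real" where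
  "partial_last V z = deriv (\<lambda>s. V (z + s *\<^sub>R e_last)) 0"

definition C1_on :: "(real ^ 'n) set \<Rightarrow> (real ^ 'n \<Rightarrow> real) \<Rightarrow> bool" where
  "C1_on S V \<longleftrightarrow> (\<exists>G. (\<forall>z\<in>S. GDERIV V z :> G z) \<and> continuous_on S G)"

definition nominal ::
    "(real ^ 'n::{finite,linorder} \<Rightarrow> real) \<Rightarrow> real ^ 'n::{finite,linorder} \<Rightarrow> real ^ 'n::{finite,linorder}" where
  "nominal u0 z = J z + u0 z *\<^sub>R e_last"

text \<open>
  Only the almost everywhere derivative is constrained; its almost everywhere existence is
  automatic for Lipschitz functions.
\<close>
definition lipschitz_with_rate :: "real \<Rightarrow> (real \<Rightarrow> real) \<Rightarrow> bool" where
  "lipschitz_with_rate M g \<longleftrightarrow> (\<exists>L. L-lipschitz_on {0..} g) \<and>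
    (AE t in lebesgue. 0 < t \<longrightarrow> (\<exists>d. (g has_real_derivative d) (at t) \<and> \<bar>d\<bar> \<le> M))"


section \<open>The closed loop\<close>

text \<open>
  The state \<open>w\<close> carries the integral \<open>w t = \<integral>\<^sub>0\<^bsup>\<lambda>t\<^esup> \<partial>\<^sub>r V1 (D\<^sub>\<lambda> (z (s/\<lambda>))) ds\<close>. By the substitution
  \<open>s = \<lambda>\<tau>\<close> it satisfies \<open>w 0 = 0\<close> and \<open>w' = \<lambda> \<partial>\<^sub>r V1 (D\<^sub>\<lambda> z)\<close>. As \<open>\<partial>\<^sub>r V1\<close> is in general
  discontinuous (and undefined) at the origin, the integral is understood through the Filippov
  inclusion for the pair \<open>(z, w)\<close>; the value of \<open>partial_last V1\<close> at \<open>0\<close> is immaterial there.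
\<close>
definition u_st ::
    "real \<Rightarrow> real \<Rightarrow> real \<Rightarrow> real \<Rightarrow>
     (real ^ 'n::{finite,linorder} \<Rightarrow> real) \<Rightarrow>
     real ^ 'n::{finite,linorder} \<Rightarrow> real \<Rightarrow> real"
  where
  "u_st \<gamma>d kP kI lam u0 z w = (1 / \<gamma>d) * (kP * u0 (Dscale lam z) - kI * w)"

definition closed_loop ::
    "real \<Rightarrow> real \<Rightarrow> real \<Rightarrow> real \<Rightarrow>
     (real ^ 'n::{finite,linorder} \<Rightarrow> real) \<Rightarrow>
     (real ^ 'n::{finite,linorder} \<Rightarrow> real) \<Rightarrow>
     (real \<Rightarrow> real) \<Rightarrow> (real \<Rightarrow> real) \<Rightarrow> real \<Rightarrow>
     (real ^ 'n::{finite,linorder}) \<times> real \<Rightarrow>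
     (real ^ 'n::{finite,linorder}) \<times> real" where
  "closed_loop \<gamma>d kP kI lam u0 V1 \<gamma> \<phi> t = (\<lambda>(z, w).
     (J z + (\<gamma> t * u_st \<gamma>d kP kI lam u0 z w + \<phi> t) *\<^sub>R e_last,
      lam * partial_last V1 (Dscale lam z)))"

end

theory Submission
  imports Defs "HOL-Complex_Analysis.Great_Picard"
begin

text \<open>
  Put \<open>y = D\<^sub>\<lambda> z\<close> and let the integrator state take the place of an additional integrator at the end of
  the chain. Up to the time scale \<open>\<lambda>\<close>, the closed loop without uncertainty is
  \<open>y' = J y + (k\<^sub>P u\<^sub>0(y) + \<eta>) e\<^sub>r\<close>, \<open>\<eta>' = - k\<^sub>I \<partial>\<^sub>r V\<^sub>1(y)\<close>, and the condition \<open>p + (r+1) \<kappa> = 0\<close> makes \<open>\<partial>\<^sub>r V\<^sub>1\<close>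
  homogeneous of degree zero, so that the pair \<open>(y, \<eta>)\<close> is again homogeneous of degree \<open>\<kappa>\<close>. The function
  \<open>W = k\<^sub>I V\<^sub>1(y) + \<eta>\<^sup>2/2\<close> is nonincreasing along solutions, since the terms \<open>\<eta> \<partial>\<^sub>r V\<^sub>1\<close> cancel and
  \<open>(k\<^sub>P - 1) u\<^sub>0 \<partial>\<^sub>r V\<^sub>1 \<le> 0\<close>.

  Instead of an invariance principle, which would give no robustness, \<open>W\<close> is made strict by a cross term:
  \<open>W\<^sup>3\<^sup>/\<^sup>2 - \<epsilon> y\<^sub>r \<eta>\<close> has a derivative bounded by a negative multiple of \<open>W\<close>, and its cube root
  \<open>M\<close> decreases at a constant rate (\<open>strict_lyapunov_exists\<close>). This persists under homogeneous perturbations of small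
  relative size. The needed decay of \<open>V\<^sub>1\<close> at a point comes from its decay along trajectories
  (\<open>gradient_decay\<close>), which uses Peano's existence theorem (\<open>peano_bounded\<close>).

  The uncertainty is handled in two phases (\<open>finite_time_convergence\<close>). Far from the origin a small \<open>\<delta>\<^sub>\<gamma>\<close>
  makes the variation of \<open>\<gamma>\<close> a small relative perturbation and \<open>\<phi>\<close> is of lower order, whatever \<open>\<lambda>\<close>
  is; this confines the integrator state to a bounded set independent of the initial state. There the
  disturbance is absorbed into the integrator state, and only its derivative, divided by \<open>\<lambda>\<close>, remains;
  for \<open>\<lambda>\<close> large \<open>M\<close> then vanishes in finite time.

  Two points are delicate. First, \<open>V\<^sub>1\<close> is not differentiable where \<open>y = 0\<close>, which happens at times when
  \<open>\<eta> \<noteq> 0\<close>. Such times are isolated, and \<open>M\<close> is continuous there, so that a monotonicity lemma tolerating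
  countable and, for the almost everywhere derivatives of \<open>\<gamma>\<close> and \<open>\<phi>\<close>, null exceptional sets
  (\<open>decrease_of_derivative_off_exceptional\<close>) suffices. Secondly, a trajectory might stop existing in finite time.
  Since it stays bounded, this is excluded by continuing it (\<open>continuation\<close>), in particular from the
  origin, where the continuation stays at \<open>z = 0\<close> and uses that \<open>\<partial>\<^sub>r V\<^sub>1\<close> takes values of both signs.
\<close>

section \<open>Monotonicity from almost everywhere derivatives\<close>

text \<open>
  Calmness is the pointwise Lipschitz property: the constant may change from point to point. It is
  all that is needed to map null sets to null sets, and, unlike a Lipschitz bound on an interval, it
  follows from mere differentiability and so survives composition with functions whose gradient is
  unbounded.
\<close>
definition calm_at :: "(real \<Rightarrow> real) \<Rightarrow> real \<Rightarrow> bool" where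
  "calm_at f x \<longleftrightarrow> (\<exists>B. \<forall>\<^sub>F y in nhds x. \<bar>f y - f x\<bar> \<le> B * \<bar>y - x\<bar>)"

lemma calm_atE:
  assumes "calm_at f x"
  obtains B where "B > 0" "\<forall>\<^sub>F y in nhds x. \<bar>f y - f x\<bar> \<le> B * \<bar>y - x\<bar>"
proof -
  obtain B where B: "\<forall>\<^sub>F y in nhds x. \<bar>f y - f x\<bar> \<le> B * \<bar>y - x\<bar>"
    using assms unfolding calm_at_def by blast
  have "\<forall>\<^sub>F y in nhds x. \<bar>f y - f x\<bar> \<le> (\<bar>B\<bar> + 1) * \<bar>y - x\<bar>"
    using B by eventually_elim (smt (verit) mult_right_mono abs_ge_zero)
  then show ?thesis by (intro that[of "\<bar>B\<bar> + 1"]) auto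
qed

lemma calm_at_lipschitz:
  assumes "L-lipschitz_on S f" "x \<in> interior S"
  shows "calm_at f x"
proof -
  have "\<forall>\<^sub>F y in nhds x. y \<in> S"
    using eventually_nhds_in_open[OF open_interior assms(2)]
    by (rule eventually_mono) (use interior_subset in auto)
  then have "\<forall>\<^sub>F y in nhds x. \<bar>f y - f x\<bar> \<le> L * \<bar>y - x\<bar>"
  proof eventually_elim
    case (elim y)
    then show ?case
      using lipschitz_onD[OF assms(1) elim, of x] assms(2) interior_subset[of S]
      by (auto simp: dist_real_def)
  qed
  then show ?thesis unfolding calm_at_def by blast
qed

lemma calm_compose:
  fixes c :: "real \<Rightarrow> 'a::real_normed_vector" and F :: "'a \<Rightarrow> real"
  assumes "F differentiable (at (c x))" "continuous (at x) c"
    and "\<forall>\<^sub>F y in nhds x. norm (c y - c x) \<le> B * \<bar>y - x\<bar>"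
  shows "calm_at (\<lambda>t. F (c t)) x"
proof -
  obtain D where D: "(F has_derivative D) (at (c x))"
    using assms(1) unfolding differentiable_def by blast
  then have bl: "bounded_linear D" by (rule has_derivative_bounded_linear)
  then obtain K where K: "\<And>v. norm (D v) \<le> norm v * K" "K > 0"
    using bounded_linear.pos_bounded by blast
  obtain d where d: "d > 0" "\<And>y. norm (y - c x) < d \<Longrightarrow> norm (F y - F (c x) - D (y - c x)) \<le> 1 * norm (y - c x)"
    using D unfolding has_derivative_at_alt using zero_less_one by blast
  have "\<forall>\<^sub>F y in nhds x. dist (c y) (c x) < d"
    using assms(2) d(1) 
    by (metis continuous_within tendstoD tendsto_at_iff_tendsto_nhds)
  with assms(3) have "\<forall>\<^sub>F y in nhds x. \<bar>F (c y) - F (c x)\<bar> \<le> ((K + 1) * B) * \<bar>y - x\<bar>"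
  proof eventually_elim
    case (elim y)
    have "norm (F (c y) - F (c x)) \<le> norm (D (c y - c x)) + norm (F (c y) - F (c x) - D (c y - c x))"
      using norm_triangle_sub by blast
    also have "\<dots> \<le> norm (c y - c x) * K + 1 * norm (c y - c x)"
      using K(1) d(2)[of "c y"] elim(2) by (intro add_mono) (auto simp: dist_norm)
    also have "\<dots> = (K + 1) * norm (c y - c x)" by (simp add: algebra_simps)
    also have "\<dots> \<le> (K + 1) * (B * \<bar>y - x\<bar>)"
      using elim(1) K(2) by (intro mult_left_mono) auto
    finally show ?case by (simp add: mult.assoc)
  qed
  then show ?thesis unfolding calm_at_def by blast
qed

lemma calm_imp_continuous:
  assumes "calm_at f x" shows "isCont f x"
proof -
  obtain B where B: "B > 0" "\<forall>\<^sub>F y in nhds x. \<bar>f y - f x\<bar> \<le> B * \<bar>y - x\<bar>"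
    using calm_atE[OF assms] by blast
  have "((\<lambda>y. f y - f x) \<longlongrightarrow> 0) (at x)"
  proof (rule Lim_null_comparison)
    show "\<forall>\<^sub>F y in at x. norm (f y - f x) \<le> B * \<bar>y - x\<bar>"
      using B(2) by (auto simp: eventually_at_filter elim: eventually_mono)
    show "((\<lambda>y. B * \<bar>y - x\<bar>) \<longlongrightarrow> 0) (at x)"
      by (auto intro!: tendsto_eq_intros)
  qed
  then show ?thesis unfolding isCont_def by (simp add: LIM_zero_iff)
qed

lemma calm_at_DERIV:
  assumes "(f has_real_derivative d) (at x)" shows "calm_at f x"
proof -
  have "calm_at (\<lambda>t. f t) x"
  proof (rule calm_compose[where c = "\<lambda>t. t" and B = 1])
    show "f differentiable (at x)" unfolding real_differentiable_def using assms by blast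
  qed auto
  then show ?thesis by simp
qed

lemma calm_at_add:
  assumes "calm_at f x" "calm_at g x" shows "calm_at (\<lambda>t. f t + g t) x"
proof -
  obtain A where A: "\<forall>\<^sub>F y in nhds x. \<bar>f y - f x\<bar> \<le> A * \<bar>y - x\<bar>"
    using assms(1) calm_at_def by blast
  obtain B where B: "\<forall>\<^sub>F y in nhds x. \<bar>g y - g x\<bar> \<le> B * \<bar>y - x\<bar>"
    using assms(2) calm_at_def by blast
  have "\<forall>\<^sub>F y in nhds x. \<bar>(f y + g y) - (f x + g x)\<bar> \<le> (A + B) * \<bar>y - x\<bar>"
    using A B by eventually_elim (auto simp: algebra_simps)
  then show ?thesis unfolding calm_at_def by blast
qed

lemma calm_at_Pair_compose:
  fixes F :: "'a::real_normed_vector \<times> real \<Rightarrow> real"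
  assumes "(y has_vector_derivative y') (at x)" "calm_at g x" "F differentiable (at (y x, g x))"
  shows "calm_at (\<lambda>t. F (y t, g t)) x"
proof -
  obtain B where B: "B > 0" "\<forall>\<^sub>F t in nhds x. \<bar>g t - g x\<bar> \<le> B * \<bar>t - x\<bar>"
    using calm_atE[OF assms(2)] by blast
  obtain d where d: "d > 0" "\<And>t. norm (t - x) < d \<Longrightarrow> norm (y t - y x - (t - x) *\<^sub>R y') \<le> 1 * norm (t - x)"
    using assms(1) unfolding has_vector_derivative_def has_derivative_at_alt using zero_less_one by blast
  have "\<forall>\<^sub>F t in nhds x. norm (t - x) < d"
    unfolding eventually_nhds_metric using d(1) by (auto simp: dist_norm)
  with B(2) have ev: "\<forall>\<^sub>F t in nhds x. norm ((y t, g t) - (y x, g x)) \<le> (norm y' + 1 + B) * \<bar>t - x\<bar>"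
  proof eventually_elim
    case (elim t)
    have "norm ((y t, g t) - (y x, g x)) \<le> norm (y t - y x) + \<bar>g t - g x\<bar>"
      using norm_Pair_le[of "y t - y x" "g t - g x"] by simp
    moreover have "norm (y t - y x) \<le> norm ((t - x) *\<^sub>R y') + norm (y t - y x - (t - x) *\<^sub>R y')"
      using norm_triangle_sub by blast
    moreover have "norm ((t - x) *\<^sub>R y') = norm y' * \<bar>t - x\<bar>" by simp
    moreover have "norm (y t - y x - (t - x) *\<^sub>R y') \<le> \<bar>t - x\<bar>" using d(2)[of t] elim by simp
    moreover have "\<bar>g t - g x\<bar> \<le> B * \<bar>t - x\<bar>" using elim by simp
    ultimately have "norm ((y t, g t) - (y x, g x)) \<le> norm y' * \<bar>t - x\<bar> + \<bar>t - x\<bar> + B * \<bar>t - x\<bar>"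
      by linarith
    then show ?case by (simp add: distrib_right)
  qed
  have "continuous (at x) (\<lambda>t. (y t, g t))"
    using assms(1) calm_imp_continuous[OF assms(2)]
    by (intro continuous_Pair) (auto intro: has_vector_derivative_continuous)
  from calm_compose[OF assms(3) this ev] show ?thesis .
qed

lemma calm_at_mult:
  fixes f g :: "real \<Rightarrow> real"
  assumes "calm_at f x" "(g has_real_derivative g') (at x)" shows "calm_at (\<lambda>t. f t * g t) x"
proof -
  have "(\<lambda>q::real \<times> real. fst q * snd q) differentiable (at (g x, f x))"
    by (intro differentiable_mult bounded_linear_imp_differentiable bounded_linear_fst bounded_linear_snd)
  moreover have "(g has_vector_derivative g') (at x)"
    using assms(2) by (simp add: has_real_derivative_iff_has_vector_derivative)
  ultimately have "calm_at (\<lambda>t. fst (g t, f t) * snd (g t, f t)) x"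
    by (intro calm_at_Pair_compose[where F = "\<lambda>q. fst q * snd q" and y = g and g = f] assms(1))
  then show ?thesis by (simp add: mult.commute)
qed

lemma negligible_calm_image:
  assumes "negligible N" "\<And>x. x \<in> N \<Longrightarrow> calm_at f x"
  shows "negligible (f ` N)"
proof (rule negligible_locally_Lipschitz_image)
  fix x assume "x \<in> N"
  then obtain B where "\<forall>\<^sub>F y in nhds x. \<bar>f y - f x\<bar> \<le> B * \<bar>y - x\<bar>"
    using assms(2) calm_at_def by blast
  then show "\<exists>T B. open T \<and> x \<in> T \<and> (\<forall>y\<in>N \<inter> T. norm (f y - f x) \<le> B * norm (y - x))"
    unfolding eventually_nhds by (metis IntD2 real_norm_def)
qed (use assms in auto)

text \<open>
  Zygmund's argument. If \<open>f\<close> increased, some level \<open>c\<close> strictly between \<open>f s\<close> and \<open>f t\<close> would lie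
  outside the null set \<open>f ` E\<close>. At the last point where \<open>f \<le> c\<close> the derivative exists and is negative,
  although \<open>f > c\<close> immediately to the right of it.
\<close>
lemma nonincreasing_of_derivative_off_negligible:
  fixes f :: "real \<Rightarrow> real"
  assumes st: "s \<le> t" and cont: "continuous_on {s..t} f"
    and img: "negligible (f ` E)"
    and der: "\<And>x. x \<in> {s<..<t} - E \<Longrightarrow> \<exists>d<0. (f has_real_derivative d) (at x)"
  shows "f t \<le> f s"
proof (rule ccontr)
  assume "\<not> f t \<le> f s"
  then have lt: "f s < f t" by simp
  have "\<not> {f s<..<f t} \<subseteq> f ` E"
    using negligible_subset[OF img] lt open_not_negligible[of "{f s<..<f t}"]
    by (metis greaterThanLessThan_empty_iff leD open_greaterThanLessThan)
  then obtain c where c: "f s < c" "c < f t" "c \<notin> f ` E"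
    by (meson greaterThanLessThan_iff subsetI)
  define A where "A = {x \<in> {s..t}. f x \<le> c}"
  have clA: "closed A"
    unfolding A_def by (rule continuous_on_closed_Collect_le[OF cont]) auto
  have sA: "s \<in> A" using st c by (auto simp: A_def)
  have bdd: "bdd_above A" by (auto simp: A_def bdd_above_def)
  define m where "m = Sup A"
  have mA: "m \<in> A" unfolding m_def using closed_contains_Sup[of A] clA bdd sA by blast
  have ge: "f x > c" if "x \<in> {m<..t}" for x
  proof (rule ccontr)
    assume "\<not> f x > c"
    then have "x \<in> A" using that mA by (auto simp: A_def)
    then have "x \<le> m" unfolding m_def using bdd by (simp add: cSup_upper)
    with that show False by auto
  qed
  have mt: "m < t" using mA c by (auto simp: A_def less_le)
  have fm: "f m = c"
  proof (rule ccontr)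
    assume "f m \<noteq> c"
    then have "f m < c" using mA by (auto simp: A_def)
    then obtain x where x: "m \<le> x" "x \<le> t" "f x = c"
      using IVT'[of f m c t] c mt continuous_on_subset[OF cont] mA by (force simp: A_def)
    with \<open>f m < c\<close> ge[of x] show False by (cases "x = m") auto
  qed
  then have "m \<in> {s<..<t} - E" using c mt mA by (auto simp: A_def less_le)
  then obtain d where d: "d < 0" "(f has_real_derivative d) (at m)" using der by blast
  obtain e where e: "e > 0" "\<And>h. h > 0 \<Longrightarrow> h < e \<Longrightarrow> f m > f (m + h)"
    using DERIV_neg_dec_right[OF d(2,1)] by blast
  define h where "h = min (e/2) (t - m)"
  have "h > 0" "h < e" "m + h \<in> {m<..t}" using e mt by (auto simp: h_def min_def)
  with e(2)[of h] ge[of "m + h"] fm show False by auto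
qed

text \<open>
  The image of the exceptional set is null: countable on \<open>C\<close> because images of countable sets are
  countable, null on \<open>N\<close> by calmness. Two exceptional sets are distinguished because continuity
  suffices on the countable one.
\<close>
lemma decrease_of_derivative_off_exceptional:
  fixes f :: "real \<Rightarrow> real"
  assumes st: "s \<le> t" and cont: "continuous_on {s..t} f"
    and C: "countable C" and N: "negligible N"
    and calm: "\<And>x. x \<in> {s<..<t} \<inter> N - C \<Longrightarrow> calm_at f x"
    and der: "\<And>x. x \<in> {s<..<t} - N - C \<Longrightarrow> \<exists>d\<le>-b. (f has_real_derivative d) (at x)"
  shows "f t \<le> f s - b * (t - s)"
proof -
  \<comment> \<open>A strictly negative derivative is needed, so \<open>b\<close> is approached by smaller rates.\<close>
  have *: "f t \<le> f s - b' * (t - s)" if b': "b' < b" for b'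
  proof -
    define F where "F x = f x + b' * x" for x
    let ?N = "{s<..<t} \<inter> N - C"
    let ?E = "?N \<union> C"
    have "negligible (F ` ?N)"
    proof (rule negligible_calm_image)
      show "negligible ?N" using N by (meson Diff_subset Int_lower2 negligible_subset)
      show "calm_at F x" if "x \<in> ?N" for x
        unfolding F_def using calm[OF that]
        by (rule calm_at_add) (auto intro!: calm_at_DERIV derivative_eq_intros)
    qed
    moreover have "negligible (F ` C)"
      using C by (intro negligible_iff_null_sets[THEN iffD2] countable_imp_null_set_lborel[THEN null_sets_completionI]) auto
    ultimately have img: "negligible (F ` ?E)"
      by (simp only: image_Un negligible_Un)
    have "F t \<le> F s"
    proof (rule nonincreasing_of_derivative_off_negligible[OF st _ img])
      show "continuous_on {s..t} F" unfolding F_def by (intro continuous_intros cont)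
      fix x assume "x \<in> {s<..<t} - ?E"
      then obtain d where "d \<le> - b" "(f has_real_derivative d) (at x)" using der[of x] by blast
      then show "\<exists>d<0. (F has_real_derivative d) (at x)"
        unfolding F_def using b' by (intro exI[of _ "d + b'"]) (auto intro!: derivative_eq_intros)
    qed
    then show ?thesis by (simp add: F_def algebra_simps)
  qed
  have "\<forall>\<^sub>F b' in at_left b. f t \<le> f s - b' * (t - s)"
    using * by (auto simp: eventually_at_filter)
  moreover have "((\<lambda>b'. f s - b' * (t - s)) \<longlongrightarrow> f s - b * (t - s)) (at_left b)"
    by (auto intro!: tendsto_eq_intros)
  ultimately show ?thesis
    using tendsto_lowerbound[of _ _ "at_left b" "f t"] by (simp add: trivial_limit_at_left_real)
qed

text \<open>
  A function that decreases at rate \<open>b\<close> wherever it exceeds \<open>R\<close> cannot get back above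
  \<open>max R (f s - b * (t - s))\<close>: consider what happens after the last time it was below that line.
\<close>
lemma barrier_decrease:
  fixes f :: "real \<Rightarrow> real"
  assumes st: "s \<le> t" and cont: "continuous_on {s..t} f" and b: "b > 0"
    and dec: "\<And>a c. s \<le> a \<Longrightarrow> a \<le> c \<Longrightarrow> c \<le> t \<Longrightarrow> (\<And>x. x \<in> {a..c} \<Longrightarrow> f x > R) \<Longrightarrow> f c \<le> f a - b * (c - a)"
  shows "f t \<le> max R (f s - b * (t - s))"
proof (rule ccontr)
  assume neg: "\<not> f t \<le> max R (f s - b * (t - s))"
  define g where "g x = max R (f s - b * (x - s))" for x
  define A where "A = {x \<in> {s..t}. f x \<le> g x}"
  have clA: "closed A" unfolding A_def g_def
    by (rule continuous_on_closed_Collect_le[OF cont]) (auto intro!: continuous_intros)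
  have sA: "s \<in> A" using st by (auto simp: A_def g_def)
  have bdd: "bdd_above A" by (auto simp: A_def bdd_above_def)
  define m where "m = Sup A"
  have mA: "m \<in> A" unfolding m_def using closed_contains_Sup[of A] clA bdd sA by blast
  have ge: "f x > g x" if "x \<in> {m<..t}" for x
  proof (rule ccontr)
    assume "\<not> f x > g x"
    then have "x \<in> A" using that mA by (auto simp: A_def)
    then have "x \<le> m" unfolding m_def using bdd by (simp add: cSup_upper)
    with that show False by auto
  qed
  have mt: "m < t" using mA neg by (auto simp: A_def g_def less_le)
  have "f t \<le> f a - b * (t - a)" if "a \<in> {m<..t}" for a
    using that ge mA by (intro dec) (auto simp: A_def g_def)
  then have "\<forall>\<^sub>F a in at_right m. f t \<le> f a - b * (t - a)"
    using mt unfolding eventually_at_right_field by (intro exI[of _ t]) auto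
  moreover have "((\<lambda>a. f a - b * (t - a)) \<longlongrightarrow> f m - b * (t - m)) (at_right m)"
  proof -
    have "continuous (at m within {s..t}) f" using cont mA by (auto simp: A_def continuous_on_eq_continuous_within)
    then have "(f \<longlongrightarrow> f m) (at m within {m<..t})"
      unfolding continuous_within by (rule tendsto_within_subset) (use mA A_def in auto)
    moreover have "at m within {m<..t} = at_right m"
      using mt by (auto intro!: at_within_nhd[of _ "{..<t}"])
    ultimately have "(f \<longlongrightarrow> f m) (at_right m)" by simp
    then show ?thesis by (auto intro!: tendsto_eq_intros)
  qed
  ultimately have "f t \<le> f m - b * (t - m)"
    using tendsto_lowerbound[of _ _ "at_right m" "f t"] by (simp add: trivial_limit_at_right_real)
  moreover have "f m \<le> g m" using mA by (simp add: A_def)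
  moreover have "b * (t - m) \<ge> 0" using b mt by auto
  ultimately have "f t \<le> max R (f s - b * (t - s))"
    unfolding g_def by (auto simp: max_def algebra_simps split: if_splits)
  with neg show False by simp
qed

lemmas hk_integral_combine = Henstock_Kurzweil_Integration.integral_combine
  and hk_integral_cong = Henstock_Kurzweil_Integration.integral_cong

section \<open>The fundamental theorem of calculus for Lipschitz functions\<close>

lemma integral_norm_le_interval:
  fixes f :: "real \<Rightarrow> 'a::euclidean_space"
  assumes "f integrable_on {a..b}" "a \<le> b" "\<And>t. t \<in> {a..b} \<Longrightarrow> norm (f t) \<le> B"
  shows "norm (integral {a..b} f) \<le> B * (b - a)"
proof -
  have "0 \<le> B" using assms(3)[of a] assms(2) by (smt (verit) atLeastAtMost_iff norm_ge_zero)
  then show ?thesis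
    using has_integral_bound_real[of B "{}" f "integral {a..b} f" a b] assms
    by (auto simp: integrable_integral)
qed

lemma integral_difference_quotient_tendsto:
  fixes F :: "real \<Rightarrow> real"
  assumes L: "L-lipschitz_on UNIV F"
  shows "(\<lambda>n. real (Suc n) * integral {c..c + 1 / real (Suc n)} F) \<longlonglongrightarrow> F c"
proof (rule Lim_transform_bound[THEN LIM_zero_cancel])
  have cont: "continuous_on S F" for S
    using lipschitz_on_continuous_on[OF L] continuous_on_subset by blast
  show "(\<lambda>n. L * (1 / real (Suc n))) \<longlonglongrightarrow> 0"
    using tendsto_mult_right_zero[OF LIMSEQ_inverse_real_of_nat, of L] by (simp add: divide_inverse)
  show "\<forall>\<^sub>F n in sequentially. norm (real (Suc n) * integral {c..c + 1 / real (Suc n)} F - F c) \<le> norm (L * (1 / real (Suc n)))"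
  proof (intro always_eventually allI)
    fix n
    define h where "h = 1 / real (Suc n)"
    have h: "h > 0" "real (Suc n) * h = 1" by (auto simp: h_def)
    have L0: "L \<ge> 0" using L lipschitz_on_nonneg by blast
    have "norm (integral {c..c + h} (\<lambda>x. F x - F c)) \<le> (L * h) * (c + h - c)"
    proof (rule integral_norm_le_interval)
      show "(\<lambda>x. F x - F c) integrable_on {c..c + h}"
        by (intro integrable_continuous_real continuous_intros cont)
      fix t assume "t \<in> {c..c + h}"
      then have "\<bar>F t - F c\<bar> \<le> L * \<bar>t - c\<bar>"
        using lipschitz_onD[OF L, of t c] by (simp add: dist_real_def)
      also have "\<dots> \<le> L * h" using \<open>t \<in> _\<close> L0 by (intro mult_left_mono) auto
      finally show "norm (F t - F c) \<le> L * h" by simp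
    qed (use h in auto)
    also have "integral {c..c + h} (\<lambda>x. F x - F c) = integral {c..c + h} F - h * F c"
      using h(1) by (subst integral_diff) (auto intro!: integrable_continuous_real cont)
    finally have "real (Suc n) * \<bar>integral {c..c + h} F - h * F c\<bar> \<le> real (Suc n) * (L * h * h)"
      by (intro mult_left_mono) auto
    also have "real (Suc n) * (L * h * h) = L * h" using h(2) by (metis mult.left_commute mult.right_neutral mult.assoc)
    finally have "\<bar>real (Suc n) * (integral {c..c + h} F - h * F c)\<bar> \<le> L * h" by (simp add: abs_mult)
    moreover have "real (Suc n) * (integral {c..c + h} F - h * F c) = real (Suc n) * integral {c..c + h} F - F c"
      using h(2) by (metis (no_types, lifting) mult.assoc mult_1 right_diff_distrib)
    ultimately show "norm (real (Suc n) * integral {c..c + 1 / real (Suc n)} F - F c) \<le> norm (L * (1 / real (Suc n)))"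
      unfolding h_def[symmetric] real_norm_def using L0 h(1) by (metis abs_of_nonneg less_imp_le mult_nonneg_nonneg)
  qed
qed

text \<open>
  Integrating a difference quotient over \<open>{a..b}\<close> leaves only two averages of the function, over
  short intervals at \<open>b\<close> and at \<open>a\<close>, which tend to the endpoint values. The quotients are bounded by
  the Lipschitz constant and converge almost everywhere, so dominated convergence gives both the
  integrability of the derivative and the value of its integral.
\<close>
lemma lipschitz_has_integral_derivative:
  fixes f f' :: "real \<Rightarrow> real"
  assumes L: "L-lipschitz_on {a..b} f" and ab: "a \<le> b" and N: "negligible N"
    and der: "\<And>x. x \<in> {a<..<b} - N \<Longrightarrow> (f has_real_derivative f' x) (at x)"
  shows "(f' has_integral (f b - f a)) {a..b}" and "f' absolutely_integrable_on {a..b}"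
proof -
  \<comment> \<open>Constant continuation makes \<open>F (x + h)\<close> meaningful up to the right endpoint.\<close>
  define F where "F x = f (max a (min b x))" for x
  have LF: "L-lipschitz_on UNIV F"
  proof (rule lipschitz_onI)
    fix x y :: real
    have "dist (F x) (F y) \<le> L * dist (max a (min b x)) (max a (min b y))"
      unfolding F_def using ab by (intro lipschitz_onD[OF L]) auto
    also have "\<dots> \<le> L * dist x y"
      using lipschitz_on_nonneg[OF L] by (intro mult_left_mono) (auto simp: dist_real_def)
    finally show "dist (F x) (F y) \<le> L * dist x y" .
  qed (use lipschitz_on_nonneg[OF L] in auto)
  have L0: "L \<ge> 0" using L lipschitz_on_nonneg by blast
  have cont: "continuous_on S F" for S
    using lipschitz_on_continuous_on[OF LF] continuous_on_subset by blast
  have int: "F integrable_on {c..d}" for c d by (intro integrable_continuous_real cont)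
  define h where "h n = 1 / real (Suc n)" for n
  have h: "h n > 0" "real (Suc n) * h n = 1" for n by (auto simp: h_def)
  define q where "q n x = real (Suc n) * (F (x + h n) - F x)" for n x
  define I where "I n = real (Suc n) * integral {b..b + h n} F - real (Suc n) * integral {a..a + h n} F" for n
  have qI: "(q n has_integral I n) {a..b}" for n
  proof -
    have "((\<lambda>x. F (x + h n)) has_integral integral {a + h n..b + h n} F) {a..b}"
      using has_integral_shift_Icc_real[of F "h n" _ a b] integrable_integral[OF int]
      by (simp add: o_def add.commute)
    then have "(q n has_integral (real (Suc n) * (integral {a + h n..b + h n} F - integral {a..b} F))) {a..b}"
      unfolding q_def by (intro has_integral_mult_right has_integral_diff integrable_integral int)
    moreover have "integral {a..a + h n} F + integral {a + h n..b + h n} F = integral {a..b} F + integral {b..b + h n} F"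
      using hk_integral_combine[of a "a + h n" "b + h n" F]
        hk_integral_combine[of a b "b + h n" F] h(1)[of n] ab int by simp
    then have eq: "integral {a + h n..b + h n} F - integral {a..b} F = integral {b..b + h n} F - integral {a..a + h n} F" by simp
    ultimately show ?thesis unfolding I_def eq by (simp only: right_diff_distrib)
  qed
  have "I \<longlonglongrightarrow> F b - F a"
    unfolding I_def h_def by (intro tendsto_diff integral_difference_quotient_tendsto[OF LF])
  then have Ilim: "I \<longlonglongrightarrow> f b - f a" using ab by (simp add: F_def)
  let ?E = "N \<union> {a, b}"
  have E: "negligible ?E" using N by simp
  have qbd: "norm (q n x) \<le> L" for n x
  proof -
    have "\<bar>F (x + h n) - F x\<bar> \<le> L * h n"
      using lipschitz_onD[OF LF, of "x + h n" x] h(1)[of n] by (simp add: dist_real_def)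
    then have "real (Suc n) * \<bar>F (x + h n) - F x\<bar> \<le> real (Suc n) * (L * h n)"
      by (intro mult_left_mono) auto
    also have "\<dots> = L" using h(2)[of n] by (metis mult.left_commute mult.right_neutral)
    finally show ?thesis by (simp add: q_def abs_mult)
  qed
  have qlim: "(\<lambda>n. q n x) \<longlonglongrightarrow> f' x" if x: "x \<in> {a..b} - ?E" for x
  proof -
    have "(f has_real_derivative f' x) (at x)" using x by (intro der) auto
    moreover have "\<forall>\<^sub>F y in nhds x. F y = f y"
    proof -
      have "\<forall>\<^sub>F y in nhds x. y \<in> {a<..<b}" using x by (intro eventually_nhds_in_open) auto
      then show ?thesis by eventually_elim (auto simp: F_def)
    qed
    ultimately have "(F has_real_derivative f' x) (at x)"
      by (subst DERIV_cong_ev[OF refl _ refl])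
    then have "((\<lambda>k. (F (x + k) - F x) / k) \<longlongrightarrow> f' x) (at 0)" by (simp add: DERIV_def)
    moreover have "filterlim h (at 0) sequentially"
      unfolding filterlim_at h_def using LIMSEQ_inverse_real_of_nat by (auto simp: divide_inverse)
    ultimately have "(\<lambda>n. (F (x + h n) - F x) / h n) \<longlonglongrightarrow> f' x"
      by (rule filterlim_compose)
    moreover have "(F (x + h n) - F x) / h n = q n x" for n by (simp add: q_def h_def)
    ultimately show ?thesis by simp
  qed
  define g where "g x = (if x \<in> ?E then 0 else f' x)" for x
  have gI: "(g has_integral (f b - f a)) {a..b}"
  proof (rule has_integral_dominated_convergence[where f = "\<lambda>n x. if x \<in> ?E then 0 else q n x" and h = "\<lambda>_. L", OF _ _ _ _ Ilim])
    show "((\<lambda>x. if x \<in> ?E then 0 else q n x) has_integral I n) {a..b}" for n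
      by (rule has_integral_spike[OF E _ qI]) auto
    show "\<forall>x\<in>{a..b}. (\<lambda>n. if x \<in> ?E then 0 else q n x) \<longlonglongrightarrow> g x"
      unfolding g_def using qlim by auto
    show "\<forall>x\<in>{a..b}. norm (if x \<in> ?E then 0 else q n x) \<le> L" for n using qbd L0 by auto
  qed auto
  then show "(f' has_integral (f b - f a)) {a..b}"
    by (rule has_integral_spike[OF E, rotated]) (auto simp: g_def)
  have "norm (g x) \<le> L" if "x \<in> {a..b}" for x
  proof (cases "x \<in> ?E")
    case False
    then have "(\<lambda>n. norm (q n x)) \<longlonglongrightarrow> norm (f' x)" using qlim that by (intro tendsto_norm) auto
    then have "norm (f' x) \<le> L" by (rule tendsto_upperbound) (use qbd in auto)
    then show ?thesis using False by (simp add: g_def)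
  qed (use L0 in \<open>simp add: g_def\<close>)
  then have "g absolutely_integrable_on {a..b}"
    using gI by (intro absolutely_integrable_integrable_bound[where g = "\<lambda>_. L"]) (auto simp: integrable_on_def)
  then show "f' absolutely_integrable_on {a..b}"
    by (rule absolutely_integrable_spike[OF _ E]) (auto simp: g_def)
qed

section \<open>Filippov sets\<close>

lemma filippov_subset:
  assumes "d > 0" "closed C" "convex C" "\<And>y. y \<in> ball x d \<Longrightarrow> f y \<in> C"
  shows "filippov f x \<subseteq> C"
proof -
  have "filippov f x \<subseteq> closure (convex hull (f ` (ball x d - {})))"
    unfolding filippov_def using assms(1) negligible_empty by blast
  also have "\<dots> \<subseteq> C"
    using assms by (intro closure_minimal hull_minimal) auto
  finally show ?thesis .
qed

text \<open>
  Where a linear component of the field is continuous, the regularisation does not enlarge it. This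
  separates the continuous equations for the chain from the discontinuous one for the integrator.
\<close>
lemma filippov_linear_image:
  fixes f :: "'a::euclidean_space \<Rightarrow> 'a" and L :: "'a \<Rightarrow> 'b::euclidean_space"
  assumes "isCont (\<lambda>y. L (f y)) x" "bounded_linear L" "v \<in> filippov f x"
  shows "L v = L (f x)"
proof -
  have "dist (L (f x)) (L v) \<le> e" if e: "e > 0" for e
  proof -
    obtain d where d: "d > 0" "\<And>y. dist y x < d \<Longrightarrow> dist (L (f y)) (L (f x)) < e"
      using assms(1)[unfolded continuous_at_eps_delta, rule_format, OF e] by blast
    have "filippov f x \<subseteq> L -` cball (L (f x)) e"
    proof (rule filippov_subset[OF d(1)])
      show "closed (L -` cball (L (f x)) e)"
        by (intro continuous_closed_vimage linear_continuous_at assms) auto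
      show "convex (L -` cball (L (f x)) e)"
        using assms(2) by (intro convex_linear_vimage) (auto simp: bounded_linear.linear)
    qed (use d in \<open>force simp: dist_commute\<close>)
    with assms(3) show ?thesis by auto
  qed
  then show ?thesis by (metis dist_le_zero_iff field_le_epsilon add_0)
qed

text \<open>
  Near a continuity point \<open>y\<close>, values close to \<open>f y\<close> are taken on a whole ball, which no null set can
  exhaust. Hence limits of values at continuity points belong to the Filippov set.
\<close>
lemma filippov_limit:
  fixes f :: "'a::euclidean_space \<Rightarrow> 'a"
  assumes "\<And>d e. d > 0 \<Longrightarrow> e > 0 \<Longrightarrow> \<exists>y\<in>ball x d. isCont f y \<and> dist (f y) c < e"
  shows "c \<in> filippov f x"
  unfolding filippov_def
proof (intro INT_I)
  fix d :: real and N :: "'a set" assume d: "d \<in> {0<..}" and N: "N \<in> {N. negligible N}"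
  show "c \<in> closure (convex hull (f ` (ball x d - N)))"
    unfolding closure_approachable
  proof (intro allI impI)
    fix e :: real assume e: "e > 0"
    then obtain y where y: "y \<in> ball x d" "isCont f y" "dist (f y) c < e/2"
      using assms[of d "e/2"] d by auto
    obtain r where r: "r > 0" "\<And>z. dist z y < r \<Longrightarrow> dist (f z) (f y) < e/2"
      using y(2) e unfolding continuous_at_eps_delta by (metis half_gt_zero)
    let ?U = "ball x d \<inter> ball y r"
    have "open ?U" "?U \<noteq> {}" using y r by auto
    then have "\<not> negligible ?U" by (rule open_not_negligible)
    then have "\<not> ?U \<subseteq> N" using N negligible_subset by blast
    then obtain z where z: "z \<in> ball x d" "z \<in> ball y r" "z \<notin> N" by blast
    have "dist (f z) c < e" using r(2)[of z] y(3) z(2) dist_triangle[of "f z" c "f y"]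
      by (simp add: dist_commute)
    then show "\<exists>w\<in>convex hull (f ` (ball x d - N)). dist w c < e"
      using z by (intro bexI[of _ "f z"]) (auto intro: hull_inc)
  qed
qed

lemma isCont_imp_filippov:
  fixes f :: "'a::euclidean_space \<Rightarrow> 'a"
  assumes "isCont f x" shows "f x \<in> filippov f x"
  using assms by (intro filippov_limit bexI[of _ x]) auto

lemma convex_filippov: "convex (filippov f x)"
  unfolding filippov_def by (intro convex_INT convex_closure convex_convex_hull)

section \<open>Peano's existence theorem\<close>

text \<open>
  The field is allowed to be discontinuous at the initial time \<open>a\<close>; this is what makes it possible
  to start solutions on the discontinuity set of the closed loop.
\<close>
lemma curve_integrable:
  fixes f :: "real \<Rightarrow> 'a::euclidean_space \<Rightarrow> 'b::euclidean_space"
  assumes cont: "continuous_on ({a<..b} \<times> UNIV) (\<lambda>(t, x). f t x)"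
    and bnd: "\<And>t x. t \<in> {a..b} \<Longrightarrow> norm (f t x) \<le> M"
    and x: "continuous_on {a..b} x" and cd: "a \<le> c" "d \<le> b"
  shows "(\<lambda>s. f s (x s)) absolutely_integrable_on {c..d}"
proof (rule absolutely_integrable_integrable_bound[where g = "\<lambda>_. M"])
  have "(\<lambda>s. f s (x s)) integrable_on {c<..d}"
  proof (rule measurable_bounded_by_integrable_imp_integrable[where g = "\<lambda>_. M"])
    have "continuous_on {c<..d} (\<lambda>s. (\<lambda>(t, x). f t x) (s, x s))"
      by (rule continuous_on_compose2[OF cont])
        (use cd in \<open>auto intro!: continuous_intros continuous_on_subset[OF x]\<close>)
    then show "(\<lambda>s. f s (x s)) \<in> borel_measurable (lebesgue_on {c<..d})"
      by (intro continuous_imp_measurable_on_sets_lebesgue) auto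
    show "(\<lambda>_. M) integrable_on {c<..d}"
      by (rule integrable_spike_set[OF integrable_const_ivl[of _ c d]]) (auto intro: negligible_subset[of "{c}"])
    show "norm (f s (x s)) \<le> M" if "s \<in> {c<..d}" for s using bnd that cd by auto
  qed auto
  then show "(\<lambda>s. f s (x s)) integrable_on {c..d}"
    by (rule integrable_spike_set) (auto intro: negligible_subset[of "{c}"])
qed (use bnd cd in auto)

text \<open>
  Tonelli's delayed equation. Its integral operator looks at the past only up to time \<open>t - h\<close>, so the
  iterates starting from the constant \<open>x0\<close> agree on a further interval of length \<open>h\<close> at each step and a
  finite number of iterations reaches \<open>b\<close>.
\<close>
lemma delayed_solution:
  fixes f :: "real \<Rightarrow> 'a::euclidean_space \<Rightarrow> 'a"
  assumes cont: "continuous_on ({a<..b} \<times> UNIV) (\<lambda>(t, x). f t x)"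
    and bnd: "\<And>t x. t \<in> {a..b} \<Longrightarrow> norm (f t x) \<le> M" and ab: "a < b"
    and h: "h > 0"
  obtains x where "M-lipschitz_on {a..b} x" "x a = x0"
    "\<And>t. t \<in> {a..b} \<Longrightarrow> x t = x0 + integral {a..max a (t - h)} (\<lambda>s. f s (x s))"
proof -
  define \<Phi> where "\<Phi> x t = x0 + integral {a..max a (t - h)} (\<lambda>s. f s (x s))" for x t
  define X where "X k = (\<Phi> ^^ k) (\<lambda>_. x0)" for k
  have M0: "M \<ge> 0" using bnd[of a 0] ab norm_ge_zero order_trans by (metis atLeastAtMost_iff less_imp_le order_refl)
  have lip\<Phi>: "M-lipschitz_on {a..b} (\<Phi> x)" if "continuous_on {a..b} x" for x
  proof (rule lipschitz_onI[OF _ M0])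
    have *: "dist (\<Phi> x s) (\<Phi> x t) \<le> M * dist s t" if st: "s \<in> {a..b}" "t \<in> {a..b}" "s \<le> t" for s t
    proof -
      let ?s = "max a (s - h)" and ?t = "max a (t - h)"
      have int: "(\<lambda>s. f s (x s)) integrable_on {c..d}" if "a \<le> c" "d \<le> b" for c d
        using curve_integrable[OF cont bnd \<open>continuous_on {a..b} x\<close> that] absolutely_integrable_on_def by blast
      have "integral {a..?s} (\<lambda>s. f s (x s)) + integral {?s..?t} (\<lambda>s. f s (x s)) = integral {a..?t} (\<lambda>s. f s (x s))"
        using st h by (intro hk_integral_combine int) auto
      then have "\<Phi> x t = \<Phi> x s + integral {?s..?t} (\<lambda>s. f s (x s))"
        unfolding \<Phi>_def by (simp add: add.assoc)
      then have "dist (\<Phi> x s) (\<Phi> x t) = norm (integral {?s..?t} (\<lambda>s. f s (x s)))"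
        by (simp add: dist_norm)
      also have "\<dots> \<le> M * (?t - ?s)"
        using st h by (intro integral_norm_le_interval int bnd) auto
      also have "\<dots> \<le> M * dist s t" using st M0 by (intro mult_left_mono) (auto simp: dist_real_def)
      finally show ?thesis .
    qed
    show "dist (\<Phi> x s) (\<Phi> x t) \<le> M * dist s t" if "s \<in> {a..b}" "t \<in> {a..b}" for s t
      using *[of s t] *[of t s] that by (cases "s \<le> t") (auto simp: dist_commute)
  qed
  have lipX: "M-lipschitz_on {a..b} (X k)" for k
  proof (induction k)
    case 0 then show ?case by (auto simp: X_def intro: lipschitz_intros lipschitz_on_le[OF lipschitz_on_constant M0])
  next
    case (Suc k)
    then show ?case using lip\<Phi>[OF lipschitz_on_continuous_on[OF Suc]] by (simp add: X_def)
  qed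
  have agree: "\<forall>t\<in>{a..b}. t \<le> a + real k * h \<longrightarrow> X (Suc k) t = X k t" for k
  proof (induction k)
    case 0
    then show ?case using h by (auto simp: X_def \<Phi>_def)
  next
    case (Suc k)
    show ?case
    proof (intro ballI impI)
      fix t assume t: "t \<in> {a..b}" "t \<le> a + real (Suc k) * h"
      have "integral {a..max a (t - h)} (\<lambda>s. f s (X (Suc k) s)) = integral {a..max a (t - h)} (\<lambda>s. f s (X k s))"
      proof (rule hk_integral_cong)
        fix s assume "s \<in> {a..max a (t - h)}"
        then have "s \<in> {a..b}" "s \<le> a + real k * h"
          using t h by (auto simp: algebra_simps max_def split: if_splits)
        with Suc.IH show "f s (X (Suc k) s) = f s (X k s)" by simp
      qed
      then show "X (Suc (Suc k)) t = X (Suc k) t" by (simp add: X_def \<Phi>_def)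
    qed
  qed
  obtain k :: nat where k: "b - a < real k * h" using reals_Archimedean3[OF h] by blast
  show thesis
  proof (rule that[of "X k"])
    show "M-lipschitz_on {a..b} (X k)" by (rule lipX)
    have eq: "X k t = x0 + integral {a..max a (t - h)} (\<lambda>s. f s (X k s))" if "t \<in> {a..b}" for t
      using agree[of k] that k by (auto simp: X_def \<Phi>_def)
    show "X k t = x0 + integral {a..max a (t - h)} (\<lambda>s. f s (X k s))" if "t \<in> {a..b}" for t
      using eq that .
    show "X k a = x0" using eq[of a] ab h by simp
  qed
qed

text \<open>
  The delayed solutions are equi-Lipschitz, so the Arzela-Ascoli theorem provides a uniform limit as the
  delay tends to zero, and dominated convergence passes to the limit in the integral equation.
\<close>
lemma peano_bounded:
  fixes f :: "real \<Rightarrow> 'a::euclidean_space \<Rightarrow> 'a"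
  assumes cont: "continuous_on ({a<..b} \<times> UNIV) (\<lambda>(t, x). f t x)"
    and bnd: "\<And>t x. t \<in> {a..b} \<Longrightarrow> norm (f t x) \<le> M" and ab: "a < b"
  obtains x where "continuous_on {a..b} x" "x a = x0"
    "\<And>t. t \<in> {a..b} \<Longrightarrow> ((\<lambda>s. f s (x s)) has_integral (x t - x0)) {a..t}"
proof -
  \<comment> \<open>The value at time \<open>a\<close> is changed to \<open>0\<close> so that the integrands converge at every time.\<close>
  define f0 where "f0 t x = (if t = a then 0 else f t x)" for t x
  have cont0: "continuous_on ({a<..b} \<times> UNIV) (\<lambda>(t, x). f0 t x)"
    by (rule continuous_on_eq[OF cont]) (auto simp: f0_def)
  have M0: "M \<ge> 0" using bnd[of a 0] ab norm_ge_zero order_trans by (metis atLeastAtMost_iff less_imp_le order_refl)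
  have bnd0: "norm (f0 t x) \<le> M" if "t \<in> {a..b}" for t x
    using bnd[OF that] M0 by (auto simp: f0_def)
  define h where "h n = 1 / real (Suc n)" for n
  have hlim: "h \<longlonglongrightarrow> 0"
    unfolding h_def using LIMSEQ_inverse_real_of_nat by (simp add: divide_inverse)
  have "\<exists>x. M-lipschitz_on {a..b} x \<and> x a = x0 \<and>
    (\<forall>t\<in>{a..b}. x t = x0 + integral {a..max a (t - h n)} (\<lambda>s. f0 s (x s)))" for n
    using delayed_solution[OF cont0 bnd0 ab, of "h n" x0] by (metis h_def of_nat_0_less_iff zero_less_Suc zero_less_divide_1_iff)
  then obtain Y where Y: "\<And>n. M-lipschitz_on {a..b} (Y n)" "\<And>n. Y n a = x0"
    "\<And>n t. t \<in> {a..b} \<Longrightarrow> Y n t = x0 + integral {a..max a (t - h n)} (\<lambda>s. f0 s (Y n s))"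
    by metis
  obtain y k where y: "continuous_on {a..b} y" "strict_mono (k :: nat \<Rightarrow> nat)"
    and unif: "\<And>e. 0 < e \<Longrightarrow> \<exists>N. \<forall>n x. n \<ge> N \<and> x \<in> {a..b} \<longrightarrow> norm (Y (k n) x - y x) < e"
  proof (rule Arzela_Ascoli[of "{a..b}" Y "norm x0 + M * (b - a)"])
    show "norm (Y n x) \<le> norm x0 + M * (b - a)" if x: "x \<in> {a..b}" for n x
    proof -
      have "dist (Y n x) (Y n a) \<le> M * dist x a" using lipschitz_onD[OF Y(1), of x a n] x ab by auto
      also have "\<dots> \<le> M * (b - a)" using x M0 by (intro mult_left_mono) (auto simp: dist_real_def)
      finally show ?thesis using Y(2)[of n] norm_triangle_sub[of "Y n x" x0] by (simp add: dist_norm)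
    qed
    fix x e :: real assume xe: "x \<in> {a..b}" "0 < e"
    show "\<exists>d. 0 < d \<and> (\<forall>n y. y \<in> {a..b} \<and> norm (x - y) < d \<longrightarrow> norm (Y n x - Y n y) < e)"
    proof (intro exI[of _ "e / (M + 1)"] conjI allI impI)
      show "0 < e / (M + 1)" using xe M0 by auto
      fix n y assume y: "y \<in> {a..b} \<and> norm (x - y) < e / (M + 1)"
      have "norm (Y n x - Y n y) \<le> M * norm (x - y)"
        using lipschitz_onD[OF Y(1), of x y n] xe y by (auto simp: dist_norm)
      also have "\<dots> \<le> (M + 1) * norm (x - y)" by (intro mult_right_mono) auto
      also have "\<dots> < e" using y M0 by (simp add: field_simps)
      finally show "norm (Y n x - Y n y) < e" .
    qed
  qed auto
  have lim: "(\<lambda>n. Y (k n) t) \<longlonglongrightarrow> y t" if "t \<in> {a..b}" for t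
    unfolding LIMSEQ_iff using unif that by meson
  have hk: "(\<lambda>n. h (k n)) \<longlonglongrightarrow> 0" using LIMSEQ_subseq_LIMSEQ[OF hlim y(2)] by (simp add: o_def)
  have Ycont: "continuous_on {a..b} (Y n)" for n using Y(1) lipschitz_on_continuous_on by blast
  have intY: "(\<lambda>s. f0 s (Y n s)) integrable_on {c..d}" if "a \<le> c" "d \<le> b" for n c d
    using curve_integrable[OF cont0 bnd0 Ycont that] absolutely_integrable_on_def by blast
  have sol: "((\<lambda>s. f0 s (y s)) has_integral (y t - x0)) {a..t}" if t: "t \<in> {a..b}" for t
  proof (rule has_integral_dominated_convergence[where f = "\<lambda>n s. f0 s (Y (k n) s)" and h = "\<lambda>_. M"])
    show "((\<lambda>s. f0 s (Y (k n) s)) has_integral integral {a..t} (\<lambda>s. f0 s (Y (k n) s))) {a..t}" for n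
      using t by (intro integrable_integral intY) auto
    show "\<forall>s\<in>{a..t}. norm (f0 s (Y (k n) s)) \<le> M" for n using bnd0 t by auto
    show "\<forall>s\<in>{a..t}. (\<lambda>n. f0 s (Y (k n) s)) \<longlonglongrightarrow> f0 s (y s)"
    proof
      fix s assume s: "s \<in> {a..t}"
      show "(\<lambda>n. f0 s (Y (k n) s)) \<longlonglongrightarrow> f0 s (y s)"
      proof (cases "s = a")
        case False
        have "continuous_on UNIV (\<lambda>x. (\<lambda>(t, x). f0 t x) (s, x))"
          by (rule continuous_on_compose2[OF cont0]) (use s t False in \<open>auto intro!: continuous_intros\<close>)
        then have "isCont (f0 s) (y s)" by (simp add: continuous_on_eq_continuous_at)
        then show ?thesis using isCont_tendsto_compose lim s t by fastforce
      qed (simp add: f0_def)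
    qed
    show "(\<lambda>n. integral {a..t} (\<lambda>s. f0 s (Y (k n) s))) \<longlonglongrightarrow> y t - x0"
    proof (rule Lim_transform2[where f = "\<lambda>n. Y (k n) t - x0"])
      show "(\<lambda>n. Y (k n) t - x0) \<longlonglongrightarrow> y t - x0" using lim[OF t] by (intro tendsto_intros)
      show "(\<lambda>n. Y (k n) t - x0 - integral {a..t} (\<lambda>s. f0 s (Y (k n) s))) \<longlonglongrightarrow> 0"
      proof (rule Lim_null_comparison)
        show "(\<lambda>n. M * h (k n)) \<longlonglongrightarrow> 0" using tendsto_mult_right_zero[OF hk] .
        show "\<forall>\<^sub>F n in sequentially. norm (Y (k n) t - x0 - integral {a..t} (\<lambda>s. f0 s (Y (k n) s))) \<le> M * h (k n)"
        proof (intro always_eventually allI)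
          fix n
          let ?t = "max a (t - h (k n))"
          have hp: "h (k n) > 0" by (simp add: h_def)
          have "integral {a..?t} (\<lambda>s. f0 s (Y (k n) s)) + integral {?t..t} (\<lambda>s. f0 s (Y (k n) s)) = integral {a..t} (\<lambda>s. f0 s (Y (k n) s))"
            using t hp by (intro hk_integral_combine intY) auto
          then have "Y (k n) t - x0 - integral {a..t} (\<lambda>s. f0 s (Y (k n) s)) = - integral {?t..t} (\<lambda>s. f0 s (Y (k n) s))"
            by (subst Y(3)[OF t, of "k n"]) (simp add: algebra_simps)
          then have "norm (Y (k n) t - x0 - integral {a..t} (\<lambda>s. f0 s (Y (k n) s))) = norm (integral {?t..t} (\<lambda>s. f0 s (Y (k n) s)))"
            by simp
          also have "\<dots> \<le> M * (t - ?t)"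
            using t hp by (intro integral_norm_le_interval intY bnd0) auto
          also have "\<dots> \<le> M * h (k n)" using M0 t hp by (intro mult_left_mono) auto
          finally show "norm (Y (k n) t - x0 - integral {a..t} (\<lambda>s. f0 s (Y (k n) s))) \<le> M * h (k n)" .
        qed
      qed
    qed
  qed auto
  show thesis
  proof (rule that[of y])
    show "continuous_on {a..b} y" by (rule y)
    show "y a = x0" using lim[of a] ab Y(2) LIMSEQ_unique[OF tendsto_const] by force
    show "((\<lambda>s. f s (y s)) has_integral (y t - x0)) {a..t}" if "t \<in> {a..b}" for t
      by (rule has_integral_spike[OF negligible_sing[of a] _ sol[OF that]]) (auto simp: f0_def)
  qed
qed

section \<open>The chain of integrators and its dilations\<close>

lemma idx_pos: "1 \<le> idx (i::'n::{finite,linorder})"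
  unfolding idx_def using card_gt_0_iff[of "{j. j \<le> i}"] by (auto simp: Suc_le_eq)

lemma idx_le: "idx (i::'n::{finite,linorder}) \<le> CARD('n)"
  unfolding idx_def by (rule card_mono) auto

lemma idx_last: "idx (last_ix::'n::{finite,linorder}) = CARD('n)"
proof -
  have "{j. j \<le> (last_ix::'n)} = UNIV" unfolding last_ix_def by auto
  then show ?thesis by (simp add: idx_def)
qed

lemma J_last [simp]: "J z $ last_ix = 0"
  by (simp add: J_def)

lemma e_last_last [simp]: "e_last $ last_ix = 1"
  by (simp add: e_last_def)

lemma norm_e_last [simp]: "norm e_last = 1"
  by (simp add: e_last_def)

lemma e_last_neq_0 [simp]: "e_last \<noteq> 0"
  using norm_e_last norm_zero zero_neq_one by metis

lemma linear_J: "linear J"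
  by (rule linearI) (auto simp: J_def vec_eq_iff algebra_simps)

lemma J_zero [simp]: "J 0 = 0"
  using linear_J by (rule linear_0)

lemma continuous_on_J [continuous_intros]:
  "continuous_on S f \<Longrightarrow> continuous_on S (\<lambda>x. J (f x))"
  by (rule continuous_on_compose2[OF linear_continuous_on[of J UNIV]])
    (use linear_J in \<open>auto simp: linear_conv_bounded_linear\<close>)

lemma linear_Dscale: "linear (Dscale lam)"
  by (rule linearI) (auto simp: Dscale_def vec_eq_iff algebra_simps)

lemma Dscale_zero [simp]: "Dscale lam 0 = 0"
  by (rule linear_0[OF linear_Dscale])

lemma Dscale_eq_0 [simp]: "lam > 0 \<Longrightarrow> Dscale lam z = 0 \<longleftrightarrow> z = 0"
  by (auto simp: Dscale_def vec_eq_iff)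

lemma Dscale_e_last: "Dscale lam (s *\<^sub>R e_last :: real ^ 'n::{finite,linorder}) = (lam * s) *\<^sub>R e_last"
proof -
  have "lam ^ (CARD('n) + 1 - idx i) * (s * axis last_ix 1 $ i) = lam * (s * axis last_ix 1 $ i)" for i :: 'n
    by (cases "i = last_ix") (auto simp: axis_def idx_last)
  then show ?thesis by (simp add: Dscale_def vec_eq_iff e_last_def mult.assoc)
qed

text \<open>
  \<open>D\<^sub>\<lambda>\<close> turns the chain into the same chain running \<open>\<lambda>\<close> times faster, because consecutive entries of
  \<open>D\<^sub>\<lambda>\<close> differ by a factor \<open>\<lambda>\<close>.
\<close>
lemma Dscale_J: "Dscale lam (J z) = lam *\<^sub>R J (Dscale lam (z :: real ^ 'n::{finite,linorder}))"
proof -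
  have "lam ^ (CARD('n) + 1 - idx i) * z $ next_ix i = lam * (lam ^ (CARD('n) + 1 - idx (next_ix i)) * z $ next_ix i)"
    if "i \<noteq> last_ix" for i :: 'n
  proof -
    have "i < last_ix" using that unfolding last_ix_def by (simp add: less_le)
    then have ne: "{j. i < j} \<noteq> {}" by auto
    have lt: "i < next_ix i" unfolding next_ix_def using Min_in[of "{j. i < j}"] ne by auto
    have "{j. j \<le> next_ix i} = insert (next_ix i) {j. j \<le> i}"
    proof -
      have nx: "next_ix i \<le> j" if "i < j" for j unfolding next_ix_def using that by (intro Min_le) auto
      then have "j \<le> next_ix i \<longleftrightarrow> j = next_ix i \<or> j \<le> i" for j
        using lt nx[of j] by (metis le_less_trans less_imp_le linorder_not_less order_antisym order_refl)
      then show ?thesis by auto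
    qed
    then have "idx (next_ix i) = Suc (idx i)" unfolding idx_def using lt by simp
    moreover have "idx (next_ix i) \<le> CARD('n)" by (rule idx_le)
    ultimately have "CARD('n) + 1 - idx i = Suc (CARD('n) + 1 - idx (next_ix i))" by simp
    then show ?thesis by simp
  qed
  then show ?thesis by (auto simp: Dscale_def J_def vec_eq_iff)
qed

text \<open>
  The data of the unperturbed problem. The condition on \<open>p\<close> makes the weight of the \<open>i\<close>-th coordinate
  equal to \<open>(r + 2 - i) k\<close> with \<open>k = - \<kappa> > 0\<close>; in particular \<open>z\<^sub>r\<close> has weight \<open>2 k\<close>, \<open>u0\<close> has degree \<open>k\<close> and
  \<open>V1\<close> has degree \<open>2 k\<close>, so that \<open>\<partial>\<^sub>r V1\<close> has degree zero.
\<close>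
locale homogeneous_chain =
  fixes \<kappa> p c \<alpha> kP kI :: real
    and u0 V1 :: "real ^ 'n::{finite,linorder} \<Rightarrow> real"
  assumes kappa_neg: "\<kappa> < 0" and p_eq: "p + (real CARD('n) + 1) * \<kappa> = 0"
    and u0_cont: "continuous_on UNIV u0"
    and u0_hom: "homogeneous_on p \<kappa> UNIV (wt p \<kappa> (CARD('n) + 1)) u0"
    and field_hom: "homogeneous_field p \<kappa> \<kappa> (nominal u0)"
    and V1_cont: "continuous_on UNIV V1"
    and V1_0: "V1 0 = 0" and V1_pos: "z \<noteq> 0 \<Longrightarrow> V1 z > 0"
    and V1_C1: "C1_on (- {0}) V1"
    and V1_hom: "homogeneous_on p \<kappa> UNIV (2 * wt p \<kappa> (CARD('n) + 1)) V1"
    and c_pos: "c > 0"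
    and V1_decay: "filippov_solution (\<lambda>_. nominal u0) T x \<Longrightarrow> 0 < t \<Longrightarrow> ereal t < T \<Longrightarrow> x t \<noteq> 0 \<Longrightarrow>
           (\<exists>d. ((\<lambda>s. V1 (x s)) has_real_derivative d) (at t) \<and> d \<le> - c * V1 (x t) powr \<alpha>)"
    and dV1_hom: "\<exists>q\<ge>0. homogeneous_on p \<kappa> (- {0}) q (partial_last V1)"
    and dV1_u0: "partial_last V1 z * u0 z \<le> 0"
    and kP: "kP \<ge> 1" and kI: "kI > 0"
begin

definition k :: real where "k = - \<kappa>"
abbreviation g :: "(real, 'n) vec \<Rightarrow> real" where "g \<equiv> partial_last V1"
abbreviation D :: "real \<Rightarrow> (real, 'n) vec \<Rightarrow> (real, 'n) vec" where "D \<equiv> dil p \<kappa>"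

lemma k_pos: "k > 0"
  using kappa_neg by (simp add: k_def)

lemma p_k: "p = (real CARD('n) + 1) * k"
  using p_eq by (simp add: k_def algebra_simps)

lemma wt_idx: "wt p \<kappa> (idx (i::'n)) = (real (CARD('n) + 2) - real (idx i)) * k"
  unfolding wt_def p_k by (simp add: k_def algebra_simps)

lemma wt_last: "wt p \<kappa> (CARD('n)) = 2 * k"
  using wt_idx[of last_ix] by (simp add: idx_last)

lemma wt_succ: "wt p \<kappa> (CARD('n) + 1) = k"
  unfolding wt_def p_k by (simp add: k_def algebra_simps)

lemma wt_lower: "k \<le> wt p \<kappa> (idx (i::'n))"
proof -
  have "1 * k \<le> (real (CARD('n) + 2) - real (idx i)) * k"
    using idx_le[of i] k_pos by (intro mult_right_mono) auto
  then show ?thesis unfolding wt_idx by simp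
qed

lemma wt_upper: "wt p \<kappa> (idx (i::'n)) \<le> p"
proof -
  have "(real (CARD('n) + 2) - real (idx i)) * k \<le> (real CARD('n) + 1) * k"
    using idx_pos[of i] k_pos by (intro mult_right_mono) auto
  then show ?thesis by (simp only: wt_idx flip: p_k)
qed

lemma dil_one [simp]: "D 1 z = z"
  by (simp add: dil_def vec_eq_iff)

lemma dil_dil: "e > 0 \<Longrightarrow> d > 0 \<Longrightarrow> D e (D d z) = D (e * d) z"
  by (auto simp: dil_def vec_eq_iff powr_mult)

lemma dil_eq_0 [simp]: "e > 0 \<Longrightarrow> D e z = 0 \<longleftrightarrow> z = 0"
  by (auto simp: dil_def vec_eq_iff)

lemma linear_dil: "linear (D e)"
  by (rule linearI) (auto simp: dil_def vec_eq_iff algebra_simps)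

lemma dil_e_last: "D e (s *\<^sub>R e_last) = (e powr (2 * k) * s) *\<^sub>R e_last"
proof -
  have "e powr wt p \<kappa> (idx i) * (s * axis last_ix 1 $ i) = e powr (2 * k) * (s * axis last_ix 1 $ i)" for i :: 'n
    using wt_last by (cases "i = last_ix") (auto simp: axis_def idx_last)
  then show ?thesis by (simp add: dil_def vec_eq_iff e_last_def mult.assoc)
qed

lemma norm_dil_le:
  assumes "e \<ge> 0" "\<And>i::'n. e powr wt p \<kappa> (idx i) \<le> B"
  shows "norm (D e z) \<le> B * norm z"
proof -
  have "norm (D e z) = norm (\<chi> i. e powr wt p \<kappa> (idx i) * z $ i)" by (simp add: dil_def)
  also have "\<dots> \<le> norm (B *\<^sub>R z)"
  proof (rule norm_le_componentwise_cart)
    fix i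
    have "0 \<le> B" using assms(2)[of i] powr_ge_zero order_trans by blast
    then show "norm ((\<chi> i. e powr wt p \<kappa> (idx i) * z $ i) $ i) \<le> norm ((B *\<^sub>R z) $ i)"
      using assms(2)[of i] by (auto simp: abs_mult intro!: mult_right_mono)
  qed
  also have "\<dots> = B * norm z"
    using assms(2)[of undefined] powr_ge_zero order_trans by (metis abs_of_nonneg norm_scaleR)
  finally show ?thesis .
qed

lemma norm_dil_le_le1: "0 < e \<Longrightarrow> e \<le> 1 \<Longrightarrow> norm (D e z) \<le> e powr k * norm z"
  using wt_lower by (intro norm_dil_le) (auto intro: powr_mono')

lemma norm_dil_ge: 
  assumes "e \<ge> 1" shows "norm (D e z) \<ge> e powr k * norm z"
proof -
  have "norm z = norm (D (1 / e) (D e z))" using assms by (subst dil_dil) auto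
  also have "\<dots> \<le> (1 / e) powr k * norm (D e z)" using assms by (intro norm_dil_le_le1) auto
  finally have "norm z \<le> (1 / e) powr k * norm (D e z)" .
  then have "e powr k * norm z \<le> e powr k * ((1 / e) powr k * norm (D e z))" by (intro mult_left_mono) auto
  also have "\<dots> = norm (D e z)" using assms by (simp add: powr_divide)
  finally show ?thesis .
qed

text \<open>
  The dilates of a nonzero vector have norms between zero and infinity, so one of them is a unit
  vector by the intermediate value theorem. Homogeneous estimates are thereby reduced to the compact
  unit sphere.
\<close>
lemma unit_dilate:
  assumes "z \<noteq> 0"
  obtains e w where "e > 0" "norm w = 1" "z = D e w"
proof -
  define n where "n = norm z"
  have n: "n > 0" using assms by (simp add: n_def)
  define e1 where "e1 = min 1 ((1 / n) powr (1 / k))"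
  define e2 where "e2 = max 1 ((1 / n) powr (1 / k))"
  have e12: "0 < e1" "e1 \<le> 1" "1 \<le> e2" "e1 \<le> e2" using n by (auto simp: e1_def e2_def)
  have root: "((1 / n) powr (1 / k)) powr k = 1 / n" using k_pos n by (simp add: powr_powr)
  have "norm (D e1 z) \<le> e1 powr k * n" unfolding n_def by (rule norm_dil_le_le1) (use e12 in auto)
  also have "\<dots> \<le> ((1 / n) powr (1 / k)) powr k * n"
    using n k_pos e12 by (intro mult_right_mono powr_mono2) (auto simp: e1_def)
  also have "\<dots> = 1" using n root by simp
  finally have lo: "norm (D e1 z) \<le> 1" .
  have "1 = ((1 / n) powr (1 / k)) powr k * n" using n root by simp
  also have "\<dots> \<le> e2 powr k * n"
    using n k_pos e12 by (intro mult_right_mono powr_mono2) (auto simp: e2_def)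
  also have "\<dots> \<le> norm (D e2 z)" unfolding n_def by (rule norm_dil_ge) (use e12 in auto)
  finally have hi: "1 \<le> norm (D e2 z)" .
  have "continuous_on {e1..e2} (\<lambda>e. norm (D e z))"
    unfolding dil_def using e12 by (intro continuous_intros) auto
  from IVT'[of "\<lambda>e. norm (D e z)", OF lo hi e12(4) this]
  obtain e where e: "e1 \<le> e" "norm (D e z) = 1" by auto
  then have "e > 0" using e12 by linarith
  show thesis
  proof (rule that[of "1 / e" "D e z"])
    show "z = D (1 / e) (D e z)" using \<open>e > 0\<close> by (simp add: dil_dil)
  qed (use \<open>e > 0\<close> e in auto)
qed

lemma V1_dil: "e > 0 \<Longrightarrow> V1 (D e z) = e powr (2 * k) * V1 z"
  using V1_hom unfolding wt_succ homogeneous_on_def by simp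

lemma u0_dil: "e > 0 \<Longrightarrow> u0 (D e z) = e powr k * u0 z"
  using u0_hom unfolding wt_succ homogeneous_on_def by simp

lemma V1_nonneg: "V1 z \<ge> 0"
  using V1_pos[of z] V1_0 by (cases "z = 0") auto

lemma V1_eq_0 [simp]: "V1 z = 0 \<longleftrightarrow> z = 0"
  using V1_pos[of z] V1_0 by (cases "z = 0") auto

lemma u0_0 [simp]: "u0 0 = 0"
proof -
  have "D 2 0 = 0" by (simp add: dil_def vec_eq_iff)
  then have "u0 0 = 2 powr k * u0 0" using u0_dil[of 2 0] by (metis zero_less_numeral)
  moreover have "(2::real) powr k \<noteq> 1" using k_pos by simp
  ultimately show ?thesis by simp
qed

text \<open>
  A gradient of \<open>V1\<close> away from the origin. At the origin it may be unbounded: the component along \<open>z\<^sub>i\<close>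
  has the negative degree \<open>(i - r) k\<close> for \<open>i < r\<close>.
\<close>
definition G :: "(real, 'n) vec \<Rightarrow> (real, 'n) vec" where
  "G = (SOME G. (\<forall>z\<in>- {0}. GDERIV V1 z :> G z) \<and> continuous_on (- {0}) G)"

lemma G: "\<And>z. z \<noteq> 0 \<Longrightarrow> GDERIV V1 z :> G z" "continuous_on (- {0}) G"
  using someI_ex[OF V1_C1[unfolded C1_on_def]] unfolding G_def[symmetric] by auto

lemma V1_has_derivative: "z \<noteq> 0 \<Longrightarrow> (V1 has_derivative (\<lambda>h. G z \<bullet> h)) (at z)"
  using G(1)[of z] by (simp add: gderiv_def inner_commute)

lemma g_eq: assumes "z \<noteq> 0" shows "g z = G z \<bullet> e_last"
proof -
  have d: "((\<lambda>s. z + s *\<^sub>R e_last) has_derivative (\<lambda>s. s *\<^sub>R e_last)) (at 0)"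
    by (auto intro!: derivative_eq_intros)
  have "((\<lambda>s. V1 (z + s *\<^sub>R e_last)) has_derivative (\<lambda>s. G z \<bullet> (s *\<^sub>R e_last))) (at 0)"
    using has_derivative_compose[OF d, of V1 "\<lambda>h. G z \<bullet> h"] V1_has_derivative[OF assms] by simp
  then have "((\<lambda>s. V1 (z + s *\<^sub>R e_last)) has_real_derivative (G z \<bullet> e_last)) (at 0)"
    unfolding has_field_derivative_def by (rule has_derivative_eq_rhs) auto
  then show ?thesis unfolding partial_last_def by (rule DERIV_imp_deriv)
qed

lemma g_continuous: "continuous_on (- {0}) g"
  by (rule continuous_on_eq[of _ "\<lambda>z. G z \<bullet> e_last"]) (auto intro!: continuous_intros G(2) simp: g_eq)

text \<open>
  On the last axis \<open>V1\<close> is positively homogeneous of degree one in the usual sense, since degree and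
  weight are both \<open>2 k\<close>.
\<close>
lemma V1_axis: "s \<ge> 0 \<Longrightarrow> V1 ((s * r) *\<^sub>R e_last) = s * V1 (r *\<^sub>R e_last)"
proof (cases "s = 0")
  case False
  assume "s \<ge> 0"
  with False have "s > 0" by simp
  define e where "e = s powr (1 / (2 * k))"
  have e: "e > 0" "e powr (2 * k) = s" using \<open>s > 0\<close> k_pos by (auto simp: e_def powr_powr)
  show ?thesis using V1_dil[OF e(1), of "r *\<^sub>R e_last"] by (simp only: dil_e_last e(2))
qed (simp add: V1_0)

text \<open>
  Consequently \<open>\<partial>\<^sub>r V1\<close> is constant on either half of the last axis, with opposite signs: zero is
  interior to the interval of values that it takes near the origin.
\<close>
lemma g_axis:
  assumes "s > 0" "r = 1 \<or> r = -1" shows "g ((s * r) *\<^sub>R e_last) = r * V1 (r *\<^sub>R e_last)"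
proof -
  have "\<forall>\<^sub>F t in nhds 0. V1 ((s * r) *\<^sub>R e_last + t *\<^sub>R e_last) = (s + r * t) * V1 (r *\<^sub>R e_last)"
  proof -
    have "\<forall>\<^sub>F t in nhds (0::real). t \<in> {-s<..<s}" using assms by (intro eventually_nhds_in_open) auto
    then show ?thesis
    proof eventually_elim
      case (elim t)
      have "(s * r) *\<^sub>R e_last + t *\<^sub>R (e_last :: (real, 'n) vec) = ((s + r * t) * r) *\<^sub>R e_last"
        using assms(2) by (auto simp: algebra_simps)
      moreover have "s + r * t \<ge> 0" using elim assms(2) by auto
      ultimately show ?case using V1_axis[of "s + r * t" r] by simp
    qed
  qed
  then have "((\<lambda>t. V1 ((s * r) *\<^sub>R e_last + t *\<^sub>R e_last)) has_real_derivative r * V1 (r *\<^sub>R e_last)) (at 0)"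
    by (subst DERIV_cong_ev[OF refl _ refl]) (auto intro!: derivative_eq_intros)
  then show ?thesis unfolding partial_last_def by (rule DERIV_imp_deriv)
qed

text \<open>
  The degree of \<open>\<partial>\<^sub>r V1\<close> is determined by its values on the last axis, which do not change under
  dilations and do not vanish.
\<close>
lemma g_dil: assumes "e > 0" "z \<noteq> 0" shows "g (D e z) = g z"
proof -
  obtain q where q: "\<And>e z. e > 0 \<Longrightarrow> z \<noteq> 0 \<Longrightarrow> g (D e z) = e powr q * g z"
    using dV1_hom unfolding homogeneous_on_def by auto
  have "g (D 2 e_last) = 2 powr q * g e_last" by (rule q) auto
  moreover have "D 2 e_last = (2 powr (2 * k)) *\<^sub>R e_last" using dil_e_last[of 2 1] by simp
  moreover have "g (s *\<^sub>R e_last) = V1 e_last" if "s > 0" for s using g_axis[OF that, of 1] by simp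
  from this[of 1] this[of "2 powr (2 * k)"] have "g e_last = V1 e_last" "g ((2 powr (2 * k)) *\<^sub>R e_last) = V1 e_last" by auto
  moreover have "V1 e_last > 0" by (rule V1_pos) auto
  ultimately have "(2::real) powr q = 1" by simp
  then have "q = 0" by simp
  then show ?thesis using q[OF assms] assms(1) by simp
qed

lemma V1_unit_lower:
  obtains m where "m > 0" "\<And>w. norm w = 1 \<Longrightarrow> m \<le> V1 w"
proof -
  let ?S = "sphere (0::(real, 'n) vec) 1"
  have "e_last \<in> ?S" by simp
  then have S: "compact ?S" "?S \<noteq> {}" by (rule_tac compact_sphere, blast)
  obtain w0 where w0: "w0 \<in> ?S" "\<And>w. w \<in> ?S \<Longrightarrow> V1 w0 \<le> V1 w"
    using continuous_attains_inf[OF S continuous_on_subset[OF V1_cont]] by blast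
  show thesis by (rule that[of "V1 w0"]) (use w0 in \<open>auto intro!: V1_pos\<close>)
qed

text \<open>
  Every homogeneous function that is bounded on the unit sphere is dominated by the power of \<open>V1\<close> of the
  same degree.
\<close>
lemma homogeneous_bounds:
  obtains C where "C \<ge> 1" "\<And>y. \<bar>u0 y\<bar> \<le> C * sqrt (V1 y)" "\<And>y. \<bar>y $ last_ix\<bar> \<le> C * V1 y"
    "\<And>y. y \<noteq> 0 \<Longrightarrow> \<bar>g y\<bar> \<le> C"
proof -
  let ?S = "sphere (0::(real, 'n) vec) 1"
  have S: "compact ?S" "?S \<subseteq> - {0}" by auto
  obtain m where m: "m > 0" and m_le: "\<And>w. norm w = 1 \<Longrightarrow> m \<le> V1 w" using V1_unit_lower by blast
  obtain K where K: "\<forall>w\<in>?S. \<bar>u0 w\<bar> \<le> K"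
    using compact_imp_bounded[OF compact_continuous_image[OF continuous_on_subset[OF u0_cont] S(1)]]
    by (auto simp: bounded_iff)
  obtain B where B: "\<forall>w\<in>?S. \<bar>g w\<bar> \<le> B"
    using compact_imp_bounded[OF compact_continuous_image[OF continuous_on_subset[OF g_continuous S(2)] S(1)]]
    by (auto simp: bounded_iff)
  define C where "C = max 1 (max (\<bar>K\<bar> / sqrt m) (max (1 / m) B))"
  have C: "C \<ge> 1" "\<bar>K\<bar> / sqrt m \<le> C" "1 / m \<le> C" "B \<le> C" by (auto simp: C_def)
  have main: "\<bar>u0 y\<bar> \<le> C * sqrt (V1 y) \<and> \<bar>y $ last_ix\<bar> \<le> C * V1 y \<and> \<bar>g y\<bar> \<le> C" if "y \<noteq> 0" for y
  proof -
    obtain e w where e: "e > 0" and w: "norm w = 1" and y: "y = D e w" using unit_dilate[OF \<open>y \<noteq> 0\<close>] by blast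
    have w': "w \<in> ?S" "w \<noteq> 0" using w by auto
    have mw: "m \<le> V1 w" using m_le[OF w] .
    have V: "V1 y = e powr (2 * k) * V1 w" using V1_dil[OF e] y by simp
    have sq: "sqrt (V1 y) = e powr k * sqrt (V1 w)"
      unfolding V real_sqrt_mult using e powr_half_sqrt[of "e powr (2 * k)"] by (simp add: powr_powr flip: powr_half_sqrt)
    have "\<bar>u0 y\<bar> = e powr k * \<bar>u0 w\<bar>" using u0_dil[OF e] y by (simp add: abs_mult)
    also have "\<dots> \<le> e powr k * \<bar>K\<bar>" using bspec[OF K w'(1)] by (intro mult_left_mono) auto
    also have "\<dots> \<le> e powr k * (C * sqrt m)" using C(2) m by (intro mult_left_mono) (auto simp: field_simps)
    also have "\<dots> \<le> e powr k * (C * sqrt (V1 w))" using mw C(1) by (intro mult_left_mono) auto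
    finally have 1: "\<bar>u0 y\<bar> \<le> C * sqrt (V1 y)" unfolding sq by (simp add: mult_ac)
    have "\<bar>y $ last_ix\<bar> = e powr (2 * k) * \<bar>w $ last_ix\<bar>"
      unfolding y dil_def using wt_last by (simp add: idx_last abs_mult)
    also have "\<dots> \<le> e powr (2 * k) * 1" using component_le_norm_cart[of w last_ix] w by (intro mult_left_mono) auto
    also have "\<dots> \<le> e powr (2 * k) * (C * m)" using C(3) m by (intro mult_left_mono) (auto simp: field_simps)
    also have "\<dots> \<le> e powr (2 * k) * (C * V1 w)" using mw C(1) by (intro mult_left_mono) auto
    finally have 2: "\<bar>y $ last_ix\<bar> \<le> C * V1 y" unfolding V by (simp add: mult_ac)
    have "\<bar>g y\<bar> \<le> C" using g_dil[OF e w'(2)] y bspec[OF B w'(1)] C(4) by simp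
    with 1 2 show ?thesis by simp
  qed
  show thesis
  proof (rule that[OF C(1)])
    show "\<bar>u0 y\<bar> \<le> C * sqrt (V1 y)" for y using main[of y] by (cases "y = 0") (auto simp: V1_0)
    show "\<bar>y $ last_ix\<bar> \<le> C * V1 y" for y using main[of y] by (cases "y = 0") (auto simp: V1_0)
    show "\<bar>g y\<bar> \<le> C" if "y \<noteq> 0" for y using main[OF that] by simp
  qed
qed

lemma V1_sublevel_bounded: "bounded {y. V1 y \<le> K}"
proof -
  let ?S = "sphere (0::(real, 'n) vec) 1"
  have S: "compact ?S" "?S \<subseteq> - {0}" by auto
  obtain m where m: "m > 0" and m_le: "\<And>w. norm w = 1 \<Longrightarrow> m \<le> V1 w" using V1_unit_lower by blast
  define E where "E = max 1 ((\<bar>K\<bar> / m) powr (1 / (2 * k)))"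
  have "norm y \<le> E powr p" if "V1 y \<le> K" "y \<noteq> 0" for y
  proof -
    obtain e w where e: "e > 0" and w: "norm w = 1" and y: "y = D e w" using unit_dilate[OF \<open>y \<noteq> 0\<close>] by blast
    have "e powr (2 * k) * m \<le> e powr (2 * k) * V1 w"
      using m_le[OF w] by (intro mult_left_mono) auto
    also have "\<dots> \<le> \<bar>K\<bar>" using that(1) V1_dil[OF e] y by simp
    finally have "e powr (2 * k) \<le> \<bar>K\<bar> / m" using m by (simp add: field_simps)
    then have "(e powr (2 * k)) powr (1 / (2 * k)) \<le> (\<bar>K\<bar> / m) powr (1 / (2 * k))"
      using k_pos by (intro powr_mono2) auto
    then have "e \<le> (\<bar>K\<bar> / m) powr (1 / (2 * k))" using e k_pos by (simp add: powr_powr)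
    then have eE: "e \<le> E" by (simp add: E_def)
    have E1: "E \<ge> 1" by (simp add: E_def)
    have p: "p \<ge> 0" using wt_upper[of undefined] wt_lower[of undefined] k_pos by linarith
    have "norm (D e w) \<le> E powr p * norm w"
    proof (rule norm_dil_le)
      fix i :: 'n
      have "e powr wt p \<kappa> (idx i) \<le> E powr wt p \<kappa> (idx i)"
        using e eE wt_lower[of i] k_pos by (intro powr_mono2) auto
      also have "\<dots> \<le> E powr p" using E1 wt_upper by (intro powr_mono) auto
      finally show "e powr wt p \<kappa> (idx i) \<le> E powr p" .
    qed (use e in auto)
    then show ?thesis using y w by simp
  qed
  then have "norm y \<le> E powr p" if "V1 y \<le> K" for y using that by (cases "y = 0") auto
  then show ?thesis by (intro boundedI[of _ "E powr p"]) auto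
qed

end

section \<open>A strict Lyapunov function\<close>

lemma has_vector_derivative_of_integral_equation:
  fixes x h :: "real \<Rightarrow> 'a::euclidean_space"
  assumes "\<And>s. s \<in> {a..b} \<Longrightarrow> (h has_integral (x s - x0)) {a..s}"
    and "continuous_on {a..b} h" and t: "t \<in> {a<..<b}"
  shows "(x has_vector_derivative h t) (at t)"
proof -
  have "((\<lambda>s. integral {a..s} h) has_vector_derivative h t) (at t within {a..b})"
    using assms by (intro integral_has_vector_derivative) auto
  then have "((\<lambda>s. integral {a..s} h) has_vector_derivative h t) (at t)"
    using t by (simp add: at_within_Icc_at)
  then have "((\<lambda>s. x0 + integral {a..s} h) has_vector_derivative h t) (at t)"
    by (auto intro!: derivative_eq_intros)
  then show ?thesis
  proof (rule has_vector_derivative_transform_within_open[of _ _ _ "{a<..<b}"])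
    show "x0 + integral {a..s} h = x s" if "s \<in> {a<..<b}" for s
      using integral_unique[OF assms(1)[of s]] that by simp
  qed (use t in auto)
qed

text \<open>
  The scalar inequality behind the strict Lyapunov function, with \<open>X\<close> in place of \<open>sqrt (V1 y)\<close>, \<open>S\<close> in
  place of \<open>sqrt W\<close> and \<open>LV\<close> in place of the derivative of \<open>V1\<close> along the nominal field. The first summand
  is the derivative of \<open>W * sqrt W\<close>: there \<open>\<eta> * gy\<close> cancels between the chain and the integrator, the excess
  gain contributes \<open>(kP - 1) * u * gy \<le> 0\<close>, and \<open>- S * X\<close> remains, up to a factor. This gives nothing when
  \<open>X = 0\<close>. The cross term \<open>yr * \<eta>\<close> contributes the missing \<open>- \<eta>\<^sup>2\<close>; its other terms are of order \<open>X\<^sup>2\<close> and are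
  absorbed by \<open>S * X\<close> when \<open>\<epsilon>\<close> is small. All terms have the same homogeneity, so a margin for
  perturbations \<open>d1\<close>, \<open>d2\<close> of the matching degrees is left over.
\<close>
lemma lyapunov_constants:
  fixes c kI kP C :: real
  assumes c: "c > 0" and kI: "kI > 0" and kP: "kP \<ge> 1" and C: "C \<ge> 1"
  obtains \<epsilon> a \<mu> where "\<epsilon> > 0" "a > 0" "\<mu> > 0" "\<mu> \<le> 1"
    "\<And>X \<eta> S yr. X \<ge> 0 \<Longrightarrow> S = sqrt (kI * X\<^sup>2 + \<eta>\<^sup>2 / 2) \<Longrightarrow> \<bar>yr\<bar> \<le> C * X\<^sup>2 \<Longrightarrow> \<bar>\<epsilon> * yr * \<eta>\<bar> \<le> S ^ 3 / 2"
    "\<And>X \<eta> S u yr gy LV d1 d2. X \<ge> 0 \<Longrightarrow> S = sqrt (kI * X\<^sup>2 + \<eta>\<^sup>2 / 2) \<Longrightarrow>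
       \<bar>u\<bar> \<le> C * X \<Longrightarrow> \<bar>yr\<bar> \<le> C * X\<^sup>2 \<Longrightarrow> \<bar>gy\<bar> \<le> C \<Longrightarrow> gy * u \<le> 0 \<Longrightarrow> LV \<le> - c * X \<Longrightarrow>
       \<bar>d1\<bar> \<le> \<mu> * S \<Longrightarrow> \<bar>d2\<bar> \<le> \<mu> \<Longrightarrow>
       3 / 2 * S * (kI * (LV + ((kP - 1) * u + \<eta> + d1) * gy) + \<eta> * (- kI * gy + d2))
         - \<epsilon> * ((kP * u + \<eta> + d1) * \<eta> + yr * (- kI * gy + d2)) \<le> - a * S\<^sup>2"
proof -
  define q where "q = sqrt kI"
  define K1 where "K1 = (kP * C)\<^sup>2 / 2 + C * (kI * C + 1)"
  define K2 where "K2 = 3 / 2 * (kI * C + 2) + 2"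
  \<comment> \<open>\<open>\<epsilon>\<close> is bounded by the second entry to absorb \<open>K1 * X\<^sup>2\<close>, and by the third for the cross term bound.\<close>
  define \<epsilon> where "\<epsilon> = min 1 (min (kI * c * q / (2 * K1)) (kI / (4 * C)))"
  define a where "a = min (c * q) \<epsilon> / 2"
  define \<mu> where "\<mu> = min 1 (a / K2)"
  have q: "q > 0" "q\<^sup>2 = kI" using kI by (auto simp: q_def)
  have K1: "K1 > 0" unfolding K1_def using C kI by (intro add_nonneg_pos mult_pos_pos add_pos_pos) auto
  have K2: "K2 > 0" unfolding K2_def using C kI by (simp add: add_pos_pos)
  have \<epsilon>: "\<epsilon> > 0" unfolding \<epsilon>_def using c kI q K1 C by auto
  have \<epsilon>_le: "\<epsilon> \<le> 1" "\<epsilon> \<le> kI * c * q / (2 * K1)" "\<epsilon> \<le> kI / (4 * C)" unfolding \<epsilon>_def by auto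
  have a: "a > 0" unfolding a_def using c q \<epsilon> by auto
  have \<mu>: "\<mu> > 0" "\<mu> \<le> 1" "\<mu> \<le> a / K2" unfolding \<mu>_def using a K2 by auto
  have basic: "S \<ge> 0 \<and> S\<^sup>2 = kI * X\<^sup>2 + \<eta>\<^sup>2 / 2 \<and> \<bar>\<eta>\<bar> \<le> 2 * S \<and> q * X \<le> S"
    if "X \<ge> 0" "S = sqrt (kI * X\<^sup>2 + \<eta>\<^sup>2 / 2)" for X \<eta> S :: real
  proof -
    have W: "kI * X\<^sup>2 + \<eta>\<^sup>2 / 2 \<ge> 0" using kI by auto
    then have S: "S \<ge> 0" "S\<^sup>2 = kI * X\<^sup>2 + \<eta>\<^sup>2 / 2" using that(2) by auto
    have "\<eta>\<^sup>2 \<le> (2 * S)\<^sup>2" using S(2) kI by (simp add: power_mult_distrib)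
    then have "\<bar>\<eta>\<bar> \<le> \<bar>2 * S\<bar>" by (simp only: abs_le_square_iff)
    then have "\<bar>\<eta>\<bar> \<le> 2 * S" using S(1) by simp
    moreover have "(q * X)\<^sup>2 \<le> S\<^sup>2" using S(2) q(2) by (simp add: power_mult_distrib)
    then have "q * X \<le> S" using S(1) power2_le_imp_le by blast
    ultimately show ?thesis using S by simp
  qed
  show thesis
  proof (rule that[of \<epsilon> a \<mu>])
    fix X \<eta> S yr :: real
    assume X: "X \<ge> 0" and S: "S = sqrt (kI * X\<^sup>2 + \<eta>\<^sup>2 / 2)" and yr: "\<bar>yr\<bar> \<le> C * X\<^sup>2"
    note b = basic[OF X S]
    have "kI * X\<^sup>2 \<le> S\<^sup>2" using b by auto
    then have X2: "X\<^sup>2 \<le> S\<^sup>2 / kI" using kI by (simp add: field_simps)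
    have "\<bar>\<epsilon> * yr * \<eta>\<bar> = \<epsilon> * \<bar>yr\<bar> * \<bar>\<eta>\<bar>" using \<epsilon> by (simp add: abs_mult)
    also have "\<dots> \<le> (kI / (4 * C)) * (C * (S\<^sup>2 / kI)) * (2 * S)"
    proof (intro mult_mono)
      show "\<bar>yr\<bar> \<le> C * (S\<^sup>2 / kI)" using yr X2 C by (meson mult_left_mono order_trans zero_le_one)
    qed (use b \<epsilon>_le \<epsilon> C kI in auto)
    also have "\<dots> = S ^ 3 / 2" using C kI by (simp add: field_simps power3_eq_cube power2_eq_square)
    finally show "\<bar>\<epsilon> * yr * \<eta>\<bar> \<le> S ^ 3 / 2" .
  next
    fix X \<eta> S u yr gy LV d1 d2 :: real
    assume X: "X \<ge> 0" and S: "S = sqrt (kI * X\<^sup>2 + \<eta>\<^sup>2 / 2)" and u: "\<bar>u\<bar> \<le> C * X"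
      and yr: "\<bar>yr\<bar> \<le> C * X\<^sup>2" and gy: "\<bar>gy\<bar> \<le> C" and gu: "gy * u \<le> 0" and LV: "LV \<le> - c * X"
      and d1: "\<bar>d1\<bar> \<le> \<mu> * S" and d2: "\<bar>d2\<bar> \<le> \<mu>"
    note b = basic[OF X S]
    have "d1 * gy \<le> \<bar>d1\<bar> * \<bar>gy\<bar>" by (metis abs_ge_self abs_mult)
    also have "\<dots> \<le> (\<mu> * S) * C" using d1 gy by (intro mult_mono) auto
    finally have dg: "d1 * gy \<le> \<mu> * S * C" .
    have "\<eta> * d2 \<le> \<bar>\<eta>\<bar> * \<bar>d2\<bar>" by (metis abs_ge_self abs_mult)
    also have "\<dots> \<le> (2 * S) * \<mu>" using d2 b by (intro mult_mono) auto
    finally have ed: "\<eta> * d2 \<le> 2 * S * \<mu>" .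
    have "kI * (LV + ((kP - 1) * u + \<eta> + d1) * gy) + \<eta> * (- kI * gy + d2)
       = kI * LV + (kI * (kP - 1)) * (gy * u) + kI * (d1 * gy) + \<eta> * d2" by (simp add: algebra_simps)
    also have "\<dots> \<le> kI * (- c * X) + 0 + kI * (\<mu> * S * C) + 2 * S * \<mu>"
      using LV gu dg ed kI kP by (intro add_mono mult_left_mono mult_nonneg_nonpos[of "kI * (kP - 1)"]) auto
    finally have T1: "kI * (LV + ((kP - 1) * u + \<eta> + d1) * gy) + \<eta> * (- kI * gy + d2) \<le>
      - kI * c * X + (kI * C + 2) * \<mu> * S" (is "?T1 \<le> _") by (simp add: algebra_simps)
    have "3 / 2 * S * ?T1 \<le> 3 / 2 * S * (- kI * c * X + (kI * C + 2) * \<mu> * S)"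
      using T1 b by (intro mult_left_mono) auto
    also have "\<dots> = - (3 / 2) * (kI * c) * (S * X) + 3 / 2 * (kI * C + 2) * \<mu> * S\<^sup>2"
      by (simp add: algebra_simps power2_eq_square)
    finally have A: "3 / 2 * S * ?T1 \<le> - (3 / 2) * (kI * c) * (S * X) + 3 / 2 * (kI * C + 2) * \<mu> * S\<^sup>2" .
    have "- (kP * u * \<eta>) \<le> kP * \<bar>u\<bar> * \<bar>\<eta>\<bar>"
      using kP abs_ge_minus_self[of "kP * u * \<eta>"] by (simp add: abs_mult)
    also have "\<dots> \<le> kP * (C * X) * \<bar>\<eta>\<bar>" using u kP by (intro mult_right_mono mult_left_mono) auto
    also have "\<dots> \<le> \<eta>\<^sup>2 / 2 + (kP * C)\<^sup>2 / 2 * X\<^sup>2"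
    proof -
      have "0 \<le> (\<bar>\<eta>\<bar> - kP * C * X)\<^sup>2" by simp
      then show ?thesis by (simp add: power2_diff power_mult_distrib algebra_simps)
    qed
    finally have p1: "- (kP * u * \<eta>) \<le> \<eta>\<^sup>2 / 2 + (kP * C)\<^sup>2 / 2 * X\<^sup>2" .
    have "- (d1 * \<eta>) \<le> \<bar>d1\<bar> * \<bar>\<eta>\<bar>" using abs_ge_minus_self[of "d1 * \<eta>"] by (simp add: abs_mult)
    also have "\<dots> \<le> (\<mu> * S) * (2 * S)" using d1 b \<mu> by (intro mult_mono) auto
    finally have p2: "- (d1 * \<eta>) \<le> 2 * \<mu> * S\<^sup>2" by (simp add: power2_eq_square)
    have "\<bar>- kI * gy + d2\<bar> \<le> kI * \<bar>gy\<bar> + \<bar>d2\<bar>" using kI abs_triangle_ineq[of "- kI * gy" d2] by (simp add: abs_mult)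
    also have "\<dots> \<le> kI * C + 1" using gy d2 \<mu> kI by (intro add_mono mult_left_mono) auto
    finally have m: "\<bar>- kI * gy + d2\<bar> \<le> kI * C + 1" .
    have "- (yr * (- kI * gy + d2)) \<le> \<bar>yr\<bar> * \<bar>- kI * gy + d2\<bar>"
      using abs_ge_minus_self[of "yr * (- kI * gy + d2)"] unfolding abs_mult .
    also have "\<dots> \<le> (C * X\<^sup>2) * (kI * C + 1)" using m yr C by (intro mult_mono) auto
    finally have p3: "- (yr * (- kI * gy + d2)) \<le> C * (kI * C + 1) * X\<^sup>2" by (simp add: mult_ac)
    have "- ((kP * u + \<eta> + d1) * \<eta> + yr * (- kI * gy + d2))
      = - (kP * u * \<eta>) - \<eta>\<^sup>2 - d1 * \<eta> - yr * (- kI * gy + d2)" by (simp add: algebra_simps power2_eq_square)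
    also have "\<dots> \<le> - \<eta>\<^sup>2 / 2 + K1 * X\<^sup>2 + 2 * \<mu> * S\<^sup>2"
      using p1 p2 p3 unfolding K1_def distrib_right by linarith
    finally have "\<epsilon> * - ((kP * u + \<eta> + d1) * \<eta> + yr * (- kI * gy + d2)) \<le> \<epsilon> * (- \<eta>\<^sup>2 / 2 + K1 * X\<^sup>2 + 2 * \<mu> * S\<^sup>2)"
      using \<epsilon> by (intro mult_left_mono) auto
    also have "\<dots> = - (\<epsilon> * (\<eta>\<^sup>2 / 2)) + (\<epsilon> * K1) * X\<^sup>2 + \<epsilon> * (2 * \<mu> * S\<^sup>2)" by (simp add: algebra_simps)
    also have "\<dots> \<le> - (\<epsilon> * (\<eta>\<^sup>2 / 2)) + (kI * c * q / 2) * X\<^sup>2 + 1 * (2 * \<mu> * S\<^sup>2)"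
    proof (intro add_mono mult_right_mono order_refl)
      show "\<epsilon> * K1 \<le> kI * c * q / 2" using \<epsilon>_le(2) K1 by (simp add: field_simps)
    qed (use \<epsilon>_le \<mu> in auto)
    finally have B: "- (\<epsilon> * ((kP * u + \<eta> + d1) * \<eta> + yr * (- kI * gy + d2))) \<le>
      - (\<epsilon> * (\<eta>\<^sup>2 / 2)) + (kI * c * q / 2) * X\<^sup>2 + 2 * \<mu> * S\<^sup>2"
      by (simp only: mult_minus_right mult_1)
    have "(q * X) * X \<le> S * X" using b X by (intro mult_right_mono) auto
    then have "kI * c * ((q * X) * X) \<le> kI * c * (S * X)" using kI c by (intro mult_left_mono) auto
    then have SX: "kI * c * q * X\<^sup>2 \<le> kI * c * (S * X)" by (simp add: power2_eq_square mult_ac)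
    have SX0: "0 \<le> kI * c * (S * X)" using kI c b X by simp
    have "min (c * q) \<epsilon> * (kI * X\<^sup>2) \<le> c * q * (kI * X\<^sup>2)" using kI by (intro mult_right_mono) auto
    moreover have "min (c * q) \<epsilon> * (\<eta>\<^sup>2 / 2) \<le> \<epsilon> * (\<eta>\<^sup>2 / 2)" by (intro mult_right_mono) auto
    moreover have "2 * a * S\<^sup>2 = min (c * q) \<epsilon> * (kI * X\<^sup>2) + min (c * q) \<epsilon> * (\<eta>\<^sup>2 / 2)"
      using b unfolding a_def by (simp add: algebra_simps)
    ultimately have F: "2 * a * S\<^sup>2 \<le> kI * c * q * X\<^sup>2 + \<epsilon> * (\<eta>\<^sup>2 / 2)" by (simp add: mult_ac)
    have "\<mu> * K2 \<le> a" using \<mu>(3) K2 by (simp add: field_simps)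
    then have "\<mu> * K2 * S\<^sup>2 \<le> a * S\<^sup>2" by (intro mult_right_mono) auto
    moreover have "\<mu> * K2 * S\<^sup>2 = 3 / 2 * (kI * C + 2) * \<mu> * S\<^sup>2 + 2 * \<mu> * S\<^sup>2"
      unfolding K2_def by (simp add: algebra_simps)
    ultimately have R: "3 / 2 * (kI * C + 2) * \<mu> * S\<^sup>2 + 2 * \<mu> * S\<^sup>2 \<le> a * S\<^sup>2" by simp
    have sum: "A1 - B1 \<le> - R" if "A1 \<le> - (3 / 2) * P + r1" "- B1 \<le> - E + Q / 2 + r2" "r1 + r2 \<le> R" "2 * R \<le> Q + E" "Q \<le> P"
      for A1 B1 P Q E r1 r2 R :: real
      using that by linarith
    have "3 / 2 * S * ?T1 - \<epsilon> * ((kP * u + \<eta> + d1) * \<eta> + yr * (- kI * gy + d2)) \<le> - (a * S\<^sup>2)"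
    proof (rule sum[OF _ _ R _ SX])
      show "3 / 2 * S * ?T1 \<le> - (3 / 2) * (kI * c * (S * X)) + 3 / 2 * (kI * C + 2) * \<mu> * S\<^sup>2"
        using A by (simp only: mult.assoc)
      show "- (\<epsilon> * ((kP * u + \<eta> + d1) * \<eta> + yr * (- kI * gy + d2))) \<le>
        - (\<epsilon> * (\<eta>\<^sup>2 / 2)) + kI * c * q * X\<^sup>2 / 2 + 2 * \<mu> * S\<^sup>2" using B by (simp only: times_divide_eq_left)
      show "2 * (a * S\<^sup>2) \<le> kI * c * q * X\<^sup>2 + \<epsilon> * (\<eta>\<^sup>2 / 2)" using F by (simp only: mult.assoc)
    qed
    then show "3 / 2 * S * ?T1 - \<epsilon> * ((kP * u + \<eta> + d1) * \<eta> + yr * (- kI * gy + d2)) \<le> - a * S\<^sup>2"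
      by (simp only: mult_minus_left)
  qed (use \<epsilon> a \<mu> in auto)
qed

context homogeneous_chain
begin

lemma nominal_continuous: "continuous_on UNIV (nominal u0)"
  unfolding nominal_def by (intro continuous_intros u0_cont)

text \<open>
  The decay of \<open>V1\<close> is known only along nominal trajectories. Peano's theorem starts a trajectory at
  any nonzero point; the pointwise inequality follows by letting time tend to zero.
\<close>
lemma gradient_decay_raw:
  assumes y0: "y0 \<noteq> 0"
  shows "G y0 \<bullet> nominal u0 y0 \<le> - c * V1 y0 powr \<alpha>"
proof -
  let ?F = "nominal u0"
  define r where "r = norm y0 / 2"
  have r: "r > 0" using y0 by (simp add: r_def)
  \<comment> \<open>Composing with the projection onto a ball away from the origin makes the field bounded.\<close>
  define B where "B = cball y0 r"
  have B: "compact B" "convex B" "closed B" "B \<noteq> {}" "0 \<notin> B" 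
    using r by (auto simp: B_def r_def dist_norm)
  define f where "f t x = ?F (closest_point B x)" for t :: real and x
  have cp: "continuous_on S (closest_point B)" for S by (rule continuous_on_closest_point[OF B(2-4)])
  have fc: "continuous_on UNIV (\<lambda>x. ?F (closest_point B x))"
    by (rule continuous_on_compose2[OF nominal_continuous cp]) auto
  obtain M where M: "\<And>x. x \<in> B \<Longrightarrow> norm (?F x) \<le> M"
    using compact_imp_bounded[OF compact_continuous_image[OF continuous_on_subset[OF nominal_continuous] B(1)]]
    unfolding bounded_iff by auto
  obtain x where xc: "continuous_on {0..1} x" and x0: "x 0 = y0"
    and xi: "\<And>t. t \<in> {0..1} \<Longrightarrow> ((\<lambda>s. f s (x s)) has_integral (x t - y0)) {0..t}"
  proof (rule peano_bounded[of 0 1 f M y0])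
    show "continuous_on ({0<..1} \<times> UNIV) (\<lambda>(t, x). f t x)"
      unfolding f_def split_beta
      by (rule continuous_on_compose2[OF fc]) (auto intro!: continuous_intros)
    show "norm (f t x) \<le> M" for t x
      unfolding f_def by (intro M closest_point_in_set B)
  qed auto
  obtain \<delta> where \<delta>: "\<delta> > 0" "\<And>t. t \<in> {0..1} \<Longrightarrow> dist t 0 < \<delta> \<Longrightarrow> dist (x t) (x 0) < r"
    using xc r unfolding continuous_on_iff by (metis atLeastAtMost_iff order_refl zero_le_one)
  define T where "T = min \<delta> 1"
  have T: "T > 0" "T \<le> 1" "T \<le> \<delta>" using \<delta> by (auto simp: T_def)
  have inB: "x t \<in> B" if "0 \<le> t" "t < T" for t
    using \<delta>(2)[of t] that T x0 by (auto simp: B_def dist_real_def dist_commute)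
  have fF: "f s (x s) = ?F (x s)" if "0 \<le> s" "s < T" for s
    unfolding f_def using inB[OF that] by (simp add: closest_point_self)
  have cont: "continuous_on {0..1} (\<lambda>s. f s (x s))"
    unfolding f_def by (rule continuous_on_compose2[OF fc xc]) auto
  have sol: "filippov_solution (\<lambda>_. ?F) (ereal T) x"
    unfolding filippov_solution_def
  proof (intro conjI exI[of _ "\<lambda>s. f s (x s)"] allI impI)
    fix t assume t: "0 \<le> t" "ereal t < ereal T"
    show "(\<lambda>s. f s (x s)) absolutely_integrable_on {0..t}"
      using t T by (intro absolutely_integrable_continuous_real continuous_on_subset[OF cont]) auto
    show "x t = x 0 + integral {0..t} (\<lambda>s. f s (x s))"
      using xi[of t] t T x0 by (auto simp: integral_unique)
  next
    have "?F z \<in> filippov ?F z" for z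
      using nominal_continuous by (intro isCont_imp_filippov) (simp add: continuous_on_eq_continuous_at)
    then show "AE t in lebesgue. 0 \<le> t \<and> ereal t < ereal T \<longrightarrow> f t (x t) \<in> filippov ?F (x t)"
      using fF by (intro AE_I2) auto
  qed (use T in auto)
  have ineq: "G (x t) \<bullet> ?F (x t) + c * V1 (x t) powr \<alpha> \<le> 0" if t: "0 < t" "t < T" for t
  proof -
    have nz: "x t \<noteq> 0" using inB[of t] t B(5) by auto
    have "(x has_vector_derivative f t (x t)) (at t)"
      by (rule has_vector_derivative_of_integral_equation[OF xi cont]) (use t T in auto)
    then have "(x has_derivative (\<lambda>h. h *\<^sub>R ?F (x t))) (at t)"
      using fF[of t] t by (simp add: has_vector_derivative_def)
    from has_derivative_compose[OF this V1_has_derivative[OF nz]]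
    have "((\<lambda>s. V1 (x s)) has_real_derivative (G (x t) \<bullet> ?F (x t))) (at t)"
      unfolding has_field_derivative_def by (rule has_derivative_eq_rhs) auto
    moreover obtain d where "((\<lambda>s. V1 (x s)) has_real_derivative d) (at t)" "d \<le> - c * V1 (x t) powr \<alpha>"
      using V1_decay[OF sol t(1) _ nz] t by auto
    ultimately show ?thesis using DERIV_unique by fastforce
  qed
  have "((\<lambda>t. x t) \<longlongrightarrow> y0) (at_right 0)"
  proof -
    have "((\<lambda>t. x t) \<longlongrightarrow> x 0) (at 0 within {0..1})" using xc by (auto simp: continuous_on_def)
    then have "(x \<longlongrightarrow> x 0) (at 0 within {0<..1})" by (rule tendsto_within_subset) auto
    moreover have "at (0::real) within {0<..1} = at_right 0" by (rule at_within_nhd[of _ "{..<1}"]) auto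
    ultimately show ?thesis using x0 by simp
  qed
  moreover have "isCont (\<lambda>z. G z \<bullet> ?F z + c * V1 z powr \<alpha>) y0"
  proof -
    have "continuous_on (- {0}) (\<lambda>z. G z \<bullet> ?F z + c * V1 z powr \<alpha>)"
      by (intro continuous_intros G(2) continuous_on_subset[OF nominal_continuous] continuous_on_subset[OF V1_cont]) auto
    then show ?thesis using y0 by (simp add: continuous_on_eq_continuous_at open_Compl)
  qed
  ultimately have "((\<lambda>t. G (x t) \<bullet> ?F (x t) + c * V1 (x t) powr \<alpha>) \<longlongrightarrow> G y0 \<bullet> ?F y0 + c * V1 y0 powr \<alpha>) (at_right 0)"
    using isCont_tendsto_compose by fast
  moreover have "\<forall>\<^sub>F t in at_right 0. G (x t) \<bullet> ?F (x t) + c * V1 (x t) powr \<alpha> \<le> 0"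
    unfolding eventually_at_right_field using ineq T by (intro exI[of _ T]) auto
  ultimately have "G y0 \<bullet> ?F y0 + c * V1 y0 powr \<alpha> \<le> 0"
    by (rule tendsto_upperbound) (simp add: trivial_limit_at_right_real)
  then show ?thesis by simp
qed

text \<open>
  On the level set \<open>V1 = 1\<close> the exponent \<open>\<alpha>\<close> is invisible, and dilating that level set forces the exponent
  \<open>1/2\<close> dictated by the degrees \<open>2 k\<close> of \<open>V1\<close> and \<open>\<kappa> = - k\<close> of the field.
\<close>
lemma gradient_decay:
  assumes y: "y \<noteq> 0"
  shows "G y \<bullet> nominal u0 y \<le> - c * sqrt (V1 y)"
proof -
  define v where "v = V1 y"
  have v: "v > 0" unfolding v_def using y by (rule V1_pos)
  define e where "e = v powr (- 1 / (2 * k))"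
  have e: "e > 0" "e powr (2 * k) = 1 / v" "e powr k = 1 / sqrt v"
  proof -
    have 1: "- 1 / (2 * k) * (2 * k) = - 1" and 2: "- 1 / (2 * k) * k = - (1 / 2)" using k_pos by auto
    show "e powr (2 * k) = 1 / v" "e powr k = 1 / sqrt v"
      using v unfolding e_def powr_powr 1 2 by (simp_all add: powr_minus_divide powr_half_sqrt)
  qed (use v in \<open>simp add: e_def\<close>)
  let ?F = "nominal u0"
  let ?z = "D e y"
  have z: "?z \<noteq> 0" using y e by simp
  have V1z: "V1 ?z = 1" unfolding V1_dil[OF e(1)] e(2) using v by (simp flip: v_def)
  have "((\<lambda>x. D e x) has_derivative D e) (at y)"
    using linear_dil by (simp add: linear_conv_bounded_linear bounded_linear_imp_has_derivative)
  from has_derivative_compose[OF this V1_has_derivative[OF z]]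
  have "((\<lambda>x. V1 (D e x)) has_derivative (\<lambda>h. G ?z \<bullet> D e h)) (at y)" .
  moreover have "((\<lambda>x. V1 (D e x)) has_derivative (\<lambda>h. e powr (2 * k) * (G y \<bullet> h))) (at y)"
    unfolding V1_dil[OF e(1)] by (intro has_derivative_mult_right V1_has_derivative y)
  ultimately have "(\<lambda>h. G ?z \<bullet> D e h) = (\<lambda>h. e powr (2 * k) * (G y \<bullet> h))"
    by (rule has_derivative_unique)
  then have 1: "G ?z \<bullet> D e (?F y) = e powr (2 * k) * (G y \<bullet> ?F y)" by metis
  have "?F ?z = e powr (- k) *\<^sub>R D e (?F y)"
    using field_hom e(1) unfolding homogeneous_field_def k_def by simp
  then have "G ?z \<bullet> ?F ?z = e powr (- k) * (e powr (2 * k) * (G y \<bullet> ?F y))" using 1 by simp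
  also have "\<dots> = e powr k * (G y \<bullet> ?F y)" by (simp flip: powr_add mult.assoc)
  finally have "e powr k * (G y \<bullet> ?F y) \<le> - c" using gradient_decay_raw[OF z] V1z by simp
  then have "(G y \<bullet> ?F y) / sqrt v \<le> - c" using e(3) by simp
  then show ?thesis using v unfolding v_def by (simp add: divide_le_eq)
qed

text \<open>
  The weak Lyapunov function of the chain with its integrator, homogeneous of degree \<open>2 k\<close> when the
  integrator state has weight \<open>k\<close>.
\<close>
definition W :: "(real, 'n) vec \<times> real \<Rightarrow> real" where
  "W q = kI * V1 (fst q) + (snd q)\<^sup>2 / 2"

lemma W_nonneg: "W q \<ge> 0"
  unfolding W_def using kI V1_nonneg by simp

lemma W_eq_0: "W q = 0 \<longleftrightarrow> q = 0"
proof -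
  have "W q = 0 \<longleftrightarrow> kI * V1 (fst q) = 0 \<and> (snd q)\<^sup>2 / 2 = 0"
    unfolding W_def using kI V1_nonneg by (intro add_nonneg_eq_0_iff) auto
  then show ?thesis using kI by (auto simp: prod_eq_iff)
qed

lemma W_cont: "continuous_on UNIV W"
  unfolding W_def by (intro continuous_intros continuous_on_compose2[OF V1_cont]) auto

lemma W_has_derivative:
  assumes "fst q \<noteq> 0"
  shows "(W has_derivative (\<lambda>h. kI * (G (fst q) \<bullet> fst h) + snd q * snd h)) (at q)"
proof -
  have "((\<lambda>q. V1 (fst q)) has_derivative (\<lambda>h. G (fst q) \<bullet> fst h)) (at q)"
    using has_derivative_compose[OF has_derivative_fst[OF has_derivative_ident] V1_has_derivative[OF assms]] by simp
  then show ?thesis unfolding W_def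
    by (auto intro!: derivative_eq_intros simp: power2_eq_square)
qed

text \<open>
  \<open>M\<close> is comparable to \<open>sqrt W\<close> and decreases at the rate \<open>b\<close>, in the time scale of the chain, along the
  perturbed equations, as long as the perturbation \<open>d1\<close> of the chain is small relative to \<open>sqrt W\<close> and
  the perturbation \<open>d2\<close> of the integrator is small. Both smallness conditions are invariant under
  dilations. A linear decrease means that \<open>M\<close> vanishes in finite time. Differentiability is available only
  for \<open>y \<noteq> 0\<close>.
\<close>
definition strict_lyapunov :: "((real, 'n) vec \<times> real \<Rightarrow> real) \<Rightarrow> real \<Rightarrow> real \<Rightarrow> bool" where
  "strict_lyapunov M b \<mu> \<longleftrightarrow> b > 0 \<and> \<mu> > 0 \<and> \<mu> \<le> 1 \<and> continuous_on UNIV M \<and>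
    (\<forall>q. M q \<le> 2 * sqrt (W q) \<and> sqrt (W q) \<le> 2 * M q) \<and>
    (\<forall>q. fst q \<noteq> 0 \<longrightarrow> M differentiable (at q)) \<and>
    (\<forall>y \<eta> t lam d1 d2. lam \<ge> 0 \<longrightarrow> y t \<noteq> 0 \<longrightarrow> \<bar>d1\<bar> \<le> \<mu> * sqrt (W (y t, \<eta> t)) \<longrightarrow> \<bar>d2\<bar> \<le> \<mu> \<longrightarrow>
       (y has_vector_derivative lam *\<^sub>R (J (y t) + (kP * u0 (y t) + \<eta> t + d1) *\<^sub>R e_last)) (at t) \<longrightarrow>
       (\<eta> has_real_derivative lam * (- kI * g (y t) + d2)) (at t) \<longrightarrow>
       (\<exists>d\<le>- (b * lam). ((\<lambda>s. M (y s, \<eta> s)) has_real_derivative d) (at t)))"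

lemmas strict_lyapunov_decay = strict_lyapunov_def[THEN iffD1, THEN conjunct2, THEN conjunct2,
    THEN conjunct2, THEN conjunct2, THEN conjunct2, THEN conjunct2, rule_format]

lemma strict_lyapunovD:
  assumes "strict_lyapunov M b \<mu>"
  shows "b > 0" "\<mu> > 0" "\<mu> \<le> 1" "continuous_on UNIV M" "M q \<le> 2 * sqrt (W q)" "sqrt (W q) \<le> 2 * M q"
    "fst q \<noteq> 0 \<Longrightarrow> M differentiable (at q)"
  using assms unfolding strict_lyapunov_def by blast+

text \<open>
  The function is the cube root of \<open>W * sqrt W - \<epsilon> * y\<^sub>r * \<eta>\<close>, a quantity of degree \<open>3 k\<close> with derivative at
  most \<open>- a * W\<close>; the cube root, of degree \<open>k\<close>, is the power whose derivative is bounded away from zero.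
\<close>
lemma strict_lyapunov_exists: "\<exists>M b \<mu>. strict_lyapunov M b \<mu>"
proof -
  obtain C where C: "C \<ge> 1" "\<And>y. \<bar>u0 y\<bar> \<le> C * sqrt (V1 y)" "\<And>y. \<bar>y $ last_ix\<bar> \<le> C * V1 y"
    "\<And>y. y \<noteq> 0 \<Longrightarrow> \<bar>g y\<bar> \<le> C" using homogeneous_bounds by blast
  obtain \<epsilon> a \<mu> where pos: "\<epsilon> > 0" "a > 0" "\<mu> > 0" "\<mu> \<le> 1"
    and cross: "\<And>X \<eta> S yr. X \<ge> 0 \<Longrightarrow> S = sqrt (kI * X\<^sup>2 + \<eta>\<^sup>2 / 2) \<Longrightarrow> \<bar>yr\<bar> \<le> C * X\<^sup>2 \<Longrightarrow> \<bar>\<epsilon> * yr * \<eta>\<bar> \<le> S ^ 3 / 2"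
    and dec: "\<And>X \<eta> S u yr gy LV d1 d2. X \<ge> 0 \<Longrightarrow> S = sqrt (kI * X\<^sup>2 + \<eta>\<^sup>2 / 2) \<Longrightarrow>
       \<bar>u\<bar> \<le> C * X \<Longrightarrow> \<bar>yr\<bar> \<le> C * X\<^sup>2 \<Longrightarrow> \<bar>gy\<bar> \<le> C \<Longrightarrow> gy * u \<le> 0 \<Longrightarrow> LV \<le> - c * X \<Longrightarrow>
       \<bar>d1\<bar> \<le> \<mu> * S \<Longrightarrow> \<bar>d2\<bar> \<le> \<mu> \<Longrightarrow>
       3 / 2 * S * (kI * (LV + ((kP - 1) * u + \<eta> + d1) * gy) + \<eta> * (- kI * gy + d2))
         - \<epsilon> * ((kP * u + \<eta> + d1) * \<eta> + yr * (- kI * gy + d2)) \<le> - a * S\<^sup>2"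
    using lyapunov_constants[OF c_pos kI kP C(1)] by blast
  define \<Lambda> where "\<Lambda> q = W q * sqrt (W q) - \<epsilon> * (fst q $ last_ix) * snd q" for q
  define M where "M q = root 3 (\<Lambda> q)" for q
  have SW: "sqrt (W q) = sqrt (kI * (sqrt (V1 (fst q)))\<^sup>2 + (snd q)\<^sup>2 / 2)" for q
    unfolding W_def using V1_nonneg by simp
  have cube: "W q * sqrt (W q) = sqrt (W q) ^ 3" for q
    using W_nonneg[of q] by (simp add: power3_eq_cube)
  have \<Lambda>_bounds: "sqrt (W q) ^ 3 / 2 \<le> \<Lambda> q \<and> \<Lambda> q \<le> 2 * sqrt (W q) ^ 3" for q
  proof -
    have "\<bar>\<epsilon> * (fst q $ last_ix) * snd q\<bar> \<le> sqrt (W q) ^ 3 / 2"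
      by (rule cross[OF _ SW]) (use C(3) V1_nonneg in auto)
    moreover have "sqrt (W q) ^ 3 \<ge> 0" using W_nonneg by simp
    ultimately show ?thesis unfolding \<Lambda>_def cube by linarith
  qed
  have upper: "M q \<le> 2 * sqrt (W q)" for q
  proof -
    have "\<Lambda> q \<le> (2 * sqrt (W q)) ^ 3" using \<Lambda>_bounds[of q] W_nonneg[of q] by (simp add: power_mult_distrib)
    then have "M q \<le> root 3 ((2 * sqrt (W q)) ^ 3)" unfolding M_def by simp
    also have "\<dots> = 2 * sqrt (W q)" by (rule odd_real_root_power_cancel) simp
    finally show ?thesis .
  qed
  have lower: "sqrt (W q) \<le> 2 * M q" for q
  proof -
    have "(sqrt (W q) / 2) ^ 3 \<le> \<Lambda> q" using \<Lambda>_bounds[of q] W_nonneg[of q] by (simp add: power_divide)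
    then have "root 3 ((sqrt (W q) / 2) ^ 3) \<le> M q" unfolding M_def by simp
    then show ?thesis using odd_real_root_power_cancel[of 3 "sqrt (W q) / 2"] by simp
  qed
  have cont: "continuous_on UNIV M"
    unfolding M_def \<Lambda>_def
    by (intro continuous_on_real_root continuous_intros W_cont continuous_on_compose2[OF W_cont]) auto
  have W_pos: "W q > 0" if "fst q \<noteq> 0" for q
    using W_nonneg[of q] W_eq_0[of q] that by (auto simp: less_le)
  have \<Lambda>_pos: "\<Lambda> q > 0" if "fst q \<noteq> 0" for q
    using \<Lambda>_bounds[of q] W_pos[OF that] by (smt (verit) real_sqrt_gt_zero zero_less_power half_gt_zero)
  have d32: "((\<lambda>w. w * sqrt w) has_real_derivative 3 / 2 * sqrt w) (at w)" if "w > 0" for w :: real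
  proof -
    have "w * inverse (sqrt w) = sqrt w" using that by (metis divide_inverse real_div_sqrt less_imp_le)
    then show ?thesis using that
      by (auto intro!: derivative_eq_intros simp: field_simps)
  qed
  have \<Lambda>_deriv: "(\<Lambda> has_derivative (\<lambda>h. 3 / 2 * sqrt (W q) * (kI * (G (fst q) \<bullet> fst h) + snd q * snd h)
        - \<epsilon> * (fst h $ last_ix * snd q + fst q $ last_ix * snd h))) (at q)"
    if q: "fst q \<noteq> 0" for q
  proof -
    have 1: "((\<lambda>q. W q * sqrt (W q)) has_derivative (\<lambda>h. 3 / 2 * sqrt (W q) * (kI * (G (fst q) \<bullet> fst h) + snd q * snd h))) (at q)"
      using has_derivative_compose[OF W_has_derivative[OF q], of "\<lambda>w. w * sqrt w" "(*) (3 / 2 * sqrt (W q))"]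
        d32[OF W_pos[OF q]] unfolding has_field_derivative_def by simp
    have "((\<lambda>q. fst q $ last_ix) has_derivative (\<lambda>h. fst h $ last_ix)) (at q)"
      by (intro bounded_linear.has_derivative[OF bounded_linear_vec_nth] has_derivative_fst has_derivative_ident)
    then have 2: "((\<lambda>q. \<epsilon> * (fst q $ last_ix) * snd q) has_derivative (\<lambda>h. \<epsilon> * (fst h $ last_ix * snd q + fst q $ last_ix * snd h))) (at q)"
      by (auto intro!: derivative_eq_intros simp: algebra_simps)
    show ?thesis unfolding \<Lambda>_def by (rule has_derivative_diff[OF 1 2])
  qed
  have root_deriv: "(root 3 has_real_derivative 1 / (3 * (root 3 x)\<^sup>2)) (at x)" if "x > 0" for x
  proof -
    have "odd (3::nat)" "x \<noteq> 0" "3 - Suc 0 = 2" using that by auto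
    then show ?thesis using DERIV_odd_real_root[of 3 x] by (simp add: inverse_eq_divide)
  qed
  have "strict_lyapunov M (a / 12) \<mu>"
    unfolding strict_lyapunov_def
  proof (intro conjI allI impI upper lower cont pos(3,4))
    fix q :: "(real, 'n) vec \<times> real" assume q: "fst q \<noteq> 0"
    show "M differentiable (at q)"
    proof -
      have "(root 3 has_derivative (*) (1 / (3 * (root 3 (\<Lambda> q))\<^sup>2))) (at (\<Lambda> q))"
        using root_deriv[OF \<Lambda>_pos[OF q]] unfolding has_field_derivative_def .
      from has_derivative_compose[OF \<Lambda>_deriv[OF q] this] show ?thesis
        unfolding M_def differentiable_def by blast
    qed
  next
    fix y :: "real \<Rightarrow> (real, 'n) vec" and \<eta> :: "real \<Rightarrow> real" and t lam d1 d2 :: real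
    assume lam: "lam \<ge> 0" and y: "y t \<noteq> 0" and d1: "\<bar>d1\<bar> \<le> \<mu> * sqrt (W (y t, \<eta> t))" and d2: "\<bar>d2\<bar> \<le> \<mu>"
      and dy: "(y has_vector_derivative lam *\<^sub>R (J (y t) + (kP * u0 (y t) + \<eta> t + d1) *\<^sub>R e_last)) (at t)"
      and d\<eta>: "(\<eta> has_real_derivative lam * (- kI * g (y t) + d2)) (at t)"
    let ?q = "(y t, \<eta> t)" and ?S = "sqrt (W (y t, \<eta> t))"
    define y' where "y' = J (y t) + (kP * u0 (y t) + \<eta> t + d1) *\<^sub>R e_last"
    define \<eta>' where "\<eta>' = - kI * g (y t) + d2"
    define L' where "L' = 3 / 2 * ?S * (kI * (G (y t) \<bullet> y') + \<eta> t * \<eta>') - \<epsilon> * (y' $ last_ix * \<eta> t + y t $ last_ix * \<eta>')"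
    have q: "fst ?q \<noteq> 0" using y by simp
    have "((\<lambda>s. (y s, \<eta> s)) has_derivative (\<lambda>h. (h *\<^sub>R (lam *\<^sub>R y'), h * (lam * \<eta>')))) (at t)"
      using has_derivative_Pair[OF dy[unfolded has_vector_derivative_def] d\<eta>[unfolded has_field_derivative_def]]
      by (simp add: y'_def \<eta>'_def mult.commute)
    from has_derivative_compose[OF this \<Lambda>_deriv[OF q]]
    have "((\<lambda>s. \<Lambda> (y s, \<eta> s)) has_real_derivative (lam * L')) (at t)"
      unfolding has_field_derivative_def
      by (rule has_derivative_eq_rhs) (auto simp: L'_def algebra_simps)
    from DERIV_chain2[OF root_deriv[OF \<Lambda>_pos[OF q]] this]
    have der: "((\<lambda>s. M (y s, \<eta> s)) has_real_derivative (1 / (3 * (M ?q)\<^sup>2) * (lam * L'))) (at t)"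
      unfolding M_def .
    have "G (y t) \<bullet> y' = G (y t) \<bullet> nominal u0 (y t) + ((kP - 1) * u0 (y t) + \<eta> t + d1) * g (y t)"
      unfolding y'_def nominal_def g_eq[OF y] by (simp add: algebra_simps inner_add_right)
    moreover have "y' $ last_ix = kP * u0 (y t) + \<eta> t + d1" unfolding y'_def by simp
    ultimately have "L' \<le> - a * ?S\<^sup>2"
      unfolding L'_def \<eta>'_def
      using dec[where X = "sqrt (V1 (y t))" and \<eta> = "\<eta> t" and S = ?S and u = "u0 (y t)" and yr = "y t $ last_ix" and gy = "g (y t)"
        and LV = "G (y t) \<bullet> nominal u0 (y t)" and ?d1.0 = d1 and ?d2.0 = d2] SW[of ?q] C(2)[of "y t"] C(3)[of "y t"] C(4)[OF y] dV1_u0[of "y t"]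
        gradient_decay[OF y] d1 d2 V1_nonneg[of "y t"] by simp
    have Spos: "?S > 0" using W_pos[OF q] by simp
    have Mp: "M ?q > 0" using lower[of ?q] Spos by linarith
    have "(M ?q)\<^sup>2 \<le> (2 * ?S)\<^sup>2" using upper[of ?q] Mp by (intro power_mono) auto
    then have M2: "(M ?q)\<^sup>2 \<le> 4 * ?S\<^sup>2" by (simp only: power_mult_distrib) simp
    have "L' \<le> - (a / 4) * (M ?q)\<^sup>2"
    proof -
      have "a * (M ?q)\<^sup>2 \<le> a * (4 * ?S\<^sup>2)" using M2 pos by (intro mult_left_mono) auto
      then show ?thesis using \<open>L' \<le> - a * ?S\<^sup>2\<close> by simp
    qed
    then have "lam * L' \<le> lam * (- (a / 4) * (M ?q)\<^sup>2)" using lam by (intro mult_left_mono) auto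
    then have "1 / (3 * (M ?q)\<^sup>2) * (lam * L') \<le> 1 / (3 * (M ?q)\<^sup>2) * (lam * (- (a / 4) * (M ?q)\<^sup>2))"
      using Mp by (intro mult_left_mono[of "lam * L'"]) auto
    also have "\<dots> = - (a / 12 * lam)" using Mp by (simp add: field_simps)
    finally show "\<exists>d\<le>- (a / 12 * lam). ((\<lambda>s. M (y s, \<eta> s)) has_real_derivative d) (at t)"
      using der by blast
  qed (use pos in auto)
  then show ?thesis by blast
qed

end

section \<open>Decrease along perturbed trajectories\<close>

lemma isCont_slice:
  fixes F :: "real \<Rightarrow> 'a::euclidean_space \<Rightarrow> 'b::euclidean_space"
  assumes "continuous_on (S \<times> UNIV) (\<lambda>(t, q). F t q)" "t \<in> S"
  shows "isCont (F t) q"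
proof -
  have "continuous_on UNIV (\<lambda>q. (\<lambda>(t, q). F t q) (t, q))"
    by (rule continuous_on_compose2[OF assms(1)]) (use assms(2) in \<open>auto intro!: continuous_intros\<close>)
  then show ?thesis by (simp add: continuous_on_eq_continuous_at)
qed

text \<open>
  The velocity \<open>v\<close> of a solution is known only almost everywhere. A component of it that agrees almost
  everywhere with a continuous function is nevertheless a derivative at every time.
\<close>
lemma linear_velocity_derivative:
  fixes x v :: "real \<Rightarrow> 'a::euclidean_space" and L :: "'a \<Rightarrow> 'b::euclidean_space"
  assumes L: "bounded_linear L" and int: "v integrable_on {0..b}"
    and x: "\<And>s. s \<in> {0..b} \<Longrightarrow> x s = x 0 + integral {0..s} v"
    and t: "t \<in> {a<..<b}" "0 \<le> a" and N: "negligible N"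
    and h: "\<And>s. s \<in> {a..b} - N \<Longrightarrow> L (v s) = h s" "continuous_on {a..b} h"
  shows "((\<lambda>t. L (x t)) has_vector_derivative h t) (at t)"
proof (rule has_vector_derivative_of_integral_equation[OF _ h(2) t(1), of _ "L (x a)"])
  fix s assume s: "s \<in> {a..b}"
  have ints: "v integrable_on {0..s}" by (rule integrable_subinterval_real[OF int]) (use s t in auto)
  have "integral {0..a} v + integral {a..s} v = integral {0..s} v"
    using s t ints by (intro hk_integral_combine) auto
  then have "integral {a..s} v = x s - x a" using x[of s] x[of a] s t by (simp add: algebra_simps)
  moreover have "v integrable_on {a..s}" by (rule integrable_subinterval_real[OF ints]) (use t in auto)
  ultimately have "((\<lambda>t. L (v t)) has_integral L (x s) - L (x a)) {a..s}"
    using has_integral_linear[OF integrable_integral L, of v "{a..s}"]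
    by (simp add: o_def linear_diff[OF bounded_linear.linear[OF L]])
  then show "(h has_integral L (x s) - L (x a)) {a..s}"
    by (rule has_integral_spike[OF N, rotated]) (use h(1) s in auto)
qed

text \<open>
  A zero of \<open>y\<close> is isolated, because \<open>f\<close>, which vanishes with \<open>y\<close>, leaves zero there with nonzero speed.
\<close>
lemma countable_zeros_nonzero_derivative:
  fixes f :: "real \<Rightarrow> real" and y :: "real \<Rightarrow> 'a::real_normed_vector"
  assumes "continuous_on {a<..<c} y"
    and der: "\<And>x. x \<in> {a<..<c} \<Longrightarrow> y x = 0 \<Longrightarrow> \<exists>d. d \<noteq> 0 \<and> (f has_real_derivative d) (at x)"
    and f: "\<And>x. y x = 0 \<Longrightarrow> f x = 0"
  shows "countable {x \<in> {a<..<c}. y x = 0}"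
proof -
  have "{x \<in> {a<..<c}. y x = 0} sparse_in {a<..<c}"
    unfolding sparse_in_eventually_iff[OF open_greaterThanLessThan]
  proof
    fix x assume x: "x \<in> {a<..<c}"
    show "\<forall>\<^sub>F t in at x. t \<notin> {x \<in> {a<..<c}. y x = 0}"
    proof (cases "y x = 0")
      case True
      then obtain d where d: "d \<noteq> 0" "(f has_real_derivative d) (at x)" using der x by blast
      then have "((\<lambda>t. (f t - f x) / (t - x)) \<longlongrightarrow> d) (at x)"
        by (simp add: has_field_derivative_iff)
      then have "\<forall>\<^sub>F t in at x. (f t - f x) / (t - x) \<noteq> 0"
        using d(1) by (rule tendsto_imp_eventually_ne)
      then show ?thesis by eventually_elim (use f True in auto)
    next
      case False
      have "isCont y x" using assms(1) x by (simp add: continuous_on_eq_continuous_at)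
      then have "(y \<longlongrightarrow> y x) (at x)" by (simp add: isCont_def)
      then have "\<forall>\<^sub>F t in at x. y t \<noteq> 0" using False by (rule tendsto_imp_eventually_ne)
      then show ?thesis by eventually_elim auto
    qed
  qed
  from sparse_imp_countable[OF open_greaterThanLessThan this] show ?thesis
    by (rule countable_subset[rotated]) auto
qed

context homogeneous_chain
begin

text \<open>
  At times with \<open>y = 0\<close> the chain rule is not available, since \<open>M\<close> need be neither differentiable nor locally
  Lipschitz where \<open>y\<close> vanishes. But then \<open>W = \<eta>\<^sup>2/2\<close> and \<open>\<mu> \<le> 1\<close>, so \<open>d1\<close> cannot compensate
  \<open>\<eta>\<close>: the last coordinate of \<open>y\<close> crosses zero with nonzero speed as long as \<open>M > R\<close>. Such times are isolated,
  hence countable, and a countable exceptional set is harmless.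
\<close>
lemma lyapunov_phase:
  fixes y :: "real \<Rightarrow> (real, 'n) vec" and \<eta> d1 :: "real \<Rightarrow> real"
  assumes lyap: "strict_lyapunov M b \<mu>" and st: "s \<le> t" and lam: "lam > 0" and R: "R \<ge> 0"
    and yc: "continuous_on {s..t} y" and \<eta>c: "continuous_on {s..t} \<eta>" and N: "negligible N"
    and d1: "\<And>\<tau>. \<tau> \<in> {s<..<t} \<Longrightarrow> M (y \<tau>, \<eta> \<tau>) > R \<Longrightarrow> \<bar>d1 \<tau>\<bar> \<le> \<mu> * sqrt (W (y \<tau>, \<eta> \<tau>))"
    and dy: "\<And>\<tau>. \<tau> \<in> {s<..<t} \<Longrightarrow>
      (y has_vector_derivative lam *\<^sub>R (J (y \<tau>) + (kP * u0 (y \<tau>) + \<eta> \<tau> + d1 \<tau>) *\<^sub>R e_last)) (at \<tau>)"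
    and d\<eta>: "\<And>\<tau>. \<tau> \<in> {s<..<t} - N \<Longrightarrow> y \<tau> \<noteq> 0 \<Longrightarrow>
      \<exists>d2. \<bar>d2\<bar> \<le> \<mu> \<and> (\<eta> has_real_derivative lam * (- kI * g (y \<tau>) + d2)) (at \<tau>)"
    and calm: "\<And>\<tau>. \<tau> \<in> {s<..<t} \<inter> N \<Longrightarrow> y \<tau> \<noteq> 0 \<Longrightarrow> calm_at \<eta> \<tau>"
  shows "M (y t, \<eta> t) \<le> max R (M (y s, \<eta> s) - b * lam * (t - s))"
proof (rule barrier_decrease[OF st])
  note b = strict_lyapunovD(1)[OF lyap] and \<mu> = strict_lyapunovD(2,3)[OF lyap]
    and Mc = strict_lyapunovD(4)[OF lyap] and up = strict_lyapunovD(5)[OF lyap]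
    and Md = strict_lyapunovD(7)[OF lyap] and dec = strict_lyapunov_decay[OF lyap]
  show cont: "continuous_on {s..t} (\<lambda>t. M (y t, \<eta> t))"
    by (rule continuous_on_compose2[OF Mc]) (auto intro!: continuous_intros yc \<eta>c)
  show "0 < b * lam" using b lam by simp
  fix a e assume ac: "s \<le> a" "a \<le> e" "e \<le> t" and big: "\<And>x. x \<in> {a..e} \<Longrightarrow> R < M (y x, \<eta> x)"
  let ?Z = "{x \<in> {a<..<e}. y x = 0}"
  have "countable ?Z"
  proof (rule countable_zeros_nonzero_derivative[where f = "\<lambda>x. y x $ last_ix"])
    show "continuous_on {a<..<e} y" by (rule continuous_on_subset[OF yc]) (use ac in auto)
    fix x assume x: "x \<in> {a<..<e}" and y0: "y x = 0"
    let ?d = "lam * (\<eta> x + d1 x)"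
    have xst: "x \<in> {s<..<t}" using x ac by auto
    have "((\<lambda>x. y x $ last_ix) has_vector_derivative (lam *\<^sub>R (J (y x) + (kP * u0 (y x) + \<eta> x + d1 x) *\<^sub>R e_last)) $ last_ix) (at x)"
      by (rule bounded_linear.has_vector_derivative[OF bounded_linear_vec_nth dy[OF xst]])
    then have der: "((\<lambda>x. y x $ last_ix) has_real_derivative ?d) (at x)"
      using y0 by (simp add: has_real_derivative_iff_has_vector_derivative)
    have "M (y x, \<eta> x) > 0" using big[of x] x R by auto
    then have "sqrt (W (y x, \<eta> x)) > 0" using up[of "(y x, \<eta> x)"] by linarith
    then have W: "W (y x, \<eta> x) > 0" by simp
    have W2: "W (y x, \<eta> x) = (\<eta> x)\<^sup>2 / 2" using y0 by (simp add: W_def V1_0)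
    have "\<bar>d1 x\<bar> \<le> \<mu> * sqrt (W (y x, \<eta> x))" using d1[OF xst] big[of x] x by auto
    also have "\<dots> \<le> 1 * sqrt (W (y x, \<eta> x))" using \<mu> W by (intro mult_right_mono) auto
    also have "\<dots> < sqrt ((\<eta> x)\<^sup>2)" using W W2 by (simp only: mult_1 real_sqrt_less_iff)
    finally have "\<bar>d1 x\<bar> < \<bar>\<eta> x\<bar>" by simp
    then have "?d \<noteq> 0" using lam by auto
    with der show "\<exists>d. d \<noteq> 0 \<and> ((\<lambda>x. y x $ last_ix) has_real_derivative d) (at x)" by blast
  qed auto
  show "M (y e, \<eta> e) \<le> M (y a, \<eta> a) - b * lam * (e - a)"
  proof (rule decrease_of_derivative_off_exceptional[OF ac(2) _ \<open>countable ?Z\<close> N])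
    show "continuous_on {a..e} (\<lambda>t. M (y t, \<eta> t))" by (rule continuous_on_subset[OF cont]) (use ac in auto)
    show "calm_at (\<lambda>t. M (y t, \<eta> t)) x" if x: "x \<in> {a<..<e} \<inter> N - ?Z" for x
    proof -
      have *: "x \<in> {s<..<t} \<inter> N" "y x \<noteq> 0" using x ac by auto
      show ?thesis
        by (rule calm_at_Pair_compose[OF dy calm[OF *] Md]) (use * in auto)
    qed
    show "\<exists>d\<le>- (b * lam). ((\<lambda>t. M (y t, \<eta> t)) has_real_derivative d) (at x)" if x: "x \<in> {a<..<e} - N - ?Z" for x
    proof -
      have *: "x \<in> {s<..<t} - N" "x \<in> {s<..<t}" "y x \<noteq> 0" using x ac by auto
      obtain d2 where d2: "\<bar>d2\<bar> \<le> \<mu>" "(\<eta> has_real_derivative lam * (- kI * g (y x) + d2)) (at x)"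
        using d\<eta>[OF *(1,3)] by blast
      show ?thesis
        by (rule dec[OF _ *(3) d1[OF *(2)] d2(1) dy[OF *(2)] d2(2)]) (use lam big x in auto)
    qed
  qed
qed

end

text \<open>
  The perturbed closed loop with gain \<open>lam\<close>. In the coordinates \<open>y = D\<^sub>\<lambda> z\<close> it is a perturbation of the system
  treated above, run \<open>lam\<close> times faster.
\<close>
locale perturbed_loop = homogeneous_chain \<kappa> p c \<alpha> kP kI u0 V1
  for \<kappa> p c \<alpha> kP kI :: real and u0 V1 :: "real ^ 'n::{finite,linorder} \<Rightarrow> real" +
  fixes \<gamma>m \<gamma>M \<gamma>bar \<phi>bar \<phi>M lam :: real and \<gamma> \<phi> :: "real \<Rightarrow> real"
  assumes gm: "0 < \<gamma>m" and \<gamma>_lip: "lipschitz_with_rate \<gamma>bar \<gamma>" and \<phi>_lip: "lipschitz_with_rate \<phi>bar \<phi>"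
    and \<gamma>_bounds: "t \<ge> 0 \<Longrightarrow> \<gamma>m \<le> \<gamma> t" "t \<ge> 0 \<Longrightarrow> \<gamma> t \<le> \<gamma>M" and \<phi>_bound: "t \<ge> 0 \<Longrightarrow> \<bar>\<phi> t\<bar> \<le> \<phi>M"
    and bars: "0 \<le> \<gamma>bar" "0 \<le> \<phi>bar" and lam: "lam > 0"
begin

definition \<gamma>d :: real where "\<gamma>d = (\<gamma>M + \<gamma>m) / 2"

abbreviation fld where "fld \<equiv> closed_loop \<gamma>d kP kI lam u0 V1 \<gamma> \<phi>"

definition A :: "real \<Rightarrow> (real, 'n) vec \<times> real \<Rightarrow> (real, 'n) vec" where
  "A t q = J (fst q) + (\<gamma> t * u_st \<gamma>d kP kI lam u0 (fst q) (snd q) + \<phi> t) *\<^sub>R e_last"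

lemma fld_eq: "fld t q = (A t q, lam * g (Dscale lam (fst q)))"
  by (simp add: closed_loop_def A_def split_beta)

lemma \<gamma>M_ge: "\<gamma>m \<le> \<gamma>M"
  using \<gamma>_bounds[of 0] by simp

lemma \<gamma>d_pos: "\<gamma>d > 0" "\<gamma>d \<ge> \<gamma>m"
  using gm \<gamma>M_ge by (auto simp: \<gamma>d_def)

lemma \<gamma>_cont: "continuous_on {0..} \<gamma>" and \<phi>_cont: "continuous_on {0..} \<phi>"
  using \<gamma>_lip \<phi>_lip unfolding lipschitz_with_rate_def using lipschitz_on_continuous_on by auto

lemma Dscale_cont [continuous_intros]: "continuous_on S f \<Longrightarrow> continuous_on S (\<lambda>x. Dscale lam (f x :: (real, 'n) vec))"
  by (rule continuous_on_compose2[OF linear_continuous_on[of "Dscale lam" UNIV]])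
    (use linear_Dscale in \<open>auto simp: linear_conv_bounded_linear\<close>)

lemma A_cont: "continuous_on ({0..} \<times> UNIV) (\<lambda>(t, q). A t q)"
  unfolding A_def u_st_def split_beta
  by (intro continuous_intros continuous_on_compose2[OF \<gamma>_cont] continuous_on_compose2[OF \<phi>_cont]
      continuous_on_compose2[OF u0_cont]) auto

lemma A_curve_cont: "continuous_on S x \<Longrightarrow> S \<subseteq> {0..} \<Longrightarrow> continuous_on S (\<lambda>t. A t (x t))"
proof -
  assume "continuous_on S x" "S \<subseteq> {0..}"
  then have "continuous_on S (\<lambda>t. (\<lambda>(t, q). A t q) (t, x t))"
    by (intro continuous_on_compose2[OF A_cont] continuous_intros) auto
  then show ?thesis by simp
qed

lemma gD_cont: "continuous_on S z \<Longrightarrow> (\<And>s. s \<in> S \<Longrightarrow> z s \<noteq> 0) \<Longrightarrow> continuous_on S (\<lambda>s. lam * g (Dscale lam (z s)))"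
  using lam by (intro continuous_intros continuous_on_compose2[OF g_continuous]) auto

lemma fld_isCont: assumes "t \<ge> 0" "fst q \<noteq> 0" shows "isCont (fld t) q"
proof -
  have "isCont (A t) q" by (rule isCont_slice[OF A_cont]) (use assms in auto)
  moreover have "isCont (\<lambda>q. lam * g (Dscale lam (fst q))) q"
  proof -
    let ?O = "- {q :: (real, 'n) vec \<times> real. fst q = 0}"
    have "open ?O" by (intro open_Compl closed_Collect_eq continuous_intros)
    moreover have "continuous_on ?O (\<lambda>q. lam * g (Dscale lam (fst q)))"
      by (rule gD_cont) (auto intro!: continuous_intros)
    moreover have "q \<in> ?O" using assms(2) by simp
    ultimately show ?thesis by (simp only: continuous_on_eq_continuous_at)
  qed
  ultimately have "isCont (\<lambda>q. (A t q, lam * g (Dscale lam (fst q)))) q"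
    by (rule continuous_Pair)
  then show ?thesis by (simp add: fld_eq[abs_def])
qed

lemma g_bound: obtains B where "B > 0" "\<And>z. \<bar>lam * g z\<bar> \<le> B"
proof -
  obtain C where C: "C \<ge> 1" "\<And>y. y \<noteq> 0 \<Longrightarrow> \<bar>g y\<bar> \<le> C" using homogeneous_bounds by metis
  show thesis
  proof (rule that[of "lam * max C \<bar>g 0\<bar>"])
    show "lam * max C \<bar>g 0\<bar> > 0" using lam C(1) by auto
    show "\<bar>lam * g z\<bar> \<le> lam * max C \<bar>g 0\<bar>" for z
      using lam C(2)[of z] by (cases "z = 0") (auto simp: abs_mult intro!: mult_left_mono)
  qed
qed

lemma filippov_fld:
  assumes "t \<ge> 0" "v \<in> filippov (fld t) q"
  shows "fst v = A t q" "fst q \<noteq> 0 \<Longrightarrow> snd v = lam * g (Dscale lam (fst q))"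
    "(\<And>z. \<bar>lam * g z\<bar> \<le> B) \<Longrightarrow> \<bar>snd v\<bar> \<le> B"
proof -
  have "isCont (A t) q" by (rule isCont_slice[OF A_cont]) (use assms in auto)
  then have "isCont (\<lambda>q. fst (fld t q)) q" by (simp add: fld_eq)
  from filippov_linear_image[OF this bounded_linear_fst assms(2)] show "fst v = A t q" by (simp add: fld_eq)
  show "snd v = lam * g (Dscale lam (fst q))" if "fst q \<noteq> 0"
  proof -
    have "isCont (\<lambda>q. snd (fld t q)) q" using fld_isCont[OF assms(1) that] by (rule continuous_snd)
    from filippov_linear_image[OF this bounded_linear_snd assms(2)] show ?thesis by (simp add: fld_eq)
  qed
  show "\<bar>snd v\<bar> \<le> B" if B: "\<And>z. \<bar>lam * g z\<bar> \<le> B"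
  proof -
    have "filippov (fld t) q \<subseteq> UNIV \<times> {-B..B}"
    proof (rule filippov_subset[of 1])
      show "fld t y \<in> UNIV \<times> {-B..B}" for y
        using B[of "Dscale lam (fst y)"] by (auto simp: fld_eq abs_le_iff)
    qed (auto intro!: closed_Times convex_Times)
    then have "v \<in> UNIV \<times> {-B..B}" using assms(2) by blast
    then show ?thesis by (cases v) auto
  qed
qed

text \<open>
  The chain equations have a continuous right-hand side, so \<open>z\<close> is continuously differentiable although
  \<open>w\<close> need not be. While \<open>z \<noteq> 0\<close> this holds for \<open>w\<close> too.
\<close>
lemma solution_regular:
  assumes sol: "filippov_solution fld T x"
  shows "ereal t < T \<Longrightarrow> continuous_on {0..t} x"
    and "0 < t \<Longrightarrow> ereal t < T \<Longrightarrow> ((\<lambda>t. fst (x t)) has_vector_derivative A t (x t)) (at t)"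
    and "0 < t \<Longrightarrow> ereal t < T \<Longrightarrow> fst (x t) \<noteq> 0 \<Longrightarrow>
      ((\<lambda>t. snd (x t)) has_real_derivative lam * g (Dscale lam (fst (x t)))) (at t)"
proof -
  obtain v where v: "\<And>t. t \<ge> 0 \<Longrightarrow> ereal t < T \<Longrightarrow> v absolutely_integrable_on {0..t} \<and> x t = x 0 + integral {0..t} v"
    and ae: "AE t in lebesgue. 0 \<le> t \<and> ereal t < T \<longrightarrow> v t \<in> filippov (fld t) (x t)"
    using sol unfolding filippov_solution_def by blast
  obtain N where N: "negligible N" and vN: "\<And>t. t \<notin> N \<Longrightarrow> 0 \<le> t \<Longrightarrow> ereal t < T \<Longrightarrow> v t \<in> filippov (fld t) (x t)"
    using AE_E3[OF ae] unfolding negligible_iff_null_sets by (metis (no_types, lifting) DiffI UNIV_I space_completion space_lborel space_borel)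
  have int: "v integrable_on {0..t}" if "t \<ge> 0" "ereal t < T" for t
    using v[OF that] by (simp add: absolutely_integrable_on_def)
  have cont: "continuous_on {0..t} x" if t: "ereal t < T" for t
  proof (cases "t \<ge> 0")
    case True
    have "continuous_on {0..t} (\<lambda>s. x 0 + integral {0..s} v)"
      by (intro continuous_intros indefinite_integral_continuous_1 int True t)
    then show ?thesis
    proof (rule continuous_on_eq)
      fix s assume s: "s \<in> {0..t}"
      then have "ereal s < T" using t by (auto intro: le_less_trans[of "ereal s" "ereal t"])
      then show "x 0 + integral {0..s} v = x s" using v[of s] s by simp
    qed
  qed auto
  show "continuous_on {0..t} x" if "ereal t < T" using cont[OF that] .
  have mid: "\<exists>b>t. ereal b < T" if t: "ereal t < T" for t :: real
  proof -
    obtain r where "ereal t < r" "r < T" using dense t by blast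
    then show ?thesis by (cases r) auto
  qed
  show "((\<lambda>t. fst (x t)) has_vector_derivative A t (x t)) (at t)" if t: "0 < t" "ereal t < T"
  proof -
    obtain b where b: "t < b" "ereal b < T" using mid t by blast
    have lt: "ereal s < T" if "s \<le> b" for s
      using that b by (auto intro: le_less_trans[of "ereal _" "ereal b"])
    show ?thesis
    proof (rule linear_velocity_derivative[OF bounded_linear_fst, where v = v and b = b and a = 0 and N = N])
      show "fst (v s) = A s (x s)" if "s \<in> {0..b} - N" for s
        using filippov_fld(1)[OF _ vN[of s]] that lt by auto
      show "x s = x 0 + integral {0..s} v" if "s \<in> {0..b}" for s
        using v[of s] that lt by simp
    qed (use int N A_curve_cont[OF cont[OF b(2)]] t b in auto)
  qed
  show "((\<lambda>t. snd (x t)) has_real_derivative lam * g (Dscale lam (fst (x t)))) (at t)"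
    if t: "0 < t" "ereal t < T" and nz: "fst (x t) \<noteq> 0"
  proof -
    obtain b where b: "t < b" "ereal b < T" using mid t by blast
    have "continuous_on {0<..<b} x" by (rule continuous_on_subset[OF cont[OF b(2)]]) auto
    then have "isCont (\<lambda>t. fst (x t)) t" using t b by (auto simp: continuous_on_eq_continuous_at intro: continuous_fst)
    then have "((\<lambda>t. fst (x t)) \<longlongrightarrow> fst (x t)) (nhds t)"
      using tendsto_at_iff_tendsto_nhds[of "\<lambda>t. fst (x t)" t] by (simp add: isCont_def)
    then have "\<forall>\<^sub>F s in nhds t. fst (x s) \<noteq> 0"
      using nz by (rule tendsto_imp_eventually_ne)
    then obtain d where d: "d > 0" "\<And>s. dist s t < d \<Longrightarrow> fst (x s) \<noteq> 0"
      unfolding eventually_nhds_metric by blast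
    define a where "a = max (t / 2) (t - d / 2)"
    define e where "e = min b (t + d / 2)"
    have ae: "0 < a" "a < t" "t < e" "e \<le> b" using t b d(1) by (auto simp: a_def e_def)
    have nz': "fst (x s) \<noteq> 0" if "s \<in> {a..e}" for s
      by (rule d(2)) (use that d(1) in \<open>auto simp: a_def e_def dist_real_def abs_less_iff\<close>)
    have lt: "ereal s < T" if "s \<le> e" for s
      using that ae b by (auto intro: le_less_trans[of "ereal _" "ereal b"])
    have "((\<lambda>t. snd (x t)) has_vector_derivative lam * g (Dscale lam (fst (x t)))) (at t)"
    proof (rule linear_velocity_derivative[OF bounded_linear_snd, where v = v and b = e and a = a and N = N])
      show "snd (v s) = lam * g (Dscale lam (fst (x s)))" if "s \<in> {a..e} - N" for s
        using filippov_fld(2)[OF _ vN[of s] nz'[of s]] lt[of s] ae that by auto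
      show "continuous_on {a..e} (\<lambda>t. lam * g (Dscale lam (fst (x t))))"
        by (rule gD_cont) (use nz' ae in \<open>auto intro!: continuous_intros continuous_on_subset[OF cont[OF b(2)]]\<close>)
      show "x s = x 0 + integral {0..s} v" if "s \<in> {0..e}" for s
        using v[of s] that lt by simp
    qed (use lt int N ae in auto)
    then show ?thesis by (simp add: has_real_derivative_iff_has_vector_derivative)
  qed
qed

end

section \<open>Finite-time convergence of the closed loop\<close>

context homogeneous_chain
begin

lemma abs_le_sqrt_W: "\<bar>\<eta>\<bar> \<le> 2 * sqrt (W (y, \<eta>))"
proof -
  have "kI * V1 y \<ge> 0" using kI V1_nonneg by simp
  then have "\<eta>\<^sup>2 \<le> 4 * W (y, \<eta>)" unfolding W_def by simp
  then have "sqrt (\<eta>\<^sup>2) \<le> sqrt (4 * W (y, \<eta>))" by (rule real_sqrt_le_mono)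
  then show ?thesis by (simp add: real_sqrt_mult)
qed

definition loop_bound :: "real \<Rightarrow> bool" where
  "loop_bound K \<longleftrightarrow> K \<ge> 1 \<and> (\<forall>y. y \<noteq> 0 \<longrightarrow> \<bar>kI * g y\<bar> \<le> K) \<and>
    (\<forall>y \<eta>. \<bar>kP * u0 y\<bar> \<le> K * sqrt (W (y, \<eta>)) \<and> \<bar>kP * u0 y + \<eta>\<bar> \<le> K * sqrt (W (y, \<eta>)))"

lemma loop_bound_exists: "\<exists>K. loop_bound K"
proof -
  obtain C where C: "C \<ge> 1" "\<And>y. \<bar>u0 y\<bar> \<le> C * sqrt (V1 y)" "\<And>y. y \<noteq> 0 \<Longrightarrow> \<bar>g y\<bar> \<le> C"
    using homogeneous_bounds by metis
  define K0 where "K0 = kP * C / sqrt kI"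
  have K0: "K0 \<ge> 0" unfolding K0_def using kP C kI by auto
  have u: "\<bar>kP * u0 y\<bar> \<le> K0 * sqrt (W (y, \<eta>))" for y \<eta>
  proof -
    have "kI * V1 y \<le> W (y, \<eta>)" unfolding W_def by simp
    then have "sqrt kI * sqrt (V1 y) \<le> sqrt (W (y, \<eta>))" by (simp flip: real_sqrt_mult)
    then have le: "sqrt (V1 y) \<le> sqrt (W (y, \<eta>)) / sqrt kI" using kI by (simp add: field_simps)
    have "\<bar>kP * u0 y\<bar> \<le> kP * (C * sqrt (V1 y))" using C(2)[of y] kP by (simp add: abs_mult)
    also have "\<dots> \<le> kP * (C * (sqrt (W (y, \<eta>)) / sqrt kI))" using le kP C(1) by (intro mult_left_mono) auto
    finally show ?thesis by (simp add: K0_def)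
  qed
  have "loop_bound (K0 + 2 + kI * C)" unfolding loop_bound_def
  proof (intro conjI allI impI)
    have kIC: "kI * C \<ge> 0" using kI C by simp
    have S: "sqrt (W q) \<ge> 0" for q using W_nonneg by simp
    show "K0 + 2 + kI * C \<ge> 1" using K0 kIC by simp
    fix y \<eta>
    have le: "K0 * sqrt (W (y, \<eta>)) + 2 * sqrt (W (y, \<eta>)) \<le> (K0 + 2 + kI * C) * sqrt (W (y, \<eta>))"
      using kIC S[of "(y, \<eta>)"] by (simp add: distrib_right)
    show "\<bar>kP * u0 y\<bar> \<le> (K0 + 2 + kI * C) * sqrt (W (y, \<eta>))" "\<bar>kP * u0 y + \<eta>\<bar> \<le> (K0 + 2 + kI * C) * sqrt (W (y, \<eta>))"
      using le u[of y \<eta>] abs_le_sqrt_W[of \<eta> y] S[of "(y, \<eta>)"] by linarith+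
  next
    fix y :: "(real, 'n) vec" assume "y \<noteq> 0"
    then have "kI * \<bar>g y\<bar> \<le> kI * C" using C(3) kI by (intro mult_left_mono) auto
    moreover have "\<bar>kI * g y\<bar> = kI * \<bar>g y\<bar>" using kI by (simp add: abs_mult)
    ultimately show "\<bar>kI * g y\<bar> \<le> K0 + 2 + kI * C" using K0 by linarith
  qed
  then show ?thesis by blast
qed

end

context perturbed_loop
begin

definition \<rho> :: "real \<Rightarrow> real" where "\<rho> t = \<gamma> t / \<gamma>d"

lemma \<rho>_near_1: assumes "t \<ge> 0" shows "\<bar>\<rho> t - 1\<bar> \<le> 1 - \<gamma>m / \<gamma>M"
proof -
  have M: "\<gamma>M > 0" using gm \<gamma>M_ge by simp
  have "\<bar>\<gamma> t - \<gamma>d\<bar> \<le> (\<gamma>M - \<gamma>m) / 2" using \<gamma>_bounds[OF assms] unfolding \<gamma>d_def by (auto simp: abs_le_iff field_simps)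
  then have "\<bar>\<gamma> t - \<gamma>d\<bar> / \<gamma>d \<le> ((\<gamma>M - \<gamma>m) / 2) / \<gamma>d"
    using \<gamma>d_pos(1) by (intro divide_right_mono) auto
  moreover have "\<rho> t - 1 = (\<gamma> t - \<gamma>d) / \<gamma>d"
    using \<gamma>d_pos(1) by (simp add: \<rho>_def diff_divide_distrib)
  ultimately have "\<bar>\<rho> t - 1\<bar> \<le> ((\<gamma>M - \<gamma>m) / 2) / \<gamma>d"
    using \<gamma>d_pos(1) by (simp add: abs_divide)
  also have "\<dots> \<le> ((\<gamma>M - \<gamma>m) / 2) / (\<gamma>M / 2)"
    using \<gamma>M_ge M gm unfolding \<gamma>d_def by (intro divide_left_mono) auto
  also have "\<dots> = 1 - \<gamma>m / \<gamma>M" using M by (simp add: diff_divide_distrib)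
  finally show ?thesis .
qed

lemma rate_negligible:
  obtains N where "negligible N"
    "\<And>t. t > 0 \<Longrightarrow> t \<notin> N \<Longrightarrow> \<exists>d. (\<gamma> has_real_derivative d) (at t) \<and> \<bar>d\<bar> \<le> \<gamma>bar"
    "\<And>t. t > 0 \<Longrightarrow> t \<notin> N \<Longrightarrow> \<exists>d. (\<phi> has_real_derivative d) (at t) \<and> \<bar>d\<bar> \<le> \<phi>bar"
proof -
  have ae: "AE t in lebesgue. (0 < t \<longrightarrow> (\<exists>d. (\<gamma> has_real_derivative d) (at t) \<and> \<bar>d\<bar> \<le> \<gamma>bar)) \<and>
     (0 < t \<longrightarrow> (\<exists>d. (\<phi> has_real_derivative d) (at t) \<and> \<bar>d\<bar> \<le> \<phi>bar))" (is "AE t in lebesgue. ?P t")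
    using \<gamma>_lip \<phi>_lip unfolding lipschitz_with_rate_def by simp
  obtain N where "\<And>t. t \<in> space lebesgue - N \<Longrightarrow> ?P t" "N \<in> null_sets lebesgue"
    by (rule AE_E3[OF ae that])
  then show thesis by (intro that[of N]) (auto simp: negligible_iff_null_sets)
qed

text \<open>
  In the coordinates \<open>y\<close> and \<open>\<omega>\<close> the gain \<open>lam\<close> is only a change of the time scale, and the uncertainty enters
  through \<open>\<rho>\<close> and \<open>\<phi>\<close> in the last equation of the chain; for \<open>\<rho> = 1\<close>, \<open>\<phi> = 0\<close> it disappears.
\<close>
lemma loop_coordinates:
  assumes sol: "filippov_solution fld T x" and t: "0 < t" "ereal t < T"
  defines "y \<equiv> \<lambda>t. Dscale lam (fst (x t))" and "\<omega> \<equiv> \<lambda>t. - kI * snd (x t)"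
  shows "(y has_vector_derivative lam *\<^sub>R (J (y t) + (\<rho> t * (kP * u0 (y t) + \<omega> t) + \<phi> t) *\<^sub>R e_last)) (at t)"
    and "y t \<noteq> 0 \<Longrightarrow> (\<omega> has_real_derivative lam * (- kI * g (y t))) (at t)"
proof -
  have bl: "bounded_linear (Dscale lam :: (real, 'n) vec \<Rightarrow> _)"
    using linear_Dscale by (simp add: linear_conv_bounded_linear)
  have "(y has_vector_derivative Dscale lam (A t (x t))) (at t)"
    unfolding y_def by (rule bounded_linear.has_vector_derivative[OF bl solution_regular(2)[OF sol t]])
  moreover have "Dscale lam (A t (x t)) = lam *\<^sub>R (J (y t) + (\<rho> t * (kP * u0 (y t) + \<omega> t) + \<phi> t) *\<^sub>R e_last)"
    unfolding A_def linear_add[OF linear_Dscale] Dscale_J Dscale_e_last y_def \<omega>_def u_st_def \<rho>_def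
    by (simp add: algebra_simps)
  ultimately show "(y has_vector_derivative lam *\<^sub>R (J (y t) + (\<rho> t * (kP * u0 (y t) + \<omega> t) + \<phi> t) *\<^sub>R e_last)) (at t)"
    by simp
  show "(\<omega> has_real_derivative lam * (- kI * g (y t))) (at t)" if "y t \<noteq> 0"
  proof -
    have nz: "fst (x t) \<noteq> 0" using that lam by (simp add: y_def)
    have "(\<omega> has_real_derivative - kI * (lam * g (y t))) (at t)"
      unfolding \<omega>_def y_def by (intro DERIV_cmult solution_regular(3)[OF sol t nz])
    then show ?thesis by (simp add: mult_ac)
  qed
qed

text \<open>
  Two choices of the integrator coordinate are used. Far from the origin, \<open>\<omega> = - kI * w\<close>: no derivative of
  \<open>\<gamma>\<close> or \<open>\<phi>\<close> appears, the factor \<open>\<rho> - 1\<close> is small by the assumption on \<open>\<gamma>m / \<gamma>M\<close>, and \<open>\<phi>\<close> is negligible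
  compared with \<open>sqrt W\<close> once \<open>M\<close> exceeds a constant \<open>R0\<close> that does not depend on \<open>lam\<close>. Hence \<open>\<omega>\<close> eventually
  stays bounded by a multiple of \<open>R0\<close>. From then on \<open>\<xi> = \<phi> + \<rho> * \<omega>\<close> is used: it contains the whole matched
  disturbance, and its derivative differs from the unperturbed one by \<open>(\<phi>' + \<gamma>' * \<omega> / \<gamma>d) / lam\<close>, which is
  small for large \<open>lam\<close> because \<open>\<omega>\<close> is bounded. In this second phase \<open>M\<close> reaches zero. With \<open>\<xi>\<close> alone the
  term \<open>\<gamma>' * \<omega>\<close> would not be small for large initial states.
\<close>
lemma finite_time_convergence:
  assumes lyap: "strict_lyapunov M b \<mu>" and LB: "loop_bound K"
    and small: "(1 - \<gamma>m / \<gamma>M) * K \<le> \<mu> / 2"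
    and large: "2 * (\<phi>bar + \<gamma>bar * (16 * \<phi>M / \<mu>) / \<gamma>m) / \<mu> \<le> lam"
    and sol: "filippov_solution fld T x"
  shows "bounded (x ` {t. 0 \<le> t \<and> ereal t < T})"
    and "T = \<infinity> \<Longrightarrow> \<exists>\<tau>\<ge>0. \<forall>t\<ge>\<tau>. fst (x t) = 0"
proof -
  note b = strict_lyapunovD(1)[OF lyap] and \<mu> = strict_lyapunovD(2,3)[OF lyap]
    and up = strict_lyapunovD(5)[OF lyap] and lo = strict_lyapunovD(6)[OF lyap]
    and phase = lyapunov_phase[OF lyap]
  have K: "K \<ge> 1" and Ku: "\<And>y \<eta>. \<bar>kP * u0 y\<bar> \<le> K * sqrt (W (y, \<eta>))"
    and Ku\<eta>: "\<And>y \<eta>. \<bar>kP * u0 y + \<eta>\<bar> \<le> K * sqrt (W (y, \<eta>))"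
    and Kg: "\<And>y. y \<noteq> 0 \<Longrightarrow> \<bar>kI * g y\<bar> \<le> K" using LB unfolding loop_bound_def by simp_all
  have S0: "sqrt (W q) \<ge> 0" for q using W_nonneg by simp
  have M0: "M q \<ge> 0" for q using lo[of q] S0[of q] by linarith
  define \<delta>0 where "\<delta>0 = 1 - \<gamma>m / \<gamma>M"
  have \<delta>0: "0 \<le> \<delta>0" "\<delta>0 * K \<le> \<mu> / 2" using gm \<gamma>M_ge small by (auto simp: \<delta>0_def)
  define R0 where "R0 = 4 * \<phi>M / \<mu>"
  have R0: "R0 \<ge> 0" using \<phi>_bound[of 0] \<mu> by (simp add: R0_def)
  define D0 where "D0 = \<phi>bar + \<gamma>bar * (4 * R0) / \<gamma>m"
  have D0lam: "D0 / lam \<le> \<mu> / 2"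
  proof -
    have "2 * D0 / \<mu> \<le> lam" using large by (simp add: D0_def R0_def)
    then show ?thesis using \<mu> lam by (simp add: field_simps)
  qed
  define y where "y t = Dscale lam (fst (x t))" for t
  define \<omega> where "\<omega> t = - kI * snd (x t)" for t
  define \<xi> where "\<xi> t = \<phi> t + \<rho> t * \<omega> t" for t
  have dy: "(y has_vector_derivative lam *\<^sub>R (J (y t) + (\<rho> t * (kP * u0 (y t) + \<omega> t) + \<phi> t) *\<^sub>R e_last)) (at t)"
    if "0 < t" "ereal t < T" for t
    using loop_coordinates(1)[OF sol that] unfolding y_def \<omega>_def .
  have d\<omega>: "(\<omega> has_real_derivative lam * (- kI * g (y t))) (at t)"
    if "0 < t" "ereal t < T" "y t \<noteq> 0" for t
    using loop_coordinates(2)[OF sol that(1,2)] that(3) unfolding y_def \<omega>_def .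
  have xc: "continuous_on {0..t} x" if "ereal t < T" for t using solution_regular(1)[OF sol that] .
  have yc: "continuous_on {s..t} y" if "0 \<le> s" "ereal t < T" for s t
    unfolding y_def by (intro Dscale_cont continuous_intros continuous_on_subset[OF xc[OF that(2)]]) (use that in auto)
  have \<omega>c: "continuous_on {s..t} \<omega>" if "0 \<le> s" "ereal t < T" for s t
    unfolding \<omega>_def by (intro continuous_intros continuous_on_subset[OF xc[OF that(2)]]) (use that in auto)
  have \<rho>1: "\<bar>\<rho> t - 1\<bar> \<le> \<delta>0" if "t \<ge> 0" for t using \<rho>_near_1[OF that] by (simp add: \<delta>0_def)
  have less: "ereal s < T" if "s \<le> t" "ereal t < T" for s t
    using that by (auto intro: le_less_trans[of "ereal s" "ereal t"])
  \<comment> \<open>In this coordinate only the chain is perturbed, by the gain mismatch \<open>\<rho> - 1\<close> and by \<open>\<phi>\<close>.\<close>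
  have far: "M (y t, \<omega> t) \<le> max R0 (M (y 0, \<omega> 0) - b * lam * (t - 0))" if t: "0 \<le> t" "ereal t < T" for t
  proof (rule phase[where N = "{}" and ?d1.0 = "\<lambda>t. (\<rho> t - 1) * (kP * u0 (y t) + \<omega> t) + \<phi> t", OF t(1) lam R0 yc \<omega>c])
    fix \<tau> assume \<tau>: "\<tau> \<in> {0<..<t}"
    then have \<tau>T: "ereal \<tau> < T" using less[of \<tau> t] t by auto
    show "\<bar>(\<rho> \<tau> - 1) * (kP * u0 (y \<tau>) + \<omega> \<tau>) + \<phi> \<tau>\<bar> \<le> \<mu> * sqrt (W (y \<tau>, \<omega> \<tau>))" if big: "R0 < M (y \<tau>, \<omega> \<tau>)"
    proof -
      let ?S = "sqrt (W (y \<tau>, \<omega> \<tau>))"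
      have "\<bar>(\<rho> \<tau> - 1) * (kP * u0 (y \<tau>) + \<omega> \<tau>)\<bar> \<le> \<delta>0 * (K * ?S)"
        unfolding abs_mult using \<rho>1[of \<tau>] Ku\<eta>[of "y \<tau>" "\<omega> \<tau>"] \<tau> \<delta>0 by (intro mult_mono) auto
      also have "\<dots> \<le> \<mu> / 2 * ?S" using mult_right_mono[OF \<delta>0(2) S0] by (simp add: mult.assoc)
      finally have 1: "\<bar>(\<rho> \<tau> - 1) * (kP * u0 (y \<tau>) + \<omega> \<tau>)\<bar> \<le> \<mu> / 2 * ?S" .
      have "R0 \<le> 2 * ?S" using big up[of "(y \<tau>, \<omega> \<tau>)"] by linarith
      then have "\<phi>M \<le> \<mu> / 2 * ?S" unfolding R0_def using \<mu> by (simp add: field_simps)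
      moreover have "\<bar>\<phi> \<tau>\<bar> \<le> \<phi>M" using \<phi>_bound \<tau> by simp
      ultimately show ?thesis using 1 by linarith
    qed
    show "(y has_vector_derivative lam *\<^sub>R (J (y \<tau>) + (kP * u0 (y \<tau>) + \<omega> \<tau> + ((\<rho> \<tau> - 1) * (kP * u0 (y \<tau>) + \<omega> \<tau>) + \<phi> \<tau>)) *\<^sub>R e_last)) (at \<tau>)"
      using dy[of \<tau>] \<tau> \<tau>T by (simp add: algebra_simps)
  next
    fix \<tau> assume \<tau>: "\<tau> \<in> {0<..<t} - {}" and nz: "y \<tau> \<noteq> 0"
    then have \<tau>T: "ereal \<tau> < T" using less[of \<tau> t] t by auto
    show "\<exists>d2. \<bar>d2\<bar> \<le> \<mu> \<and> (\<omega> has_real_derivative lam * (- kI * g (y \<tau>) + d2)) (at \<tau>)"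
      using d\<omega>[OF _ \<tau>T nz] \<tau> \<mu> by (intro exI[of _ 0]) auto
  qed (use t in auto)
  \<comment> \<open>Now \<open>\<phi>\<close> has left the chain. The derivative of \<open>\<xi>\<close> exists only off a null set, on which \<open>\<xi>\<close> is calm.\<close>
  have near: "M (y t, \<xi> t) \<le> max 0 (M (y s, \<xi> s) - b * lam * (t - s))"
    if st: "0 \<le> s" "s \<le> t" "ereal t < T" and small\<omega>: "\<And>\<tau>. s \<le> \<tau> \<Longrightarrow> \<tau> \<le> t \<Longrightarrow> M (y \<tau>, \<omega> \<tau>) \<le> R0" for s t
  proof -
    obtain N where N: "negligible N"
      and \<gamma>d: "\<And>t. t > 0 \<Longrightarrow> t \<notin> N \<Longrightarrow> \<exists>d. (\<gamma> has_real_derivative d) (at t) \<and> \<bar>d\<bar> \<le> \<gamma>bar"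
      and \<phi>d: "\<And>t. t > 0 \<Longrightarrow> t \<notin> N \<Longrightarrow> \<exists>d. (\<phi> has_real_derivative d) (at t) \<and> \<bar>d\<bar> \<le> \<phi>bar"
      by (rule rate_negligible[OF that])
    show ?thesis
    proof (rule phase[where ?d1.0 = "\<lambda>t. (\<rho> t - 1) * (kP * u0 (y t))", OF st(2) lam order_refl yc _ N])
      have "continuous_on {s..t} \<gamma>" "continuous_on {s..t} \<phi>"
        using \<gamma>_cont \<phi>_cont st by (auto elim: continuous_on_subset)
      then show "continuous_on {s..t} \<xi>" unfolding \<xi>_def \<rho>_def
        using \<gamma>d_pos by (intro continuous_intros \<omega>c) (use st in auto)
    next
      fix \<tau> assume \<tau>: "\<tau> \<in> {s<..<t}"
      let ?S = "sqrt (W (y \<tau>, \<xi> \<tau>))"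
      have "\<bar>(\<rho> \<tau> - 1) * (kP * u0 (y \<tau>))\<bar> \<le> \<delta>0 * (K * ?S)"
        unfolding abs_mult[of "\<rho> \<tau> - 1"] using \<rho>1[of \<tau>] Ku[of "y \<tau>" "\<xi> \<tau>"] \<tau> st \<delta>0 by (intro mult_mono) auto
      also have "\<dots> \<le> \<mu> / 2 * ?S" using mult_right_mono[OF \<delta>0(2) S0] by (simp add: mult.assoc)
      also have "\<dots> \<le> \<mu> * ?S" using \<mu> S0[of "(y \<tau>, \<xi> \<tau>)"] by (intro mult_right_mono) auto
      finally show "\<bar>(\<rho> \<tau> - 1) * (kP * u0 (y \<tau>))\<bar> \<le> \<mu> * ?S" .
      have \<tau>T: "ereal \<tau> < T" using less[of \<tau> t] \<tau> st by auto
      show "(y has_vector_derivative lam *\<^sub>R (J (y \<tau>) + (kP * u0 (y \<tau>) + \<xi> \<tau> + (\<rho> \<tau> - 1) * (kP * u0 (y \<tau>))) *\<^sub>R e_last)) (at \<tau>)"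
        using dy[of \<tau>] \<tau> \<tau>T st by (simp add: algebra_simps \<xi>_def)
    next
      fix \<tau> assume \<tau>: "\<tau> \<in> {s<..<t} - N" and nz: "y \<tau> \<noteq> 0"
      have \<tau>T: "0 < \<tau>" "ereal \<tau> < T" using less[of \<tau> t] \<tau> st by auto
      obtain \<gamma>' where \<gamma>': "(\<gamma> has_real_derivative \<gamma>') (at \<tau>)" "\<bar>\<gamma>'\<bar> \<le> \<gamma>bar" using \<gamma>d \<tau>T \<tau> by blast
      obtain \<phi>' where \<phi>': "(\<phi> has_real_derivative \<phi>') (at \<tau>)" "\<bar>\<phi>'\<bar> \<le> \<phi>bar" using \<phi>d \<tau>T \<tau> by blast
      define d2 where "d2 = (1 - \<rho> \<tau>) * (kI * g (y \<tau>)) + (\<phi>' + \<gamma>' / \<gamma>d * \<omega> \<tau>) / lam"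
      have "(\<xi> has_real_derivative (\<phi>' + (\<gamma>' / \<gamma>d * \<omega> \<tau> + lam * (- kI * g (y \<tau>)) * \<rho> \<tau>))) (at \<tau>)"
        unfolding \<xi>_def \<rho>_def
        by (intro DERIV_add DERIV_mult \<phi>'(1) DERIV_cdivide \<gamma>'(1) d\<omega>[OF \<tau>T nz])
      moreover have "\<phi>' + (\<gamma>' / \<gamma>d * \<omega> \<tau> + lam * (- kI * g (y \<tau>)) * \<rho> \<tau>) = lam * (- kI * g (y \<tau>) + d2)"
        unfolding d2_def using lam by (simp add: field_simps)
      ultimately have der: "(\<xi> has_real_derivative lam * (- kI * g (y \<tau>) + d2)) (at \<tau>)" by simp
      have "\<bar>(1 - \<rho> \<tau>) * (kI * g (y \<tau>))\<bar> \<le> \<delta>0 * K"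
        unfolding abs_mult[of "1 - \<rho> \<tau>"] using \<rho>1[of \<tau>] Kg[OF nz] \<tau>T \<delta>0 by (intro mult_mono) auto
      then have e1: "\<bar>(1 - \<rho> \<tau>) * (kI * g (y \<tau>))\<bar> \<le> \<mu> / 2" using \<delta>0(2) by linarith
      have "sqrt (W (y \<tau>, \<omega> \<tau>)) \<le> 2 * R0" using lo[of "(y \<tau>, \<omega> \<tau>)"] small\<omega>[of \<tau>] \<tau> by auto
      then have "\<bar>\<omega> \<tau>\<bar> \<le> 4 * R0" using abs_le_sqrt_W[of "\<omega> \<tau>" "y \<tau>"] by linarith
      then have "\<bar>\<gamma>' / \<gamma>d * \<omega> \<tau>\<bar> \<le> \<gamma>bar / \<gamma>m * (4 * R0)"
        unfolding abs_mult abs_divide using \<gamma>'(2) \<gamma>d_pos gm bars by (intro mult_mono frac_le) auto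
      moreover have "\<gamma>bar / \<gamma>m * (4 * R0) = \<gamma>bar * (4 * R0) / \<gamma>m" by simp
      ultimately have "\<bar>\<phi>' + \<gamma>' / \<gamma>d * \<omega> \<tau>\<bar> \<le> D0" unfolding D0_def using \<phi>'(2) by linarith
      then have "\<bar>(\<phi>' + \<gamma>' / \<gamma>d * \<omega> \<tau>) / lam\<bar> \<le> D0 / lam"
        unfolding abs_divide using lam by (simp add: divide_right_mono)
      then have "\<bar>d2\<bar> \<le> \<mu>" unfolding d2_def using e1 D0lam by linarith
      with der show "\<exists>d2. \<bar>d2\<bar> \<le> \<mu> \<and> (\<xi> has_real_derivative lam * (- kI * g (y \<tau>) + d2)) (at \<tau>)" by blast
    next
      fix \<tau> assume \<tau>: "\<tau> \<in> {s<..<t} \<inter> N" and nz: "y \<tau> \<noteq> 0"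
      have \<tau>T: "0 < \<tau>" "ereal \<tau> < T" using less[of \<tau> t] \<tau> st by auto
      have int: "\<tau> \<in> interior {0..}" using \<tau>T by simp
      have "calm_at \<gamma> \<tau>" "calm_at \<phi> \<tau>"
        using \<gamma>_lip \<phi>_lip calm_at_lipschitz int unfolding lipschitz_with_rate_def by blast+
      moreover have "((\<lambda>t. \<omega> t / \<gamma>d) has_real_derivative lam * (- kI * g (y \<tau>)) / \<gamma>d) (at \<tau>)"
        by (intro DERIV_cdivide d\<omega>[OF \<tau>T nz])
      ultimately have "calm_at (\<lambda>t. \<phi> t + \<gamma> t * (\<omega> t / \<gamma>d)) \<tau>"
        by (intro calm_at_add calm_at_mult)
      then show "calm_at \<xi> \<tau>" unfolding \<xi>_def \<rho>_def by simp
    qed (use st in auto)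
  qed
  define B where "B = max R0 (M (y 0, \<omega> 0))"
  have MB: "M (y t, \<omega> t) \<le> B" if "0 \<le> t" "ereal t < T" for t
  proof -
    have "b * lam * (t - 0) \<ge> 0" using b lam that by simp
    then show ?thesis using far[OF that] unfolding B_def by linarith
  qed
  show "bounded (x ` {t. 0 \<le> t \<and> ereal t < T})"
  proof -
    have B0: "B \<ge> 0" using R0 by (simp add: B_def)
    have ev: "V1 (y t) \<le> (2 * B)\<^sup>2 / kI" "\<bar>\<omega> t\<bar> \<le> 4 * B" if "0 \<le> t" "ereal t < T" for t
    proof -
      have S: "sqrt (W (y t, \<omega> t)) \<le> 2 * B" using lo[of "(y t, \<omega> t)"] MB[OF that] by linarith
      then show "\<bar>\<omega> t\<bar> \<le> 4 * B" using abs_le_sqrt_W[of "\<omega> t" "y t"] by linarith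
      have "W (y t, \<omega> t) \<le> (2 * B)\<^sup>2" by (rule sqrt_le_D[OF S])
      then have "kI * V1 (y t) \<le> (2 * B)\<^sup>2" unfolding W_def fst_conv snd_conv using zero_le_power2[of "\<omega> t"] by linarith
      then show "V1 (y t) \<le> (2 * B)\<^sup>2 / kI" using kI by (simp add: field_simps)
    qed
    obtain C where C: "\<And>z. V1 z \<le> (2 * B)\<^sup>2 / kI \<Longrightarrow> norm z \<le> C"
      using V1_sublevel_bounded unfolding bounded_iff by auto
    obtain e where e: "e > 0" "\<And>z::(real, 'n) vec. e * norm z \<le> norm (Dscale lam z)"
      using linear_inj_bounded_below_pos[OF linear_Dscale[of lam]] lam by (metis Dscale_eq_0 linear_Dscale linear_injective_0)
    show ?thesis
    proof (rule boundedI[of _ "C / e + 4 * B / kI"])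
      fix q assume "q \<in> x ` {t. 0 \<le> t \<and> ereal t < T}"
      then obtain t where t: "0 \<le> t" "ereal t < T" and q: "q = x t" by auto
      have "e * norm (fst q) \<le> C" using e(2)[of "fst q"] C[OF ev(1)[OF t]] unfolding q y_def by linarith
      then have "norm (fst q) \<le> C / e" using e(1) by (simp add: field_simps)
      moreover have "\<bar>snd q\<bar> \<le> 4 * B / kI" using ev(2)[OF t] kI unfolding q \<omega>_def by (simp add: abs_mult field_simps)
      ultimately show "norm q \<le> C / e + 4 * B / kI" using norm_Pair_le[of "fst q" "snd q"] by simp
    qed
  qed
  show "\<exists>\<tau>\<ge>0. \<forall>t\<ge>\<tau>. fst (x t) = 0" if T: "T = \<infinity>"
  proof -
    have inf: "ereal t < T" for t using T by simp
    define t1 where "t1 = M (y 0, \<omega> 0) / (b * lam)"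
    have t1: "t1 \<ge> 0" unfolding t1_def using M0 b lam by simp
    have R: "M (y t, \<omega> t) \<le> R0" if "t \<ge> t1" for t
    proof -
      have "M (y 0, \<omega> 0) \<le> b * lam * (t - 0)" using that b lam unfolding t1_def by (simp add: field_simps)
      then show ?thesis using far[of t, OF _ inf] that t1 R0 by simp
    qed
    define t2 where "t2 = t1 + M (y t1, \<xi> t1) / (b * lam)"
    have t2: "t2 \<ge> t1" unfolding t2_def using M0 b lam by simp
    have "fst (x t) = 0" if t: "t \<ge> t2" for t
    proof -
      have "M (y t1, \<xi> t1) \<le> b * lam * (t - t1)" using t b lam unfolding t2_def by (simp add: field_simps)
      then have "M (y t, \<xi> t) \<le> 0" using near[OF t1 _ inf, of t] R t t2 by simp
      then have "sqrt (W (y t, \<xi> t)) \<le> 0" using lo[of "(y t, \<xi> t)"] by linarith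
      then have "W (y t, \<xi> t) = 0" using W_nonneg[of "(y t, \<xi> t)"] by simp
      then have "y t = 0" unfolding W_eq_0 by (simp add: prod_eq_iff)
      then show ?thesis unfolding y_def using lam by simp
    qed
    then show ?thesis using t1 t2 by (intro exI[of _ t2]) auto
  qed
qed

end

section \<open>Continuation of closed-loop solutions\<close>

lemma bounded_ae_integrable_extension:
  fixes v :: "real \<Rightarrow> 'a::euclidean_space"
  assumes T: "T > 0" and int: "\<And>t. 0 \<le> t \<Longrightarrow> t < T \<Longrightarrow> v integrable_on {0..t}"
    and bnd: "\<And>t. norm (v t) \<le> B"
  shows "(\<lambda>t. if t < T then v t else 0) absolutely_integrable_on {0..T}"
proof -
  let ?v = "\<lambda>t. if t < T then v t else 0"
  have B: "B \<ge> 0" using bnd[of 0] norm_ge_zero order_trans by blast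
  define s where "s n = T - T / real (Suc n)" for n
  have s: "0 \<le> s n" "s n < T" for n using T by (auto simp: s_def field_simps)
  have slim: "s \<longlonglongrightarrow> T"
    using tendsto_diff[OF tendsto_const tendsto_mult_right_zero[OF LIMSEQ_inverse_real_of_nat, of T], of T]
    by (simp add: s_def[abs_def] divide_inverse)
  have "?v integrable_on {0..T}"
  proof (rule dominated_convergence(1)[where f = "\<lambda>n t. if t \<in> {0..s n} then v t else 0" and h = "\<lambda>_. B"])
    show "(\<lambda>t. if t \<in> {0..s n} then v t else 0) integrable_on {0..T}" for n
      using int[OF s[of n]] s[of n] unfolding integrable_restrict_Int
      by (simp add: Int_absorb2 Int_commute)
    show "(\<lambda>n. if t \<in> {0..s n} then v t else 0) \<longlonglongrightarrow> ?v t" if t: "t \<in> {0..T}" for t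
    proof (cases "t < T")
      case True
      have "\<forall>\<^sub>F n in sequentially. t < s n" using order_tendstoD(1)[OF slim True] .
      then have "\<forall>\<^sub>F n in sequentially. (if t \<in> {0..s n} then v t else 0) = ?v t"
        by eventually_elim (use t True in auto)
      then show ?thesis by (rule tendsto_eventually)
    next
      case False
      then have "\<not> t \<le> s n" for n using s(2)[of n] by linarith
      then have "(if t \<in> {0..s n} then v t else 0) = ?v t" for n using False by auto
      then show ?thesis by simp
    qed
  qed (use bnd B in auto)
  then show ?thesis
    by (rule absolutely_integrable_integrable_bound[where g = "\<lambda>_. B", rotated]) (use bnd B in auto)
qed

lemma continuous_on_short_time:
  fixes x :: "real \<Rightarrow> 'a::metric_space"
  assumes "continuous_on {a..b} x" "a < b" "e > 0"
  obtains h where "h > 0" "a + h \<le> b" "\<And>t. t \<in> {a..a + h} \<Longrightarrow> dist (x t) (x a) < e"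
proof -
  have "a \<in> {a..b}" using assms(2) by simp
  then obtain d where d: "d > 0" "\<And>t. t \<in> {a..b} \<Longrightarrow> dist t a < d \<Longrightarrow> dist (x t) (x a) < e"
    using assms(1,3) unfolding continuous_on_iff by blast
  show thesis
  proof (rule that[of "min (d / 2) (b - a)"])
    show "dist (x t) (x a) < e" if "t \<in> {a..a + min (d / 2) (b - a)}" for t
      using that d(1) by (intro d(2)) (auto simp: dist_real_def)
  qed (use d assms in auto)
qed

context perturbed_loop
begin

definition local_solution :: "real \<Rightarrow> (real, 'n) vec \<times> real \<Rightarrow> bool" where
  "local_solution T0 q \<longleftrightarrow> (\<exists>h>0. \<exists>x v N. negligible N \<and>
     (\<forall>t\<in>{T0..T0 + h}. v absolutely_integrable_on {T0..t} \<and> x t = q + integral {T0..t} v) \<and>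
     (\<forall>t\<in>{T0..<T0 + h} - N. v t \<in> filippov (fld t) (x t)))"

lemma A_bounded:
  assumes "a \<ge> 0"
  obtains B where "\<And>t q. t \<in> {a..b} \<Longrightarrow> q \<in> cball q0 r \<Longrightarrow> norm (A t q) \<le> B"
proof -
  have "compact ((\<lambda>(t, q). A t q) ` ({a..b} \<times> cball q0 r))"
    by (intro compact_continuous_image compact_Times continuous_on_subset[OF A_cont]) (use assms in auto)
  then obtain B where "\<forall>z\<in>(\<lambda>(t, q). A t q) ` ({a..b} \<times> cball q0 r). norm z \<le> B"
    using compact_imp_bounded bounded_iff by blast
  then show thesis by (intro that[of B]) force
qed

text \<open>
  It suffices to replace the discontinuous component of the field by a bounded function \<open>s\<close> that is
  continuous after time \<open>T0\<close>, provided that every solution of the modified equation stays, for a short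
  time, where \<open>s\<close> has the true value and the true field is continuous.
\<close>
lemma local_solution_from_selection:
  assumes T0: "T0 \<ge> 0"
    and sc: "continuous_on ({T0<..T0 + 1} \<times> UNIV) (\<lambda>(t, q). s t q)"
    and sb: "\<And>t q. t \<in> {T0..T0 + 1} \<Longrightarrow> \<bar>s t q\<bar> \<le> Bs"
    and agree: "\<And>x. continuous_on {T0..T0 + 1} x \<Longrightarrow> x T0 = q0 \<Longrightarrow>
      (\<And>t. t \<in> {T0..T0 + 1} \<Longrightarrow> ((\<lambda>r. A r (closest_point (cball q0 1) (x r))) has_integral fst (x t) - fst q0) {T0..t}) \<Longrightarrow>
      \<exists>h>0. \<forall>t. T0 < t \<and> t \<le> T0 + h \<longrightarrow> fst (x t) \<noteq> 0 \<and> s t (x t) = lam * g (Dscale lam (fst (x t)))"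
  shows "local_solution T0 q0"
proof -
  let ?B = "cball q0 1"
  let ?cp = "closest_point ?B"
  have cp: "continuous_on S ?cp" for S by (rule continuous_on_closest_point) auto
  have cpB: "?cp q \<in> ?B" for q by (rule closest_point_in_set) auto
  define f where "f t q = (A t (?cp q), s t q)" for t q
  obtain BA where BA: "\<And>t q. t \<in> {T0..T0 + 1} \<Longrightarrow> q \<in> ?B \<Longrightarrow> norm (A t q) \<le> BA" using A_bounded[OF T0] by blast
  have Acp: "continuous_on ({T0..T0 + 1} \<times> UNIV) (\<lambda>(t, q). A t (?cp q))"
  proof -
    have "continuous_on ({T0..T0 + 1} \<times> UNIV) (\<lambda>z. (\<lambda>(t, q). A t q) (fst z, ?cp (snd z)))"
      by (rule continuous_on_compose2[OF A_cont])
        (use T0 in \<open>auto intro!: continuous_intros continuous_on_compose2[OF cp]\<close>)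
    then show ?thesis by (simp add: split_beta)
  qed
  have fc: "continuous_on ({T0<..T0 + 1} \<times> UNIV) (\<lambda>(t, q). f t q)"
  proof -
    have "continuous_on ({T0<..T0 + 1} \<times> UNIV) (\<lambda>(t, q). A t (?cp q))"
      by (rule continuous_on_subset[OF Acp]) auto
    from continuous_on_Pair[OF this sc] show ?thesis by (simp add: f_def split_beta)
  qed
  have fb: "norm (f t q) \<le> BA + Bs" if "t \<in> {T0..T0 + 1}" for t q
    using norm_Pair_le[of "A t (?cp q)" "s t q"] BA[OF that cpB[of q]] sb[OF that, of q] by (simp add: f_def)
  obtain x where xc: "continuous_on {T0..T0 + 1} x" and x0: "x T0 = q0"
    and xi: "\<And>t. t \<in> {T0..T0 + 1} \<Longrightarrow> ((\<lambda>r. f r (x r)) has_integral (x t - q0)) {T0..t}"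
    using peano_bounded[OF fc fb, of q0] by (metis less_add_one)
  have "((\<lambda>r. A r (?cp (x r))) has_integral fst (x t) - fst q0) {T0..t}" if "t \<in> {T0..T0 + 1}" for t
    using has_integral_linear[OF xi[OF that] bounded_linear_fst] by (simp add: o_def f_def)
  from agree[OF xc x0 this] obtain h1 where h1: "h1 > 0"
    "\<And>t. T0 < t \<Longrightarrow> t \<le> T0 + h1 \<Longrightarrow> fst (x t) \<noteq> 0 \<and> s t (x t) = lam * g (Dscale lam (fst (x t)))" by auto
  obtain h2 where h2: "h2 > 0" "T0 + h2 \<le> T0 + 1" "\<And>t. t \<in> {T0..T0 + h2} \<Longrightarrow> dist (x t) (x T0) < 1"
    by (rule continuous_on_short_time[OF xc, of 1]) auto
  define h where "h = min h1 h2"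
  have h: "h > 0" "h \<le> h1" "h \<le> h2" using h1 h2 by (auto simp: h_def)
  show ?thesis unfolding local_solution_def
  proof (rule exI[of _ h], rule conjI[rotated], rule exI[of _ x], rule exI[of _ "\<lambda>r. f r (x r)"],
      rule exI[of _ "{T0}"], intro conjI ballI)
    fix t assume "t \<in> {T0..T0 + h}"
    then have t: "t \<in> {T0..T0 + 1}" using h h2 by auto
    show "(\<lambda>r. f r (x r)) absolutely_integrable_on {T0..t}"
      using t by (intro curve_integrable[OF fc fb xc]) auto
    show "x t = q0 + integral {T0..t} (\<lambda>r. f r (x r))"
      using integral_unique[OF xi[OF t]] by simp
  next
    fix t assume "t \<in> {T0..<T0 + h} - {T0}"
    then have t: "T0 < t" "t \<le> T0 + h1" "t \<in> {T0..T0 + h2}" using h by auto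
    have "x t \<in> ?B" using h2(3)[OF t(3)] x0 by (simp add: dist_commute)
    then have "f t (x t) = fld t (x t)" using h1(2)[OF t(1,2)] by (simp add: f_def fld_eq closest_point_self)
    then show "f t (x t) \<in> filippov (fld t) (x t)"
      using isCont_imp_filippov[OF fld_isCont[of t "x t"]] h1(2)[OF t(1,2)] t T0 by simp
  qed (use h in auto)
qed

lemma local_solution_regular:
  assumes T0: "T0 \<ge> 0" and nz: "fst q0 \<noteq> 0"
  shows "local_solution T0 q0"
proof -
  define r where "r = norm (fst q0) / 2"
  have r: "r > 0" using nz by (simp add: r_def)
  let ?B = "cball (fst q0) r"
  let ?cp = "closest_point ?B"
  have cp: "continuous_on S ?cp" for S using r by (intro continuous_on_closest_point) auto
  have cpB: "?cp q \<in> ?B" for q using r by (intro closest_point_in_set) auto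
  have B0: "0 \<notin> ?B" using nz by (simp add: r_def)
  obtain Bg where Bg: "\<And>z. \<bar>lam * g z\<bar> \<le> Bg" using g_bound by blast
  define s where "s t q = lam * g (Dscale lam (?cp (fst q)))" for t :: real and q :: "(real, 'n) vec \<times> real"
  show ?thesis
  proof (rule local_solution_from_selection[OF T0, of s])
    show "continuous_on ({T0<..T0 + 1} \<times> UNIV) (\<lambda>(t, q). s t q)"
      unfolding s_def split_beta
    proof (rule gD_cont)
      show "continuous_on ({T0<..T0 + 1} \<times> UNIV) (\<lambda>p. ?cp (fst (snd p)))"
        by (intro continuous_on_compose2[OF cp] continuous_intros) auto
      show "?cp (fst (snd p)) \<noteq> 0" for p using cpB[of "fst (snd p)"] B0 by auto
    qed
    show "\<bar>s t q\<bar> \<le> Bg" for t q unfolding s_def by (rule Bg)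
    fix x :: "real \<Rightarrow> (real, 'n) vec \<times> real" assume xc: "continuous_on {T0..T0 + 1} x" and x0: "x T0 = q0"
    obtain h where h: "h > 0" "\<And>t. t \<in> {T0..T0 + h} \<Longrightarrow> dist (x t) (x T0) < r"
      by (rule continuous_on_short_time[OF xc, of r]) (use r in auto)
    show "\<exists>h>0. \<forall>t. T0 < t \<and> t \<le> T0 + h \<longrightarrow> fst (x t) \<noteq> 0 \<and> s t (x t) = lam * g (Dscale lam (fst (x t)))"
    proof (intro exI[of _ h] conjI allI impI)
      fix t assume t: "T0 < t \<and> t \<le> T0 + h"
      have "dist (fst (x t)) (fst q0) < r" using h(2)[of t] t dist_fst_le[of "x t" "x T0"] x0 by auto
      then have "fst (x t) \<in> ?B" by (simp add: dist_commute)
      then show "fst (x t) \<noteq> 0" "s t (x t) = lam * g (Dscale lam (fst (x t)))"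
        using B0 by (auto simp: s_def closest_point_self)
    qed (rule h)
  qed
qed

text \<open>
  From a point with \<open>z = 0\<close> whose last coordinate has initial speed \<open>m \<noteq> 0\<close>, solutions leave the
  discontinuity set at once: for a short time \<open>\<sigma> * z\<^sub>r \<ge> \<bar>m\<bar> * (t - T0) / 2\<close> with \<open>\<sigma> = sgn m\<close>. Enforcing this lower
  bound in the argument of \<open>\<partial>\<^sub>r V1\<close> yields a field that is continuous for \<open>t > T0\<close> and unchanged along
  solutions.
\<close>
lemma local_solution_transversal:
  assumes T0: "T0 \<ge> 0" and z: "fst q0 = 0" and m: "A T0 q0 $ last_ix \<noteq> 0"
  shows "local_solution T0 q0"
proof -
  define m where "m = A T0 q0 $ last_ix"
  define \<sigma> where "\<sigma> = sgn m"
  have \<sigma>: "\<sigma> = 1 \<or> \<sigma> = -1" "\<sigma> * m = \<bar>m\<bar>" "\<bar>m\<bar> > 0" "\<sigma> * \<sigma> = 1"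
    using m by (auto simp: \<sigma>_def m_def sgn_if)
  let ?cp = "closest_point (cball q0 1)"
  have cp: "continuous_on S ?cp" for S by (rule continuous_on_closest_point) auto
  obtain Bg where Bg: "\<And>z. \<bar>lam * g z\<bar> \<le> Bg" using g_bound by blast
  define Z where "Z t z = z + (\<sigma> * max (\<sigma> * z $ last_ix) (\<bar>m\<bar> / 2 * (t - T0)) - z $ last_ix) *\<^sub>R e_last" for t :: real and z :: "(real, 'n) vec"
  have Z_nz: "Z t z \<noteq> 0" if "t > T0" for t z
  proof -
    have "\<sigma> * (Z t z $ last_ix) = max (\<sigma> * z $ last_ix) (\<bar>m\<bar> / 2 * (t - T0))"
      unfolding Z_def using \<sigma>(4) by (simp add: mult.assoc[symmetric])
    moreover have "\<bar>m\<bar> / 2 * (t - T0) > 0" using \<sigma>(3) that by simp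
    ultimately have "\<sigma> * (Z t z $ last_ix) > 0" by linarith
    then show ?thesis by auto
  qed
  define s where "s t q = lam * g (Dscale lam (Z t (fst q)))" for t :: real and q :: "(real, 'n) vec \<times> real"
  show ?thesis
  proof (rule local_solution_from_selection[OF T0, of s])
    show "continuous_on ({T0<..T0 + 1} \<times> UNIV) (\<lambda>(t, q). s t q)"
      unfolding s_def split_beta
    proof (rule gD_cont)
      show "continuous_on ({T0<..T0 + 1} \<times> UNIV) (\<lambda>p. Z (fst p) (fst (snd p)))"
        unfolding Z_def by (intro continuous_intros)
      show "Z (fst p) (fst (snd p)) \<noteq> 0" if "p \<in> {T0<..T0 + 1} \<times> UNIV" for p
        using that by (intro Z_nz) auto
    qed
    show "\<bar>s t q\<bar> \<le> Bg" for t q unfolding s_def by (rule Bg)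
    fix x :: "real \<Rightarrow> (real, 'n) vec \<times> real" assume xc: "continuous_on {T0..T0 + 1} x" and x0: "x T0 = q0"
      and xi: "\<And>t. t \<in> {T0..T0 + 1} \<Longrightarrow> ((\<lambda>r. A r (?cp (x r))) has_integral fst (x t) - fst q0) {T0..t}"
    have Ac: "continuous_on {T0..T0 + 1} (\<lambda>r. A r (?cp (x r)) $ last_ix)"
      by (intro continuous_on_component A_curve_cont continuous_on_compose2[OF cp xc]) (use T0 in auto)
    obtain h where h: "h > 0" "T0 + h \<le> T0 + 1"
      "\<And>r. r \<in> {T0..T0 + h} \<Longrightarrow> dist (A r (?cp (x r)) $ last_ix) (A T0 (?cp (x T0)) $ last_ix) < \<bar>m\<bar> / 2"
      by (rule continuous_on_short_time[OF Ac, of "\<bar>m\<bar> / 2"]) (use \<sigma>(3) in auto)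
    have A0: "A T0 (?cp (x T0)) $ last_ix = m" by (simp add: x0 m_def closest_point_self)
    have low: "\<bar>m\<bar> / 2 \<le> \<sigma> * (A r (?cp (x r)) $ last_ix)" if "r \<in> {T0..T0 + h}" for r
    proof -
      have d: "\<bar>A r (?cp (x r)) $ last_ix - m\<bar> < \<bar>m\<bar> / 2" using h(3)[OF that] A0 by (simp add: dist_real_def)
      show ?thesis using \<sigma>(1)
      proof
        assume s: "\<sigma> = 1"
        have "m = \<bar>m\<bar>" using \<sigma>(2) unfolding s by linarith
        then show ?thesis using d unfolding s by linarith
      next
        assume s: "\<sigma> = -1"
        have "- m = \<bar>m\<bar>" using \<sigma>(2) unfolding s by linarith
        then show ?thesis using d unfolding s by linarith
      qed
    qed
    have key: "\<bar>m\<bar> / 2 * (t - T0) \<le> \<sigma> * (fst (x t) $ last_ix)" if t: "T0 \<le> t" "t \<le> T0 + h" for t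
    proof -
      have "t \<in> {T0..T0 + 1}" using t h by auto
      from has_integral_linear[OF xi[OF this] bounded_linear_vec_nth[of last_ix]]
      have "((\<lambda>r. A r (?cp (x r)) $ last_ix) has_integral fst (x t) $ last_ix) {T0..t}"
        using z by (simp add: o_def)
      then have hi: "((\<lambda>r. \<sigma> * (A r (?cp (x r)) $ last_ix)) has_integral \<sigma> * (fst (x t) $ last_ix)) {T0..t}"
        by (rule has_integral_mult_right)
      have hc: "((\<lambda>r. \<bar>m\<bar> / 2) has_integral \<bar>m\<bar> / 2 * (t - T0)) {T0..t}"
        using has_integral_const_real[of "\<bar>m\<bar> / 2" T0 t] t by (simp add: mult.commute)
      show ?thesis by (rule has_integral_le[OF hc hi]) (use low t in auto)
    qed
    show "\<exists>h>0. \<forall>t. T0 < t \<and> t \<le> T0 + h \<longrightarrow> fst (x t) \<noteq> 0 \<and> s t (x t) = lam * g (Dscale lam (fst (x t)))"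
    proof (intro exI[of _ h] conjI allI impI)
      fix t assume t: "T0 < t \<and> t \<le> T0 + h"
      have "\<sigma> * max (\<sigma> * fst (x t) $ last_ix) (\<bar>m\<bar> / 2 * (t - T0)) = fst (x t) $ last_ix"
      proof -
        have "max (\<sigma> * fst (x t) $ last_ix) (\<bar>m\<bar> / 2 * (t - T0)) = \<sigma> * fst (x t) $ last_ix"
          by (rule max_absorb1) (use key[of t] t in auto)
        then show ?thesis using \<sigma>(4) by (metis mult.assoc mult_1)
      qed
      then have "Z t (fst (x t)) = fst (x t)" by (simp add: Z_def)
      then show "fst (x t) \<noteq> 0" "s t (x t) = lam * g (Dscale lam (fst (x t)))"
        using Z_nz[of t "fst (x t)"] t by (auto simp: s_def)
    qed (rule h)
  qed
qed

text \<open>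
  Approaching the origin along the two halves of the last axis produces the integrator speeds
  \<open>lam * V1 e\<^sub>r\<close> and \<open>- lam * V1 (- e\<^sub>r)\<close>; convexity gives everything in between.
\<close>
lemma filippov_origin:
  assumes t: "t \<ge> 0" and A0: "A t (0, w) = 0"
    and b: "\<bar>b\<bar> \<le> lam * min (V1 e_last) (V1 (- e_last))"
  shows "(0, b) \<in> filippov (fld t) (0, w)"
proof -
  have side: "(0, lam * (r * V1 (r *\<^sub>R e_last))) \<in> filippov (fld t) (0, w)" if r: "r = 1 \<or> r = -1" for r
  proof (rule filippov_limit)
    fix d e :: real assume d: "d > 0" and e: "e > 0"
    have "isCont (A t) (0, w)" by (rule isCont_slice[OF A_cont]) (use t in auto)
    then obtain d' where d': "d' > 0" "\<And>q. dist q (0, w) < d' \<Longrightarrow> dist (A t q) 0 < e"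
      using A0 e unfolding continuous_at_eps_delta by metis
    define s where "s = min d d' / 2"
    have s: "s > 0" "s < d" "s < d'" using d d' by (auto simp: s_def)
    let ?q = "((s * r) *\<^sub>R e_last, w) :: (real, 'n) vec \<times> real"
    have q: "dist ?q (0, w) = s" using r s by (auto simp: dist_Pair_Pair)
    have "fst ?q \<noteq> 0" using s r by auto
    then have 1: "isCont (fld t) ?q" by (intro fld_isCont t)
    have "g (Dscale lam ((s * r) *\<^sub>R e_last)) = r * V1 (r *\<^sub>R e_last)"
      using g_axis[of "lam * s" r] lam s r by (simp add: Dscale_e_last mult.assoc)
    then have "dist (fld t ?q) (0, lam * (r * V1 (r *\<^sub>R e_last))) = dist (A t ?q) 0"
      by (simp add: fld_eq dist_Pair_Pair)
    then have 2: "dist (fld t ?q) (0, lam * (r * V1 (r *\<^sub>R e_last))) < e" using d'(2)[of ?q] q s by simp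
    show "\<exists>q\<in>ball (0, w) d. isCont (fld t) q \<and> dist (fld t q) (0, lam * (r * V1 (r *\<^sub>R e_last))) < e"
      using 1 2 q s by (intro bexI[of _ ?q]) (auto simp: dist_commute)
  qed
  let ?p = "lam * V1 e_last" and ?m = "lam * V1 (- e_last)"
  have pm: "?p > 0" "?m > 0" using lam V1_pos[of e_last] V1_pos[of "- e_last"] by auto
  have b': "b \<le> ?p" "- ?m \<le> b"
    using b lam by (auto simp: abs_le_iff min_def split: if_splits)
      (smt (verit) mult_left_mono)+
  have ends: "(0, ?p) \<in> filippov (fld t) (0, w)" "(0, - ?m) \<in> filippov (fld t) (0, w)"
    using side[of 1] side[of "-1"] by auto
  define u where "u = (b + ?m) / (?p + ?m)"
  have u: "0 \<le> u" "u \<le> 1" unfolding u_def using b' pm by (auto simp: divide_le_eq_1)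
  have "(1 - u) *\<^sub>R (0, - ?m) + u *\<^sub>R (0, ?p) \<in> filippov (fld t) (0 :: (real, 'n) vec, w)"
    using convex_filippov[of "fld t" "(0, w)"] ends u unfolding convex_alt by blast
  moreover have "(1 - u) * (- ?m) + u * ?p = b"
  proof -
    have "u * (?p + ?m) = b + ?m" unfolding u_def using pm by simp
    then show ?thesis by (simp add: algebra_simps)
  qed
  ultimately show ?thesis by simp
qed

text \<open>
  From an equilibrium of the chain the solution stays at \<open>z = 0\<close>, with the integrator cancelling the disturbance
  exactly: \<open>w = \<gamma>d * \<phi> / (kI * \<gamma>)\<close>. This is admissible because the speed of this \<open>w\<close> is bounded independently
  of \<open>lam\<close>, while the interval of available speeds grows with \<open>lam\<close>.
\<close>
lemma local_solution_sliding:
  assumes T0: "T0 \<ge> 0" and z: "fst q0 = 0" and A0: "A T0 q0 = 0"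
    and rate: "\<gamma>d / kI * (\<phi>bar / \<gamma>m + \<phi>M * \<gamma>bar / \<gamma>m\<^sup>2) \<le> lam * min (V1 e_last) (V1 (- e_last))"
  shows "local_solution T0 q0"
proof -
  define w where "w t = \<gamma>d / kI * (\<phi> t / \<gamma> t)" for t
  have \<gamma>p: "\<gamma> t > 0" if "t \<ge> 0" for t using \<gamma>_bounds(1)[OF that] gm by linarith
  have A_w: "A t (0, w') = 0 \<longleftrightarrow> w' = w t" if "t \<ge> 0" for t w'
  proof -
    have "A t (0, w') = 0 \<longleftrightarrow> \<gamma> t * ((1 / \<gamma>d) * (- (kI * w'))) + \<phi> t = 0"
      by (simp add: A_def u_st_def)
    also have "\<dots> \<longleftrightarrow> w' = w t" using \<gamma>p[OF that] \<gamma>d_pos(1) kI unfolding w_def by (auto simp: field_simps)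
    finally show ?thesis .
  qed
  have w0: "q0 = (0, w T0)" using A_w[OF T0, of "snd q0"] A0 z by (metis prod.collapse)
  obtain L1 where L1: "L1-lipschitz_on {0..} \<gamma>" using \<gamma>_lip unfolding lipschitz_with_rate_def by blast
  obtain L2 where L2: "L2-lipschitz_on {0..} \<phi>" using \<phi>_lip unfolding lipschitz_with_rate_def by blast
  have \<phi>M0: "\<phi>M \<ge> 0" using \<phi>_bound[of 0] by simp
  have L0: "L1 \<ge> 0" "L2 \<ge> 0" using L1 L2 lipschitz_on_nonneg by auto
  have wlip: "(\<gamma>d / kI * ((L2 * \<gamma>M + \<phi>M * L1) / \<gamma>m\<^sup>2))-lipschitz_on {0..} w"
  proof (rule lipschitz_onI)
    fix s t :: real assume st: "s \<in> {0..}" "t \<in> {0..}"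
    have "\<phi> s / \<gamma> s - \<phi> t / \<gamma> t = ((\<phi> s - \<phi> t) * \<gamma> t + \<phi> t * (\<gamma> t - \<gamma> s)) / (\<gamma> s * \<gamma> t)"
      using \<gamma>p[of s] \<gamma>p[of t] st by (simp add: field_simps)
    then have "\<bar>\<phi> s / \<gamma> s - \<phi> t / \<gamma> t\<bar> = \<bar>(\<phi> s - \<phi> t) * \<gamma> t + \<phi> t * (\<gamma> t - \<gamma> s)\<bar> / (\<gamma> s * \<gamma> t)"
      using \<gamma>p[of s] \<gamma>p[of t] st by (simp add: abs_divide abs_mult)
    also have "\<dots> \<le> ((L2 * \<gamma>M + \<phi>M * L1) * \<bar>s - t\<bar>) / (\<gamma>m * \<gamma>m)"
    proof (rule frac_le)
      have "\<bar>(\<phi> s - \<phi> t) * \<gamma> t + \<phi> t * (\<gamma> t - \<gamma> s)\<bar> \<le> \<bar>\<phi> s - \<phi> t\<bar> * \<bar>\<gamma> t\<bar> + \<bar>\<phi> t\<bar> * \<bar>\<gamma> t - \<gamma> s\<bar>"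
        using abs_triangle_ineq unfolding abs_mult[symmetric] by blast
      also have "\<dots> \<le> (L2 * \<bar>s - t\<bar>) * \<gamma>M + \<phi>M * (L1 * \<bar>s - t\<bar>)"
        using lipschitz_onD[OF L1 st(2,1)] lipschitz_onD[OF L2 st] \<gamma>_bounds(2)[of t] \<gamma>p[of t] \<phi>_bound[of t] st L0
        by (intro add_mono mult_mono) (auto simp: dist_real_def abs_minus_commute)
      finally show "\<bar>(\<phi> s - \<phi> t) * \<gamma> t + \<phi> t * (\<gamma> t - \<gamma> s)\<bar> \<le> (L2 * \<gamma>M + \<phi>M * L1) * \<bar>s - t\<bar>"
        by (simp add: algebra_simps)
      show "\<gamma>m * \<gamma>m \<le> \<gamma> s * \<gamma> t" using \<gamma>_bounds(1)[of s] \<gamma>_bounds(1)[of t] gm st by (intro mult_mono) auto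
    qed (use gm L0 \<phi>M0 \<gamma>M_ge in auto)
    finally have "\<gamma>d / kI * \<bar>\<phi> s / \<gamma> s - \<phi> t / \<gamma> t\<bar> \<le> \<gamma>d / kI * (((L2 * \<gamma>M + \<phi>M * L1) * \<bar>s - t\<bar>) / (\<gamma>m * \<gamma>m))"
      using \<gamma>d_pos kI by (intro mult_left_mono) auto
    moreover have "dist (w s) (w t) = \<gamma>d / kI * \<bar>\<phi> s / \<gamma> s - \<phi> t / \<gamma> t\<bar>"
      unfolding w_def dist_real_def right_diff_distrib[symmetric] abs_mult using \<gamma>d_pos kI by simp
    ultimately show "dist (w s) (w t) \<le> \<gamma>d / kI * ((L2 * \<gamma>M + \<phi>M * L1) / \<gamma>m\<^sup>2) * dist s t"
      by (simp add: dist_real_def power2_eq_square)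
  qed (use \<gamma>d_pos kI L0 \<phi>M0 \<gamma>M_ge gm in auto)
  obtain N where N: "negligible N"
    and \<gamma>': "\<And>t. t > 0 \<Longrightarrow> t \<notin> N \<Longrightarrow> \<exists>d. (\<gamma> has_real_derivative d) (at t) \<and> \<bar>d\<bar> \<le> \<gamma>bar"
    and \<phi>': "\<And>t. t > 0 \<Longrightarrow> t \<notin> N \<Longrightarrow> \<exists>d. (\<phi> has_real_derivative d) (at t) \<and> \<bar>d\<bar> \<le> \<phi>bar"
    by (rule rate_negligible[OF that])
  have "\<exists>d. (w has_real_derivative d) (at t) \<and> \<bar>d\<bar> \<le> lam * min (V1 e_last) (V1 (- e_last))"
    if t: "t > 0" "t \<notin> N" for t
  proof -
    obtain a where a: "(\<gamma> has_real_derivative a) (at t)" "\<bar>a\<bar> \<le> \<gamma>bar" using \<gamma>' t by blast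
    obtain f where f: "(\<phi> has_real_derivative f) (at t)" "\<bar>f\<bar> \<le> \<phi>bar" using \<phi>' t by blast
    have gt: "\<gamma> t > 0" "\<gamma>m \<le> \<gamma> t" using \<gamma>p \<gamma>_bounds(1) t by auto
    have 1: "(w has_real_derivative \<gamma>d / kI * ((f * \<gamma> t - \<phi> t * a) / (\<gamma> t * \<gamma> t))) (at t)"
      unfolding w_def using gt by (intro DERIV_cmult DERIV_divide f(1) a(1)) auto
    have "(f * \<gamma> t - \<phi> t * a) / (\<gamma> t * \<gamma> t) = f / \<gamma> t - \<phi> t * a / (\<gamma> t)\<^sup>2"
      using gt by (simp add: diff_divide_distrib power2_eq_square)
    also have "\<bar>\<dots>\<bar> \<le> \<bar>f\<bar> / \<gamma> t + \<bar>\<phi> t\<bar> * \<bar>a\<bar> / (\<gamma> t)\<^sup>2"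
      using abs_triangle_ineq4[of "f / \<gamma> t" "\<phi> t * a / (\<gamma> t)\<^sup>2"] gt by (simp add: abs_divide abs_mult)
    also have "\<dots> \<le> \<phi>bar / \<gamma>m + \<phi>M * \<gamma>bar / \<gamma>m\<^sup>2"
      using gt gm f(2) a(2) \<phi>_bound[of t] t \<phi>M0
      by (intro add_mono frac_le mult_mono power_mono) (auto intro: order_trans[OF abs_ge_zero])
    finally have "\<gamma>d / kI * \<bar>(f * \<gamma> t - \<phi> t * a) / (\<gamma> t * \<gamma> t)\<bar> \<le> \<gamma>d / kI * (\<phi>bar / \<gamma>m + \<phi>M * \<gamma>bar / \<gamma>m\<^sup>2)"
      using \<gamma>d_pos kI by (intro mult_left_mono) auto
    then have "\<bar>\<gamma>d / kI * ((f * \<gamma> t - \<phi> t * a) / (\<gamma> t * \<gamma> t))\<bar> \<le> lam * min (V1 e_last) (V1 (- e_last))"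
      using rate \<gamma>d_pos kI unfolding abs_mult[of "\<gamma>d / kI"] by simp
    with 1 show ?thesis by blast
  qed
  then obtain w' where w': "\<And>t. t > 0 \<Longrightarrow> t \<notin> N \<Longrightarrow> (w has_real_derivative w' t) (at t)"
    "\<And>t. t > 0 \<Longrightarrow> t \<notin> N \<Longrightarrow> \<bar>w' t\<bar> \<le> lam * min (V1 e_last) (V1 (- e_last))" by metis
  show ?thesis unfolding local_solution_def
  proof (rule exI[of _ 1], rule conjI[rotated], rule exI[of _ "\<lambda>t. (0, w t)"], rule exI[of _ "\<lambda>t. (0, w' t)"],
      rule exI[of _ "insert T0 N"], intro conjI ballI)
    fix t assume t: "t \<in> {T0..T0 + 1}"
    have lip: "(\<gamma>d / kI * ((L2 * \<gamma>M + \<phi>M * L1) / \<gamma>m\<^sup>2))-lipschitz_on {T0..t} w"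
      by (rule lipschitz_on_subset[OF wlip]) (use T0 in auto)
    have "T0 \<le> t" using t by simp
    note ftc = lipschitz_has_integral_derivative[OF lip \<open>T0 \<le> t\<close> N w'(1)]
    have ai: "w' absolutely_integrable_on {T0..t}" by (rule ftc(2)) (use T0 in auto)
    have hi: "(w' has_integral w t - w T0) {T0..t}" by (rule ftc(1)) (use T0 in auto)
    have blp: "bounded_linear (\<lambda>r::real. (0 :: (real, 'n) vec, r))"
      by (intro bounded_linear_Pair bounded_linear_zero bounded_linear_ident)
    from absolutely_integrable_linear[OF ai blp]
    show "(\<lambda>t. (0 :: (real, 'n) vec, w' t)) absolutely_integrable_on {T0..t}" by (simp add: o_def)
    from has_integral_linear[OF hi blp]
    have "integral {T0..t} (\<lambda>t. (0 :: (real, 'n) vec, w' t)) = (0, w t - w T0)" by (intro integral_unique) (simp add: o_def)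
    then show "(0, w t) = q0 + integral {T0..t} (\<lambda>t. (0, w' t))" by (simp add: w0)
  next
    fix t assume "t \<in> {T0..<T0 + 1} - insert T0 N"
    then show "(0, w' t) \<in> filippov (fld t) (0, w t)"
      using T0 A_w[of t "w t"] w'(2)[of t] by (intro filippov_origin) auto
  qed (use N in auto)
qed

lemma local_solution_exists:
  assumes "T0 \<ge> 0"
    and "\<gamma>d / kI * (\<phi>bar / \<gamma>m + \<phi>M * \<gamma>bar / \<gamma>m\<^sup>2) \<le> lam * min (V1 e_last) (V1 (- e_last))"
  shows "local_solution T0 q0"
proof (cases "fst q0 = 0")
  case False then show ?thesis using local_solution_regular assms by blast
next
  case True
  then have A: "A T0 q0 = (A T0 q0 $ last_ix) *\<^sub>R e_last" by (simp add: A_def)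
  show ?thesis
  proof (cases "A T0 q0 $ last_ix = 0")
    case True
    then have "A T0 q0 = 0" using A by simp
    then show ?thesis using local_solution_sliding assms \<open>fst q0 = 0\<close> by blast
  next
    case False then show ?thesis using local_solution_transversal assms \<open>fst q0 = 0\<close> by blast
  qed
qed

text \<open>
  A bounded solution on \<open>[0,T0)\<close> has bounded velocity, hence a limit at \<open>T0\<close>, where a local solution can be
  attached. Maximal solutions that stay bounded therefore exist for all times.
\<close>
lemma continuation:
  assumes sol: "filippov_solution fld (ereal T0) x"
    and bdd: "bounded (x ` {t. 0 \<le> t \<and> t < T0})"
    and rate: "\<gamma>d / kI * (\<phi>bar / \<gamma>m + \<phi>M * \<gamma>bar / \<gamma>m\<^sup>2) \<le> lam * min (V1 e_last) (V1 (- e_last))"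
  shows "\<exists>T'>ereal T0. \<exists>y. filippov_solution fld T' y \<and> (\<forall>t\<ge>0. ereal t < ereal T0 \<longrightarrow> y t = x t)"
proof -
  obtain v where v0: "\<forall>t\<ge>0. ereal t < ereal T0 \<longrightarrow> v absolutely_integrable_on {0..t} \<and> x t = x 0 + integral {0..t} v"
    and ae: "AE t in lebesgue. 0 \<le> t \<and> ereal t < ereal T0 \<longrightarrow> v t \<in> filippov (fld t) (x t)"
    and "0 < ereal T0"
    using sol unfolding filippov_solution_def by blast
  have T0: "0 < T0" using \<open>0 < ereal T0\<close> by simp
  have v: "v absolutely_integrable_on {0..t} \<and> x t = x 0 + integral {0..t} v" if "t \<ge> 0" "t < T0" for t
    using v0 that less_ereal.simps(1)[of t T0] by blast
  obtain N where vN: "\<And>t. t \<in> space lebesgue - N \<Longrightarrow> 0 \<le> t \<and> ereal t < ereal T0 \<longrightarrow> v t \<in> filippov (fld t) (x t)"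
    and "N \<in> null_sets lebesgue" by (rule AE_E3[OF ae that])
  then have N: "negligible N" by (simp add: negligible_iff_null_sets)
  obtain R where R: "\<And>t. 0 \<le> t \<Longrightarrow> t < T0 \<Longrightarrow> norm (x t) \<le> R" using bdd unfolding bounded_iff by auto
  obtain BA where BA: "\<And>t q. t \<in> {0..T0} \<Longrightarrow> q \<in> cball 0 R \<Longrightarrow> norm (A t q) \<le> BA" using A_bounded[of 0] by blast
  obtain Bg where Bg: "Bg > 0" "\<And>z. \<bar>lam * g z\<bar> \<le> Bg" using g_bound by blast
  define v1 where "v1 t = (if t \<in> N \<or> t < 0 \<or> T0 \<le> t then 0 else v t)" for t
  have v1b: "norm (v1 t) \<le> \<bar>BA\<bar> + Bg" for t
  proof (cases "t \<in> N \<or> t < 0 \<or> T0 \<le> t")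
    case False
    then have t: "0 \<le> t" "t < T0" "v t \<in> filippov (fld t) (x t)" using vN[of t] by auto
    have "norm (fst (v t)) \<le> BA" using filippov_fld(1)[OF t(1,3)] BA[of t "x t"] R[OF t(1,2)] t by simp
    moreover have "\<bar>snd (v t)\<bar> \<le> Bg" by (rule filippov_fld(3)[OF t(1,3) Bg(2)])
    ultimately show ?thesis using norm_Pair_le[of "fst (v t)" "snd (v t)"] False by (simp add: v1_def)
  qed (use Bg in \<open>auto simp: v1_def\<close>)
  have spike: "v1 integrable_on {0..t}" "integral {0..t} v1 = integral {0..t} v" if "0 \<le> t" "t < T0" for t
  proof -
    have "v integrable_on {0..t}" using v[OF that] by (simp add: absolutely_integrable_on_def)
    then show "v1 integrable_on {0..t}" by (rule integrable_spike[OF _ N]) (use that in \<open>auto simp: v1_def\<close>)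
    show "integral {0..t} v1 = integral {0..t} v" by (rule integral_spike[OF N]) (use that in \<open>auto simp: v1_def\<close>)
  qed
  have v1T: "v1 absolutely_integrable_on {0..T0}"
  proof -
    have "(\<lambda>t. if t < T0 then v1 t else 0) = v1" by (auto simp: v1_def)
    then show ?thesis using bounded_ae_integrable_extension[OF T0 spike(1) v1b] by simp
  qed
  define q0 where "q0 = x 0 + integral {0..T0} v1"
  obtain h x2 v2 N2 where h: "h > 0" and N2: "negligible N2"
    and x2: "\<And>t. t \<in> {T0..T0 + h} \<Longrightarrow> v2 absolutely_integrable_on {T0..t} \<and> x2 t = q0 + integral {T0..t} v2"
    and v2: "\<And>t. t \<in> {T0..<T0 + h} - N2 \<Longrightarrow> v2 t \<in> filippov (fld t) (x2 t)"
    using local_solution_exists[OF less_imp_le[OF T0] rate, of q0] unfolding local_solution_def by blast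
  define u where "u t = (if t < T0 then v1 t else v2 t)" for t
  define y where "y t = (if t < T0 then x t else x2 t)" for t
  have u1: "u absolutely_integrable_on {0..T0}"
    by (rule absolutely_integrable_spike[OF v1T negligible_sing[of T0]]) (auto simp: u_def)
  have iu1: "integral {0..T0} u = integral {0..T0} v1"
    by (rule integral_spike[OF negligible_sing[of T0]]) (auto simp: u_def)
  have y0: "y 0 = x 0" using T0 by (simp add: y_def)
  have main: "u absolutely_integrable_on {0..t} \<and> y t = y 0 + integral {0..t} u" if t: "t \<ge> 0" "t < T0 + h" for t
  proof (cases "t < T0")
    case True
    have "u absolutely_integrable_on {0..t}" by (rule absolutely_integrable_on_subinterval[OF u1]) (use True in auto)
    moreover have "integral {0..t} u = integral {0..t} v1"
      by (rule hk_integral_cong) (use True in \<open>auto simp: u_def\<close>)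
    ultimately show ?thesis using v[OF t(1) True] spike(2)[OF t(1) True] True y0 by (simp add: y_def)
  next
    case False
    then have tT: "t \<in> {T0..T0 + h}" using t by auto
    have "v2 absolutely_integrable_on {T0..t}" using x2[OF tT] by simp
    then have u2: "u absolutely_integrable_on {T0..t}"
      by (rule absolutely_integrable_spike[OF _ negligible_empty]) (auto simp: u_def)
    have iu2: "integral {T0..t} u = integral {T0..t} v2"
      by (rule hk_integral_cong) (auto simp: u_def)
    have "u absolutely_integrable_on ({0..T0} \<union> {T0..t})" by (rule absolutely_integrable_Un[OF u1 u2])
    moreover have "{0..T0} \<union> {T0..t} = {0..t}" using False T0 by auto
    ultimately have ut: "u absolutely_integrable_on {0..t}" by simp
    then have "integral {0..T0} u + integral {T0..t} u = integral {0..t} u"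
      using False T0 by (intro hk_integral_combine) (auto simp: absolutely_integrable_on_def)
    then have "integral {0..t} u = integral {0..T0} v1 + integral {T0..t} v2" using iu1 iu2 by simp
    then show ?thesis using x2[OF tT] False ut y0 by (simp add: y_def q0_def add.assoc)
  qed
  have "filippov_solution fld (ereal (T0 + h)) y"
    unfolding filippov_solution_def
  proof (intro conjI exI[of _ u] allI impI)
    fix t assume "0 \<le> t" "ereal t < ereal (T0 + h)"
    then show "u absolutely_integrable_on {0..t}" "y t = y 0 + integral {0..t} u" using main[of t] by auto
  next
    have "AE t in lebesgue. t \<notin> N \<union> N2"
      using N N2 by (intro AE_not_in) (simp add: negligible_iff_null_sets[symmetric])
    then show "AE t in lebesgue. 0 \<le> t \<and> ereal t < ereal (T0 + h) \<longrightarrow> u t \<in> filippov (fld t) (y t)"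
    proof (rule AE_mp, intro AE_I2 impI)
      fix t assume t: "t \<notin> N \<union> N2" "0 \<le> t \<and> ereal t < ereal (T0 + h)"
      show "u t \<in> filippov (fld t) (y t)"
      proof (cases "t < T0")
        case True then show ?thesis using vN[of t] t by (simp add: u_def y_def v1_def)
      next
        case False then show ?thesis using v2[of t] t by (simp add: u_def y_def)
      qed
    qed
  qed (use T0 h in simp)
  then show ?thesis using h by (intro exI[of _ "ereal (T0 + h)"] conjI exI[of _ y]) (auto simp: y_def)
qed

end

theorem proposition1:
  fixes \<kappa> p c \<alpha> kP kI :: real
    and u0 V1 :: "real ^ 'n::{finite,linorder} \<Rightarrow> real"
  assumes "\<kappa> < 0" and "p > 0" and "p + (real CARD('n) + 1) * \<kappa> = 0"
    and "continuous_on UNIV u0"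
    and "homogeneous_on p \<kappa> UNIV (wt p \<kappa> (CARD('n) + 1)) u0"
    and "finite_time_stable (nominal u0)"
    and "homogeneous_field p \<kappa> \<kappa> (nominal u0)"
    and "continuous_on UNIV V1"
    and "V1 0 = 0" and "\<forall>z. z \<noteq> 0 \<longrightarrow> V1 z > 0"
    and "C1_on (- {0}) V1"
    and "homogeneous_on p \<kappa> UNIV (2 * wt p \<kappa> (CARD('n) + 1)) V1"
    and "c > 0" and "0 < \<alpha>" and "\<alpha> < 1"
    and "\<forall>T z t. filippov_solution (\<lambda>_. nominal u0) T z \<longrightarrow> 0 < t \<longrightarrow> ereal t < T \<longrightarrow> z t \<noteq> 0 \<longrightarrow>
           (\<exists>d. ((\<lambda>s. V1 (z s)) has_real_derivative d) (at t) \<and> d \<le> - c * V1 (z t) powr \<alpha>)"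
    and "\<exists>q\<ge>0. homogeneous_on p \<kappa> (- {0}) q (partial_last V1)"
    and "\<forall>z. partial_last V1 z * u0 z \<le> 0"
    and "kP \<ge> 1" and "kI > 0"
  shows "\<exists>\<delta>0. 0 < \<delta>0 \<and> \<delta>0 < 1 \<and>
    (\<forall>\<gamma>m \<gamma>M \<gamma>bar \<phi>bar \<phi>M :: real.
       0 < \<gamma>m \<and> \<gamma>m \<le> \<gamma>M \<and> 0 \<le> \<gamma>bar \<and> 0 \<le> \<phi>bar \<and> 0 \<le> \<phi>M \<and> 1 - \<gamma>m / \<gamma>M \<le> \<delta>0 \<longrightarrow>
       (\<exists>lam0>0. \<forall>lam\<ge>lam0. \<forall>\<gamma> \<phi> :: real \<Rightarrow> real.
          lipschitz_with_rate \<gamma>bar \<gamma> \<and> lipschitz_with_rate \<phi>bar \<phi> \<and>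
          (\<forall>t\<ge>0. \<gamma>m \<le> \<gamma> t \<and> \<gamma> t \<le> \<gamma>M \<and> \<bar>\<phi> t\<bar> \<le> \<phi>M) \<longrightarrow>
          (\<forall>T x. trajectory (closed_loop ((\<gamma>M + \<gamma>m) / 2) kP kI lam u0 V1 \<gamma> \<phi>) T x \<and> snd (x 0) = 0 \<longrightarrow>
             T = \<infinity> \<and>
             (\<exists>\<tau>\<ge>0. \<forall>t\<ge>\<tau>. fst (x t) = 0) \<and>
             continuous_on {0..}
               (\<lambda>t. u_st ((\<gamma>M + \<gamma>m) / 2) kP kI lam u0 (fst (x t)) (snd (x t))))))"
proof -
  interpret homogeneous_chain \<kappa> p c \<alpha> kP kI u0 V1
    by unfold_locales (use assms in blast)+
  obtain M b \<mu> where lyap: "strict_lyapunov M b \<mu>" using strict_lyapunov_exists by blast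
  obtain K where LB: "loop_bound K" using loop_bound_exists by blast
  have \<mu>: "\<mu> > 0" using strict_lyapunovD(2)[OF lyap] .
  have K: "K \<ge> 1" using LB by (simp add: loop_bound_def)
  \<comment> \<open>With this choice the gain mismatch uses up at most half of the margin \<open>\<mu>\<close>.\<close>
  define \<delta>0 where "\<delta>0 = min (1 / 2) (\<mu> / (2 * K))"
  have \<delta>0: "0 < \<delta>0" "\<delta>0 < 1" using \<mu> K by (auto simp: \<delta>0_def)
  show ?thesis
  proof (rule exI[of _ \<delta>0], intro conjI \<delta>0 allI impI)
    fix \<gamma>m \<gamma>M \<gamma>bar \<phi>bar \<phi>M :: real
    assume c: "0 < \<gamma>m \<and> \<gamma>m \<le> \<gamma>M \<and> 0 \<le> \<gamma>bar \<and> 0 \<le> \<phi>bar \<and> 0 \<le> \<phi>M \<and> 1 - \<gamma>m / \<gamma>M \<le> \<delta>0"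
    have "1 - \<gamma>m / \<gamma>M \<le> \<mu> / (2 * K)" using c by (auto simp: \<delta>0_def)
    then have small: "(1 - \<gamma>m / \<gamma>M) * K \<le> \<mu> / 2" using K by (simp add: field_simps)
    define rate where "rate = (\<gamma>M + \<gamma>m) / 2 / kI * (\<phi>bar / \<gamma>m + \<phi>M * \<gamma>bar / \<gamma>m\<^sup>2)"
    define m where "m = min (V1 e_last) (V1 (- e_last))"
    have m: "m > 0" unfolding m_def using V1_pos[of e_last] V1_pos[of "- e_last"] by simp
    \<comment> \<open>The second entry permits sliding at the origin, the third makes the second phase converge.\<close>
    define lam0 where "lam0 = max 1 (max (rate / m) (2 * (\<phi>bar + \<gamma>bar * (16 * \<phi>M / \<mu>) / \<gamma>m) / \<mu>))"
    have lam0: "lam0 > 0" "rate / m \<le> lam0" "2 * (\<phi>bar + \<gamma>bar * (16 * \<phi>M / \<mu>) / \<gamma>m) / \<mu> \<le> lam0"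
      unfolding lam0_def by (rule less_le_trans[OF zero_less_one max.cobounded1], simp_all)
    show "\<exists>lam0>0. \<forall>lam\<ge>lam0. \<forall>\<gamma> \<phi> :: real \<Rightarrow> real.
        lipschitz_with_rate \<gamma>bar \<gamma> \<and> lipschitz_with_rate \<phi>bar \<phi> \<and>
        (\<forall>t\<ge>0. \<gamma>m \<le> \<gamma> t \<and> \<gamma> t \<le> \<gamma>M \<and> \<bar>\<phi> t\<bar> \<le> \<phi>M) \<longrightarrow>
        (\<forall>T x. trajectory (closed_loop ((\<gamma>M + \<gamma>m) / 2) kP kI lam u0 V1 \<gamma> \<phi>) T x \<and> snd (x 0) = 0 \<longrightarrow>
           T = \<infinity> \<and>
           (\<exists>\<tau>\<ge>0. \<forall>t\<ge>\<tau>. fst (x t) = 0) \<and>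
           continuous_on {0..}
             (\<lambda>t. u_st ((\<gamma>M + \<gamma>m) / 2) kP kI lam u0 (fst (x t)) (snd (x t))))"
    proof (rule exI[of _ lam0], rule conjI[OF lam0(1)], intro allI impI)
      fix lam :: real and \<gamma> \<phi> :: "real \<Rightarrow> real" and T x
      assume lam: "lam0 \<le> lam"
        and pert: "lipschitz_with_rate \<gamma>bar \<gamma> \<and> lipschitz_with_rate \<phi>bar \<phi> \<and>
          (\<forall>t\<ge>0. \<gamma>m \<le> \<gamma> t \<and> \<gamma> t \<le> \<gamma>M \<and> \<bar>\<phi> t\<bar> \<le> \<phi>M)"
        and traj: "trajectory (closed_loop ((\<gamma>M + \<gamma>m) / 2) kP kI lam u0 V1 \<gamma> \<phi>) T x \<and> snd (x 0) = 0"
      interpret P: perturbed_loop \<kappa> p c \<alpha> kP kI u0 V1 \<gamma>m \<gamma>M \<gamma>bar \<phi>bar \<phi>M lam \<gamma> \<phi>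
        by unfold_locales (use c pert lam lam0 in auto)
      have sol: "filippov_solution P.fld T x"
        and maximal: "\<not> (\<exists>T'>T. \<exists>y. filippov_solution P.fld T' y \<and> (\<forall>t\<ge>0. ereal t < T \<longrightarrow> y t = x t))"
        using traj unfolding trajectory_def P.\<gamma>d_def by blast+
      have bdd: "bounded (x ` {t. 0 \<le> t \<and> ereal t < T})"
        and fin: "T = \<infinity> \<longrightarrow> (\<exists>\<tau>\<ge>0. \<forall>t\<ge>\<tau>. fst (x t) = 0)"
        using P.finite_time_convergence[OF lyap LB small _ sol] lam lam0(3) by auto
      have "rate \<le> lam * m" using order_trans[OF lam0(2) lam] m by (simp add: pos_divide_le_eq)
      then have rate: "P.\<gamma>d / kI * (\<phi>bar / \<gamma>m + \<phi>M * \<gamma>bar / \<gamma>m\<^sup>2) \<le> lam * min (V1 e_last) (V1 (- e_last))"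
        unfolding rate_def m_def P.\<gamma>d_def .
      have T: "T = \<infinity>"
      proof (cases T)
        case (real T0)
        then have "bounded (x ` {t. 0 \<le> t \<and> t < T0})" using bdd by simp
        from P.continuation[OF sol[unfolded real] this rate] maximal show ?thesis unfolding real by blast
      next
        case MInf
        then show ?thesis using sol unfolding filippov_solution_def by simp
      qed
      have "continuous_on {0..} x"
        unfolding continuous_on_eq_continuous_within
      proof
        fix t :: real assume t: "t \<in> {0..}"
        have "continuous_on {0..t + 1} x" by (rule P.solution_regular(1)[OF sol]) (simp add: T)
        then have "continuous (at t within {0..t + 1}) x"
          using t by (simp add: continuous_on_eq_continuous_within)
        moreover have "at t within {0..t + 1} = at t within {0..}"
          by (rule at_within_nhd[of _ "{..<t + 1}"]) auto
        ultimately show "continuous (at t within {0..}) x" by (simp add: continuous_within)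
      qed
      then have "continuous_on {0..} (\<lambda>t. u_st ((\<gamma>M + \<gamma>m) / 2) kP kI lam u0 (fst (x t)) (snd (x t)))"
        unfolding u_st_def
        by (intro continuous_intros P.Dscale_cont continuous_on_compose2[OF u0_cont]) auto
      then show "T = \<infinity> \<and> (\<exists>\<tau>\<ge>0. \<forall>t\<ge>\<tau>. fst (x t) = 0) \<and>
           continuous_on {0..} (\<lambda>t. u_st ((\<gamma>M + \<gamma>m) / 2) kP kI lam u0 (fst (x t)) (snd (x t)))"
        using T fin by simp
    qed
  qed
qed

end
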